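(* For every $l\in\mathbb N$, the image of the set $\widehat{\mathrm{SI}}_l\subset\mathbb C^2_{(\mu,r)}$ under the map $(\mu,r)\mapsto(\mu,r^2)$ is an irreducible algebraic curve. Moreover, the algebraic set $\widehat{\mathrm{SI}}_l$ consists of exactly two irreducible components, namely the algebraic curves $\widehat{\mathrm{SI}}_{l,+}$ and $\widehat{\mathrm{SI}}_{l,-}$.
   Context: Fix $\omega>0$. For $(B,A)\in\mathbb R^2$ consider $\frac{d\varphi}{dt}=-\sin\varphi+B+A\cos\omega t$; with $\tau=\omega t$, $l=B/\omega$, $\mu=A/(2\omega)$ this gives the vector field $\dot\varphi=-\frac{\sin\varphi}{\omega}+l+2\mu\cos\tau$, $\dot\tau=1$ on the torus $\mathbb R^2/2\pi\mathbb Z^2$. The rotation number is $\rho(B,A;\omega)=\lim_{k\to+\infty}\varphi(2\pi k)/(2\pi k)$; for $s\in\mathbb Z$, $L_s(\omega)=\{\rho=s\}$ is the phase-lock area. The Poincaré map $h_{(B,A)}$ is the time-$2\pi$ flow map on the circle $\{\tau=0\}$. $\partial L_{s,\pm}(\omega)$ denotes the set of points of $L_s(\omega)$ at which $h_{(B,A)}$ fixes $\pm\frac\pi2\pmod{2\pi}$; $\partial L_s=\partial L_{s,+}\cup\partial L_{s,-}$. A point of some $L_s$ at which $h_{(B,A)}$ is the identity is called a growth point if $A=0$ and a constriction if $A\neq0$. The axis is $\Lambda_l(\omega)=\{B=l\omega\}$. A generalized simple intersection is a point of $\Lambda_l(\omega)\cap\partial L_s(\omega)$ with $s\equiv l\pmod2$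 that is not a constriction. Set $r=\frac1{2\omega}$. For $r>0$ and $l\in\mathbb N$, $\mathrm{SI}_l(r)$ is the set of $\mu$-coordinates $\mu=A/(2\omega)=Ar$ of the generalized simple intersections in $\Lambda_l(\omega)$, and $\mathrm{SI}_l=\bigcup_{r>0}(\mathrm{SI}_l(r)\times\{r\})\subset\mathbb R^2_{(\mu,r)}$. Let $\mathrm{SI}_l^0\subset\mathrm{SI}_l$ be the subset of those $(\mu,r)$ whose corresponding point $(B,A)=(\frac{l}{2r},\frac{\mu}{r})$ is not a growth point (for these the Poincaré map has a unique fixed point, which is $\pm\frac\pi2\pmod{2\pi}$), and $\mathrm{SI}_{l,\pm}^0$ the subset of those for which this fixed point is $\pm\frac\pi2$. $\widehat{\mathrm{SI}}_l$ and $\widehat{\mathrm{SI}}_{l,\pm}$ denote the complex Zariski closures in $\mathbb C^2_{(\mu,r)}$ of $\mathrm{SI}_l$ and of $\mathrm{SI}^0_{l,\pm}$ respectively. *)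

theory Defs
  imports Complex_Main "HOL-Computational_Algebra.Polynomial"
begin

text \<open>Solution (in the torus time tau = omega t) of the vector field
  dphi/dtau = -(sin phi)/omega + l + 2 mu cos tau, with l = B/omega, mu = A/(2 omega),
  i.e. dphi/dtau = (-sin phi + B + A cos tau)/omega, starting at phi(0) = x.
  The solution is global and unique (globally Lipschitz right-hand side).\<close>
definition jsol :: "real \<Rightarrow> real \<Rightarrow> real \<Rightarrow> real \<Rightarrow> real \<Rightarrow> real" where
  "jsol \<omega> B A x = (THE f. f 0 = x \<and>
     (\<forall>\<tau>. (f has_real_derivative
        (- sin (f \<tau>) / \<omega> + B / \<omega> + 2 * (A / (2 * \<omega>)) * cos \<tau>)) (at \<tau>)))"

definition poincare :: "real \<Rightarrow> real \<Rightarrow> real \<Rightarrow> real \<Rightarrow> real" where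
  "poincare \<omega> B A x = jsol \<omega> B A x (2 * pi)"

definition rotnum :: "real \<Rightarrow> real \<Rightarrow> real \<Rightarrow> real" where
  "rotnum \<omega> B A = lim (\<lambda>k::nat. jsol \<omega> B A 0 (2 * pi * real k) / (2 * pi * real k))"

definition phase_lock :: "real \<Rightarrow> int \<Rightarrow> (real \<times> real) set" where
  "phase_lock \<omega> s = {(B, A). rotnum \<omega> B A = real_of_int s}"

definition fixes_mod :: "(real \<Rightarrow> real) \<Rightarrow> real \<Rightarrow> bool" where
  "fixes_mod h x \<longleftrightarrow> (\<exists>m::int. h x = x + 2 * pi * real_of_int m)"

definition circle_id :: "(real \<Rightarrow> real) \<Rightarrow> bool" where
  "circle_id h \<longleftrightarrow> (\<forall>x. fixes_mod h x)"

definition bdry_plus :: "real \<Rightarrow> int \<Rightarrow> (real \<times> real) set" where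
  "bdry_plus \<omega> s = {(B, A). (B, A) \<in> phase_lock \<omega> s \<and> fixes_mod (poincare \<omega> B A) (pi / 2)}"

definition bdry_minus :: "real \<Rightarrow> int \<Rightarrow> (real \<times> real) set" where
  "bdry_minus \<omega> s = {(B, A). (B, A) \<in> phase_lock \<omega> s \<and> fixes_mod (poincare \<omega> B A) (- pi / 2)}"

definition bdry :: "real \<Rightarrow> int \<Rightarrow> (real \<times> real) set" where
  "bdry \<omega> s = bdry_plus \<omega> s \<union> bdry_minus \<omega> s"

definition growth_point :: "real \<Rightarrow> real \<Rightarrow> real \<Rightarrow> bool" where
  "growth_point \<omega> B A \<longleftrightarrow> (\<exists>s. (B, A) \<in> phase_lock \<omega> s) \<and> circle_id (poincare \<omega> B A) \<and> A = 0"

definition constriction :: "real \<Rightarrow> real \<Rightarrow> real \<Rightarrow> bool" where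
  "constriction \<omega> B A \<longleftrightarrow> (\<exists>s. (B, A) \<in> phase_lock \<omega> s) \<and> circle_id (poincare \<omega> B A) \<and> A \<noteq> 0"

definition gen_simple_int :: "real \<Rightarrow> nat \<Rightarrow> real \<Rightarrow> real \<Rightarrow> bool" where
  "gen_simple_int \<omega> l B A \<longleftrightarrow> B = real l * \<omega> \<and>
     (\<exists>s::int. s mod 2 = int l mod 2 \<and> (B, A) \<in> bdry \<omega> s) \<and> \<not> constriction \<omega> B A"

text \<open>SI_l in coordinates (mu, r), r = 1/(2 omega), mu = A r, B = l/(2r), A = mu/r.\<close>
definition SI :: "nat \<Rightarrow> (real \<times> real) set" where
  "SI l = {(\<mu>, r). r > 0 \<and> gen_simple_int (1 / (2 * r)) l (real l / (2 * r)) (\<mu> / r)}"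

definition SI0 :: "nat \<Rightarrow> (real \<times> real) set" where
  "SI0 l = {(\<mu>, r). (\<mu>, r) \<in> SI l \<and> \<not> growth_point (1 / (2 * r)) (real l / (2 * r)) (\<mu> / r)}"

definition SI0_plus :: "nat \<Rightarrow> (real \<times> real) set" where
  "SI0_plus l = {(\<mu>, r). (\<mu>, r) \<in> SI0 l \<and>
     fixes_mod (poincare (1 / (2 * r)) (real l / (2 * r)) (\<mu> / r)) (pi / 2)}"

definition SI0_minus :: "nat \<Rightarrow> (real \<times> real) set" where
  "SI0_minus l = {(\<mu>, r). (\<mu>, r) \<in> SI0 l \<and>
     fixes_mod (poincare (1 / (2 * r)) (real l / (2 * r)) (\<mu> / r)) (- pi / 2)}"

text \<open>Polynomials in two variables (mu, r) are represented as elements of C[mu][r],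
  i.e. as univariate polynomials in r whose coefficients are polynomials in mu.\<close>
type_synonym poly2 = "complex poly poly"

definition eval2 :: "poly2 \<Rightarrow> complex \<times> complex \<Rightarrow> complex" where
  "eval2 p z = poly (map_poly (\<lambda>c. poly c (fst z)) p) (snd z)"

definition zero_set :: "poly2 set \<Rightarrow> (complex \<times> complex) set" where
  "zero_set F = {z. \<forall>p\<in>F. eval2 p z = 0}"

definition algebraic_set :: "(complex \<times> complex) set \<Rightarrow> bool" where
  "algebraic_set X \<longleftrightarrow> (\<exists>F. X = zero_set F)"

definition zariski_closure :: "(complex \<times> complex) set \<Rightarrow> (complex \<times> complex) set" where
  "zariski_closure S = \<Inter> {X. algebraic_set X \<and> S \<subseteq> X}"

definition irreducible_alg :: "(complex \<times> complex) set \<Rightarrow> bool" where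
  "irreducible_alg X \<longleftrightarrow> algebraic_set X \<and> X \<noteq> {} \<and>
     (\<forall>Y Z. algebraic_set Y \<and> algebraic_set Z \<and> X = Y \<union> Z \<longrightarrow> X = Y \<or> X = Z)"

definition nonconstant2 :: "poly2 \<Rightarrow> bool" where
  "nonconstant2 p \<longleftrightarrow> \<not> (degree p = 0 \<and> degree (coeff p 0) = 0)"

definition algebraic_curve :: "(complex \<times> complex) set \<Rightarrow> bool" where
  "algebraic_curve X \<longleftrightarrow> (\<exists>p. nonconstant2 p \<and> X = zero_set {p})"

definition irr_components :: "(complex \<times> complex) set \<Rightarrow> (complex \<times> complex) set set" where
  "irr_components X = {Y. Y \<subseteq> X \<and> irreducible_alg Y \<and>
     (\<forall>Z. irreducible_alg Z \<and> Y \<subseteq> Z \<and> Z \<subseteq> X \<longrightarrow> Z = Y)}"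

definition complexify :: "(real \<times> real) set \<Rightarrow> (complex \<times> complex) set" where
  "complexify S = (\<lambda>(a, b). (complex_of_real a, complex_of_real b)) ` S"

definition SI_hat :: "nat \<Rightarrow> (complex \<times> complex) set" where
  "SI_hat l = zariski_closure (complexify (SI l))"

definition SI_hat_plus :: "nat \<Rightarrow> (complex \<times> complex) set" where
  "SI_hat_plus l = zariski_closure (complexify (SI0_plus l))"

definition SI_hat_minus :: "nat \<Rightarrow> (complex \<times> complex) set" where
  "SI_hat_minus l = zariski_closure (complexify (SI0_minus l))"

end

theory Submission
  imports Defs "HOL-Computational_Algebra.Computational_Algebra" "HOL-Computational_Algebra.Field_as_Ring"
    "HOL-Analysis.Analysis"
begin

text \<open>Linearising the vector field by the Riccati substitution and gauging away an exponential factor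
  turns the condition "the Poincare map fixes \<open>\<plusminus>\<pi>/2\<close> with rotation number congruent to \<open>l\<close>
  modulo 2" into the existence of a bounded solution \<open>x\<close>, indexed by the integers, of the system
  \<open>(j - l) x (j - 1) \<plusminus> r x (l - 1 - j) = \<mu> x j\<close>, the \<open>x j\<close> being Fourier coefficients. A solution
  supported in \<open>{0..<l}\<close> exists iff a polynomial \<open>Q (\<mu>, \<plusminus>r)\<close>, built by a three-term recursion,
  vanishes. A solution with infinite support can be mirrored into one for the opposite sign, so both
  \<open>\<pi>/2\<close> and \<open>-\<pi>/2\<close> are fixed and the point is a constriction. Hence the two families lie on
  \<open>Q (\<mu>, r) = 0\<close> and \<open>Q (\<mu>, - r) = 0\<close>. Conversely, for small \<open>\<mu> \<noteq> 0\<close> every solution with infinite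
  support is unbounded, so there all real zeros of \<open>Q\<close> are generalised simple intersections, and there
  are infinitely many of them. Finally \<open>Q\<close> is irreducible by Eisenstein's argument at \<open>r\<close>, so an
  infinite set of zeros is Zariski dense in its curve.\<close>

section \<open>Ring homomorphisms\<close>

text \<open>The field is reversible under (phi, t) -> (pi - phi, -t), and +-pi/2 are the fixed
  angles of this reflection. Hence an orbit closing up there has multiplier +1 or -1, and hence the
  index reflection j -> l - 1 - j in the Fourier system. The coefficient j - l vanishes at j = l, so
  the equations outside \<open>{0..<l}\<close> never meet the block, and the block meets the outside
  only at the index -1: everything turns on whether \<open>x (- 1)\<close> vanishes. The obstacle is
  the converse: constrictions among the real zeros of Q are excluded only for small m. Infinitely
  many good points suffice, because an infinite subset of an irreducible curve is dense. Changing
  the sign of r exchanges the two curves, so both have the same image under r -> r^2, and that image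
  is the zero set of a norm polynomial. Up to sign Q is monic of degree l in m, congruent to m^l
  modulo r, with a simple zero at r = 0 when m = 0. As Q is written as a polynomial in r over C[m],
  a bound l on the total degree takes the place of monicity in m.\<close>

definition rhom :: "('a::comm_ring_1 \<Rightarrow> 'b::comm_ring_1) \<Rightarrow> bool" where
  "rhom h \<longleftrightarrow> h 1 = 1 \<and> (\<forall>x y. h (x + y) = h x + h y) \<and> (\<forall>x y. h (x * y) = h x * h y)"

lemma rhom_one: "rhom h \<Longrightarrow> h 1 = 1"
  and rhom_add: "rhom h \<Longrightarrow> h (x + y) = h x + h y"
  and rhom_mult: "rhom h \<Longrightarrow> h (x * y) = h x * h y"
  by (auto simp: rhom_def)

lemma rhom_zero: "rhom h \<Longrightarrow> h 0 = 0"
  using rhom_add[of h 0 0] by simp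

lemma rhom_uminus: "rhom h \<Longrightarrow> h (- x) = - h x"
  using rhom_add[of h x "- x"] rhom_zero[of h] by (simp add: eq_neg_iff_add_eq_0 add.commute)

lemma rhom_diff: "rhom h \<Longrightarrow> h (x - y) = h x - h y"
  using rhom_add[of h x "- y"] rhom_uminus[of h y] by simp

lemma rhom_of_nat: "rhom h \<Longrightarrow> h (of_nat n) = of_nat n"
  by (induction n) (simp_all add: rhom_zero rhom_add rhom_one)

lemma rhom_of_int: "rhom h \<Longrightarrow> h (of_int k) = of_int k"
  by (cases k) (simp_all add: rhom_of_nat rhom_uminus rhom_diff rhom_one)

lemma rhom_power: "rhom h \<Longrightarrow> h (x ^ n) = h x ^ n"
  by (induction n) (simp_all add: rhom_one rhom_mult)

lemmas rhom_simps = rhom_one rhom_add rhom_mult rhom_zero rhom_uminus rhom_diff rhom_of_nat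
  rhom_of_int rhom_power

lemma rhom_poly: "rhom (\<lambda>p. poly p x)"
  by (simp add: rhom_def)

lemma rhom_of_real: "rhom (of_real :: real \<Rightarrow> complex)"
  by (simp add: rhom_def)

lemma rhom_map_poly:
  assumes h: "rhom h"
  shows "rhom (map_poly h)"
proof -
  have add: "map_poly h (p + q) = map_poly h p + map_poly h q" for p q
    by (rule poly_eqI) (simp add: coeff_map_poly rhom_simps[OF h])
  have "map_poly h (smult a q) = smult (h a) (map_poly h q)" for a q
    by (rule poly_eqI) (simp add: coeff_map_poly rhom_simps[OF h])
  then have "map_poly h (p * q) = map_poly h p * map_poly h q" for p q
    by (induction p rule: pCons_induct)
       (simp_all add: add map_poly_pCons[of h, OF rhom_zero[OF h]] rhom_simps[OF h])
  with add show ?thesis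
    by (simp add: rhom_def map_poly_1' rhom_simps[OF h])
qed

lemma rhom_comp: "rhom f \<Longrightarrow> rhom g \<Longrightarrow> rhom (\<lambda>x. f (g x))"
  by (simp add: rhom_def)

lemma rhom_eval2: "rhom (\<lambda>p. eval2 p z)"
  unfolding eval2_def
  by (rule rhom_comp[OF rhom_poly rhom_map_poly[OF rhom_poly]])

lemma eval2_pCons: "eval2 (pCons a p) z = poly a (fst z) + snd z * eval2 p z"
  by (simp add: eval2_def map_poly_pCons)

lemma eval2_0 [simp]: "eval2 0 z = 0"
  by (simp add: eval2_def)

section \<open>The polynomial and its irreducibility\<close>

text \<open>Ordering the indices of the block \<open>{0..<l}\<close> as \<open>l-1, 0, l-2, 1, \<dots>\<close> makes its matrix a Jacobi
  matrix. The leading minors are \<open>chn\<close>; \<open>chQ\<close> adds the loop at the end of this path, at the middle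
  index.\<close>

definition chc :: "nat \<Rightarrow> 'a::comm_ring_1 \<Rightarrow> nat \<Rightarrow> 'a" where
  "chc l m n = (if even n then m\<^sup>2 else of_nat (Suc n div 2) * (of_nat l - of_nat (Suc n div 2)))"

fun chn :: "nat \<Rightarrow> 'a::comm_ring_1 \<Rightarrow> 'a \<Rightarrow> nat \<Rightarrow> 'a" where
  "chn l m R 0 = 1"
| "chn l m R (Suc 0) = R"
| "chn l m R (Suc (Suc n)) = R * chn l m R (Suc n) - chc l m n * chn l m R n"

definition chQ :: "nat \<Rightarrow> 'a::comm_ring_1 \<Rightarrow> 'a \<Rightarrow> 'a" where
  "chQ l m R = chn l m R l - (if odd l then m else of_nat (l div 2)) * chn l m R (l - 1)"

lemma chc_hom: "rhom h \<Longrightarrow> h (chc l m n) = chc l (h m) n"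
  by (simp add: chc_def rhom_simps)

lemma chn_hom: "rhom h \<Longrightarrow> h (chn l m R n) = chn l (h m) (h R) n"
  by (induction l m R n rule: chn.induct) (simp_all add: rhom_simps chc_hom)

text \<open>Because \<open>chQ\<close> makes sense over any commutative ring, this one fact serves
  evaluation at a point, the constant coefficient in r, the substitution \<open>homog\<close> and
  the embedding of the reals into the complex numbers.\<close>

lemma chQ_hom: "rhom h \<Longrightarrow> h (chQ l m R) = chQ l (h m) (h R)"
  by (simp add: chQ_def rhom_simps chn_hom)

lemma chn_uminus: "chn l m (- R) n = (- 1) ^ n * chn l m R n"
  by (induction l m R n rule: chn.induct) (auto simp: algebra_simps)

lemma chc_nonzero:
  fixes m :: "'a::{idom, ring_char_0}"
  assumes "m \<noteq> 0" "Suc (Suc n) \<le> l"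
  shows "chc l m n \<noteq> 0"
proof (cases "even n")
  case False
  then obtain k where n: "n = 2 * k + 1"
    by (auto elim: oddE)
  have "of_nat (Suc k) \<noteq> (0::'a)" "of_nat l \<noteq> (of_nat (Suc k) :: 'a)"
    using assms(2) n by (simp_all del: of_nat_Suc)
  then show ?thesis
    using n by (simp add: chc_def del: of_nat_Suc)
qed (use assms in \<open>simp add: chc_def\<close>)

text \<open>As for orthogonal polynomials: two neighbouring zeros propagate down the recursion to
  the value 1 at index 0, since no coefficient \<open>chc\<close> met on the way vanishes.\<close>

lemma chn_no_consecutive_zeros:
  fixes m R :: "'a::{idom, ring_char_0}"
  assumes "m \<noteq> 0" "Suc n \<le> l" "chn l m R n = 0" "chn l m R (Suc n) = 0"
  shows False
  using assms
proof (induction n)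
  case (Suc n)
  have "chn l m R n = 0"
    using Suc.prems chc_nonzero[of m n l] by simp
  then show ?case
    using Suc by simp
qed simp

text \<open>\<open>chn\<close> has parity \<open>(- 1) ^ n\<close> in R, so a common zero makes
  \<open>chn l m R l\<close> equal to both d and -d times its predecessor. Then two consecutive
  values vanish. This separates the two curves, and later it also rules out constrictions.\<close>

lemma chQ_mirror:
  fixes m R :: "'a::{idom, ring_char_0}"
  assumes "m \<noteq> 0" "l \<ge> 1" "chQ l m R = 0" "chQ l m (- R) = 0"
  shows False
proof -
  obtain k where l: "l = Suc k"
    using \<open>l \<ge> 1\<close> by (cases l) auto
  define d where "d = (if odd l then m else of_nat (l div 2))"
  have d: "d \<noteq> 0"
    using \<open>m \<noteq> 0\<close> \<open>l \<ge> 1\<close> by (auto simp: d_def simp del: of_nat_div elim!: evenE)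
  have 1: "chn l m R l = d * chn l m R k"
    using assms(3) l by (simp add: chQ_def d_def)
  have "chn l m (- R) l = d * chn l m (- R) k"
    using assms(4) l by (simp add: chQ_def d_def)
  then have "(- 1) ^ k * (chn l m R l + d * chn l m R k) = 0"
    unfolding chn_uminus distrib_left neg_eq_iff_add_eq_0[symmetric] using l
    by (simp add: mult.left_commute)
  then have "chn l m R l + d * chn l m R k = 0"
    by simp
  with 1 have "2 * (d * chn l m R k) = 0"
    by simp
  with d have "chn l m R k = 0"
    by simp
  with 1 show False
    using chn_no_consecutive_zeros[of m k l R] assms(1) l by simp
qed

section \<open>The polynomial in C[m][r]: degrees and lowest terms\<close>

abbreviation mvar :: poly2 where "mvar \<equiv> [:[:0, 1:]:]"
abbreviation rvar :: "complex \<Rightarrow> poly2" where "rvar e \<equiv> [:0, [:e:]:]"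

definition qpoly :: "nat \<Rightarrow> complex \<Rightarrow> poly2" where
  "qpoly l e = chQ l mvar (rvar e)"

lemma eval2_qpoly: "eval2 (qpoly l e) z = chQ l (fst z) (e * snd z)"
proof -
  have "eval2 mvar z = fst z" "eval2 (rvar e) z = e * snd z"
    by (simp_all add: eval2_pCons)
  then show ?thesis
    by (simp add: qpoly_def chQ_hom[OF rhom_eval2])
qed

text \<open>Two gradings are served at once: the degree in r, with m a constant polynomial, and
  after \<open>homog\<close> the total degree, where m and R both have degree 1 and
  \<open>chc\<close> has degree at most 2.\<close>

lemma degree_chn_le:
  fixes m R :: "'a::comm_ring_1 poly"
  assumes "degree m \<le> 1" "degree R \<le> 1"
  shows "degree (chn l m R n) \<le> n"
  using assms
proof (induction l m R n rule: chn.induct)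
  case (3 l m R n)
  have "degree (chc l m n) \<le> 2"
  proof (cases "even n")
    case True
    then show ?thesis
      using degree_power_le[of m 2] 3 by (simp add: chc_def)
  next
    case False
    have "degree (of_nat k :: 'a poly) = 0" for k
      by (simp add: of_nat_poly)
    then have "degree (of_nat i * (of_nat k - of_nat i) :: 'a poly) \<le> 0 + 0" for i k
      by (intro order.trans[OF degree_mult_le] add_mono degree_diff_le) simp_all
    from this[of "Suc n div 2" l] show ?thesis
      using False unfolding chc_def if_not_P[OF False] by linarith
  qed
  then have "degree (chc l m n * chn l m R n) \<le> 2 + n"
    using 3 by (intro order.trans[OF degree_mult_le]) simp
  moreover have "degree (R * chn l m R (Suc n)) \<le> 1 + Suc n"
    using 3 by (intro order.trans[OF degree_mult_le]) (simp add: add_mono)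
  ultimately show ?case
    by (simp add: degree_diff_le)
qed simp_all

lemma degree_chQ_le:
  fixes m R :: "'a::comm_ring_1 poly"
  assumes "degree m \<le> 1" "degree R \<le> 1" "l \<ge> 1"
  shows "degree (chQ l m R) \<le> l"
proof -
  have "degree (if odd l then m else of_nat (l div 2)) \<le> 1"
    using assms(1) by (simp add: of_nat_poly del: of_nat_div)
  then have "degree ((if odd l then m else of_nat (l div 2)) * chn l m R (l - 1)) \<le> 1 + (l - 1)"
    using degree_chn_le[OF assms(1,2)] by (intro order.trans[OF degree_mult_le] add_mono)
  then show ?thesis
    using degree_chn_le[OF assms(1,2), of l l] \<open>l \<ge> 1\<close> by (simp add: chQ_def degree_diff_le)
qed

lemma degree_chc_0:
  fixes m :: "'a::comm_ring_1"
  shows "degree (chc l [:m:] n) = 0"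
proof -
  have "rhom (\<lambda>c. [:c::'a:])"
    by (simp add: rhom_def one_pCons)
  from chc_hom[OF this, of l m n] show ?thesis
    by (metis degree_pCons_0)
qed

lemma coeff_chn_top:
  fixes m e :: "'a::comm_ring_1"
  shows "coeff (chn l [:m:] [:0, e:] n) n = e ^ n"
proof (induction l "[:m:]" "[:0, e:]" n rule: chn.induct)
  case (3 l n)
  have "degree (chc l [:m:] n * chn l [:m:] [:0, e:] n) \<le> n"
    using degree_chn_le[of "[:m:]" "[:0, e:]" l n]
    by (intro order.trans[OF degree_mult_le]) (simp add: degree_chc_0)
  then have "coeff (chc l [:m:] n * chn l [:m:] [:0, e:] n) (Suc (Suc n)) = 0"
    by (simp add: coeff_eq_0)
  with 3 show ?case
    by simp
qed simp_all

lemma coeff_chQ_top: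
  fixes m e :: "'a::comm_ring_1"
  assumes "l \<ge> 1"
  shows "coeff (chQ l [:m:] [:0, e:]) l = e ^ l"
proof -
  obtain k where l: "l = Suc k"
    using \<open>l \<ge> 1\<close> by (cases l) auto
  define d :: "'a poly" where "d = (if odd l then [:m:] else of_nat (l div 2))"
  have "degree d = 0"
    by (simp add: d_def of_nat_poly del: of_nat_div)
  then have "degree (d * chn l [:m:] [:0, e:] k) \<le> k"
    using degree_chn_le[of "[:m:]" "[:0, e:]" l k]
    by (intro order.trans[OF degree_mult_le]) simp
  then have "coeff (d * chn l [:m:] [:0, e:] k) l = 0"
    by (simp add: coeff_eq_0 l)
  moreover have "chQ l [:m:] [:0, e:] = chn l [:m:] [:0, e:] l - d * chn l [:m:] [:0, e:] k"
    by (simp add: chQ_def d_def l)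
  ultimately show ?thesis
    by (simp add: coeff_chn_top)
qed

lemma chn_at_0: "chn l m 0 n = (if even n then (- 1) ^ (n div 2) * m ^ n else 0)"
proof (induction l m "0::'a" n rule: chn.induct)
  case (3 l m n)
  then show ?case
    by (cases "even n") (auto simp: chc_def power2_eq_square elim!: evenE)
qed auto

lemma chQ_at_0:
  assumes "l \<ge> 1"
  shows "chQ l m 0 = m ^ l \<or> chQ l m 0 = - (m ^ l)"
proof -
  obtain k where l: "l = Suc k"
    using \<open>l \<ge> 1\<close> by (cases l) auto
  have "(- 1) ^ j = (1 :: 'a) \<or> (- 1) ^ j = (- 1 :: 'a)" for j
    by (metis neg_one_even_power neg_one_odd_power)
  from this[of "k div 2"] this[of "l div 2"] show ?thesis
    using l by (auto simp: chQ_def chn_at_0)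
qed

text \<open>At m = 0 every second coefficient \<open>chc\<close> vanishes and the recursion
  factorises: the entry at 2k + 1 is R times the product of R^2 - i (l - i) over i = 1..k, and the
  entry at 2k + 2 is R times that.\<close>

lemma chn_linear_coeff:
  fixes e :: "'a::comm_ring_1"
  shows "coeff (chn l 0 [:0, e:] (Suc (2 * k))) 0 = 0 \<and>
         coeff (chn l 0 [:0, e:] (2 * Suc k)) 0 = 0 \<and> coeff (chn l 0 [:0, e:] (2 * Suc k)) 1 = 0 \<and>
         coeff (chn l 0 [:0, e:] (Suc (2 * k))) 1 =
           e * (\<Prod>i\<in>{1..k}. - (of_nat i * (of_nat l - of_nat i)))"
proof (induction k)
  case 0
  show ?case
    by (simp add: chc_def numeral_2_eq_2)
next
  case (Suc k)
  have c: "chc l 0 (Suc (2 * k)) = [:of_nat (Suc k) * (of_nat l - of_nat (Suc k)) :: 'a:]"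
    by (simp add: chc_def of_nat_poly one_pCons del: of_nat_Suc)
  have 1: "chn l 0 [:0, e:] (Suc (2 * Suc k)) = [:0, e:] * chn l 0 [:0, e:] (2 * Suc k)
      - chc l 0 (Suc (2 * k)) * chn l 0 [:0, e:] (Suc (2 * k))"
    by simp
  have 2: "chn l 0 [:0, e:] (2 * Suc (Suc k)) = [:0, e:] * chn l 0 [:0, e:] (Suc (2 * Suc k))"
    by (simp add: chc_def)
  show ?case
    using Suc unfolding 2 unfolding 1 c by (simp add: algebra_simps del: chn.simps of_nat_Suc)
qed

text \<open>This is the Eisenstein condition that the part of Q free of m is not divisible by r^2.
  For even l the linear term comes from the loop l/2, which multiplies the odd entry.\<close>

lemma chQ_linear_coeff:
  fixes e :: "'a::{idom, ring_char_0}"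
  assumes "l \<ge> 1" "e \<noteq> 0"
  shows "coeff (chQ l 0 [:0, e:]) 1 \<noteq> 0"
proof (cases "odd l")
  case True
  then obtain k where l: "l = Suc (2 * k)"
    by (auto elim: oddE)
  have "of_nat i * (of_nat l - of_nat i) \<noteq> (0::'a)" if "i \<in> {1..k}" for i
    using that l by (auto simp del: of_nat_Suc)
  then have "(\<Prod>i\<in>{1..k}. - (of_nat i * (of_nat l - of_nat i))) \<noteq> (0::'a)"
    by (simp add: prod_zero_iff)
  then show ?thesis
    using chn_linear_coeff[of l e k] True assms l by (simp add: chQ_def del: chn.simps)
next
  case False
  with \<open>l \<ge> 1\<close> obtain k where l: "l = 2 * Suc k"
    by (metis One_nat_def dvd_def even_Suc mult_0_right not0_implies_Suc not_less_eq_eq zero_le)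
  have "of_nat i * (of_nat l - of_nat i) \<noteq> (0::'a)" if "i \<in> {1..k}" for i
    using that l by (auto simp del: of_nat_Suc of_nat_mult)
  then have *: "(\<Prod>i\<in>{1..k}. - (of_nat i * (of_nat l - of_nat i))) \<noteq> (0::'a)"
    by (simp add: prod_zero_iff)
  have "chQ l 0 [:0, e:] = chn l 0 [:0, e:] (2 * Suc k) - [:of_nat (Suc k):] * chn l 0 [:0, e:] (Suc (2 * k))"
    using l by (simp add: chQ_def of_nat_poly one_pCons del: chn.simps of_nat_Suc)
  then show ?thesis
    using chn_linear_coeff[of l e k] * assms by (simp del: chn.simps of_nat_Suc)
qed

text \<open>The substitution \<open>m \<mapsto> t\<close>, \<open>r \<mapsto> \<kappa> t\<close> into \<open>C[\<kappa>][t]\<close>: the degree in \<open>t\<close> is the total degree.\<close>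

definition homog :: "poly2 \<Rightarrow> poly2" where
  "homog p = poly (map_poly (map_poly (\<lambda>c. [:c:])) p) [:0, [:0, 1:]:]"

lemma rhom_homog: "rhom homog"
  unfolding homog_def
  by (rule rhom_comp[OF rhom_poly rhom_map_poly[OF rhom_map_poly]]) (simp add: rhom_def one_pCons)

lemma homog_pCons: "homog (pCons a p) = map_poly (\<lambda>c. [:c:]) a + pCons 0 (smult [:0, 1:] (homog p))"
  by (simp add: homog_def map_poly_pCons)

lemma coeff_homog:
  "coeff (coeff (homog p) D) i = (if i \<le> D then coeff (coeff p i) (D - i) else 0)"
proof (induction p arbitrary: D i rule: pCons_induct)
  case 0
  show ?case
    by (simp add: homog_def)
next
  case (pCons a p)
  show ?case
    by (cases D; cases i) (simp_all add: homog_pCons coeff_map_poly pCons.IH)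
qed

lemma degree_homog:
  assumes "coeff (coeff p i) j \<noteq> 0"
  shows "degree (homog p) \<ge> i + j"
proof -
  have "coeff (coeff (homog p) (i + j)) i \<noteq> 0"
    using assms by (simp add: coeff_homog)
  then show ?thesis
    by (intro le_degree) auto
qed

lemma degree_homog_qpoly:
  assumes "l \<ge> 1"
  shows "degree (homog (qpoly l e)) \<le> l"
proof -
  have "homog (qpoly l e) = chQ l (homog mvar) (homog (rvar e))"
    by (simp add: qpoly_def chQ_hom[OF rhom_homog])
  moreover have "degree (homog mvar) \<le> 1" "degree (homog (rvar e)) \<le> 1"
    by (auto simp: homog_pCons map_poly_pCons homog_def intro!: degree_add_le)
  ultimately show ?thesis
    using degree_chQ_le[OF _ _ assms] by metis
qed

lemma rhom_coeff_0: "rhom (\<lambda>p. coeff p 0)"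
  by (simp add: rhom_def coeff_mult)

lemma coeff_0_qpoly:
  assumes "l \<ge> 1"
  shows "\<exists>c. c \<noteq> 0 \<and> coeff (qpoly l e) 0 = monom c l"
proof -
  have "coeff (qpoly l e) 0 = chQ l [:0, 1:] 0"
    by (simp add: qpoly_def chQ_hom[OF rhom_coeff_0])
  moreover have "[:0, 1:] ^ l = monom (1::complex) l"
    by (simp add: monom_altdef)
  ultimately show ?thesis
    using chQ_at_0[OF assms, of "[:0, 1:]"] by (metis minus_monom neg_equal_0_iff_equal zero_neq_one)
qed

lemma coeff_qpoly_top:
  assumes "l \<ge> 1"
  shows "coeff (qpoly l e) l = [:e ^ l:]"
  using coeff_chQ_top[OF assms, of "[:0, 1:]" "[:e:]"] by (simp add: qpoly_def poly_const_pow)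

lemma degree_qpoly:
  assumes "l \<ge> 1" "e \<noteq> 0"
  shows "degree (qpoly l e) = l"
proof (rule antisym)
  show "degree (qpoly l e) \<le> l"
    unfolding qpoly_def by (rule degree_chQ_le) (use assms in auto)
  show "l \<le> degree (qpoly l e)"
    using coeff_qpoly_top[OF assms(1), of e] assms(2) by (intro le_degree) simp
qed

lemma qpoly_simple_zero:
  assumes "l \<ge> 1" "e \<noteq> 0"
  shows "coeff (coeff (qpoly l e) 1) 0 \<noteq> 0"
proof -
  have h: "rhom (map_poly (\<lambda>c. coeff c 0) :: poly2 \<Rightarrow> complex poly)"
    by (rule rhom_map_poly[OF rhom_coeff_0])
  have "coeff (coeff (qpoly l e) 1) 0 = coeff (map_poly (\<lambda>c. coeff c 0) (qpoly l e)) 1"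
    by (simp add: coeff_map_poly)
  also have "map_poly (\<lambda>c. coeff c 0) (qpoly l e) = chQ l 0 [:0, e:]"
    by (simp add: qpoly_def chQ_hom[OF h] map_poly_pCons)
  finally show ?thesis
    using chQ_linear_coeff[OF assms] by simp
qed

text \<open>Eisenstein's argument at the prime \<open>r\<close>, for a polynomial that is monic in \<open>m\<close>.\<close>

lemma qpoly_factor_unit:
  assumes l: "l \<ge> 1" and e: "e \<noteq> 0" and AB: "qpoly l e = A * B"
    and A0: "coeff (coeff A 0) 0 \<noteq> 0"
  shows "is_unit A"
proof -
  obtain c where c: "c \<noteq> 0" "coeff A 0 * coeff B 0 = monom c l"
    using coeff_0_qpoly[OF l, of e] by (auto simp: AB coeff_mult)
  have "monom c l = smult c ([:0, 1:] ^ l)"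
    by (simp add: monom_altdef)
  then have "[:0, 1:] ^ l dvd coeff A 0 * coeff B 0"
    using c by (simp add: dvd_smult)
  moreover have "prime_elem ([:0, 1:] :: complex poly)"
    by (rule prime_elem_linear_field_poly) simp
  moreover have "\<not> [:0, 1:] dvd coeff A 0"
    using A0 dvd_iff_poly_eq_0[of 0 "coeff A 0"] by (simp add: poly_0_coeff_0)
  \<comment> \<open>The prime m does not divide \<open>coeff A 0\<close>, so the whole power m^l
    falls on \<open>coeff B 0\<close>.\<close>
  ultimately have "[:0, 1:] ^ l dvd coeff B 0"
    using l by (intro prime_power_dvd_multD[of "[:0, 1:]" l "coeff A 0" "coeff B 0"]) simp_all
  moreover have B0: "coeff B 0 \<noteq> 0"
    using c by auto
  ultimately have degB0: "degree (coeff B 0) \<ge> l"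
    by (metis degree_linear_power dvd_imp_degree_le)
  \<comment> \<open>B alone already uses up the total degree l allowed for the product, so A has
    total degree 0 and in particular does not involve r.\<close>
  have "degree (homog B) \<ge> l"
    using degree_homog[of B 0 "degree (coeff B 0)"] B0 degB0 by simp
  moreover have nz: "A \<noteq> 0" "B \<noteq> 0"
    using AB degree_qpoly[OF l e] l by auto
  have hA: "degree (homog A) \<ge> degree A"
    using degree_homog[of A "degree A" "degree (lead_coeff A)"] nz by simp
  moreover have "homog A \<noteq> 0" "homog B \<noteq> 0"
    using degree_homog[of A] degree_homog[of B] nz
    by (metis coeff_homog le_add1 add_diff_cancel_left' coeff_0 leading_coeff_0_iff)+
  then have "degree (homog A * homog B) = degree (homog A) + degree (homog B)"
    by (simp add: degree_mult_eq)
  ultimately have "degree A = 0"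
    using degree_homog_qpoly[OF l, of e] unfolding AB rhom_mult[OF rhom_homog] by linarith
  then obtain a where a: "A = [:a:]"
    by (auto elim: degree_eq_zeroE)
  \<comment> \<open>What remains of A divides the leading coefficient of Q in r, which is a nonzero
    constant.\<close>
  have "a * coeff B l = [:e ^ l:]"
    using coeff_qpoly_top[OF l, of e] by (simp add: AB a)
  then have "a dvd [:e ^ l:]"
    by (metis dvd_triv_left)
  moreover have "is_unit [:e ^ l:]"
    using e by (simp add: is_unit_const_poly_iff dvd_field_iff)
  ultimately have "is_unit a"
    using dvd_trans by blast
  then show ?thesis
    by (simp add: a is_unit_const_poly_iff)
qed

lemma prime_elem_qpoly:
  assumes l: "l \<ge> 1" and e: "e \<noteq> 0"
  shows "prime_elem (qpoly l e)"
proof (rule irreducible_imp_prime_elem, rule irreducibleI)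
  show "qpoly l e \<noteq> 0"
    using degree_qpoly[OF l e] l by auto
  show "\<not> is_unit (qpoly l e)"
    using degree_qpoly[OF l e] l by (auto simp: is_unit_poly_iff)
  fix A B
  assume AB: "qpoly l e = A * B"
  \<comment> \<open>If both factors vanished at the origin, their product would have no term linear
    in r there.\<close>
  have "coeff (coeff A 0) 0 \<noteq> 0 \<or> coeff (coeff B 0) 0 \<noteq> 0"
  proof (rule ccontr)
    assume "\<not> ?thesis"
    then have "coeff (coeff (A * B) 1) 0 = 0"
      by (simp add: coeff_mult)
    then show False
      using qpoly_simple_zero[OF l e] AB by simp
  qed
  then show "is_unit A \<or> is_unit B"
    using qpoly_factor_unit[OF l e, of A B] qpoly_factor_unit[OF l e, of B A] AB
    by (auto simp: mult.commute)
qed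

section \<open>Zariski closures in the plane\<close>

text \<open>A nonzero element of least degree in the ideal \<open>(p, Q)\<close> divides both generators
  up to constants, by pseudo-division.\<close>

lemma prime_elem_elimination:
  fixes Q p :: "'a::idom_divide poly"
  assumes Q: "prime_elem Q" "degree Q \<ge> 1" and ndvd: "\<not> Q dvd p"
  shows "\<exists>A B R. R \<noteq> 0 \<and> A * p + B * Q = [:R:]"
proof -
  define I where "I = {g. g \<noteq> 0 \<and> (\<exists>A B. g = A * p + B * Q)}"
  have "p = 1 * p + 0 * Q"
    by simp
  moreover have "p \<noteq> 0"
    using ndvd by auto
  ultimately have "p \<in> I"
    unfolding I_def by blast
  define g where "g = arg_min degree (\<lambda>g. g \<in> I)"
  have gI: "g \<in> I" and gmin: "\<And>h. h \<in> I \<Longrightarrow> degree g \<le> degree h"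
    using arg_min_nat_lemma[of "\<lambda>g. g \<in> I", OF \<open>p \<in> I\<close>, of degree] by (auto simp: g_def)
  obtain A B where g: "g \<noteq> 0" "g = A * p + B * Q"
    using gI by (auto simp: I_def)
  have pseudo: "\<exists>a q. a \<noteq> 0 \<and> smult a f = g * q" if f: "f = C * p + D * Q" for f C D
  proof -
    obtain a q where aq: "a \<noteq> 0" "smult a f = g * q + pseudo_mod f g"
      using pseudo_mod(1)[OF g(1), of f] by auto
    have "pseudo_mod f g = 0"
    proof (rule ccontr)
      assume nz: "pseudo_mod f g \<noteq> 0"
      have "pseudo_mod f g = smult a f - g * q"
        using aq(2) by (simp add: algebra_simps)
      also have "\<dots> = (smult a C - A * q) * p + (smult a D - B * q) * Q"
        by (simp add: f g(2) algebra_simps smult_add_right)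
      finally have "pseudo_mod f g \<in> I"
        using nz unfolding I_def by blast
      then show False
        using gmin pseudo_mod(2)[OF g(1), of f] nz by fastforce
    qed
    then show ?thesis
      using aq by auto
  qed
  have Qnz: "Q \<noteq> 0"
    using Q(2) by auto
  have not_const: "\<not> Q dvd [:a:]" if "a \<noteq> 0" for a
    using dvd_imp_degree_le[of Q "[:a:]"] that Q(2) by auto
  obtain a q where aq: "a \<noteq> 0" "smult a Q = g * q"
    using pseudo[of Q 0 1] by auto
  obtain b q' where bq: "b \<noteq> 0" "smult b p = g * q'"
    using pseudo[of p 1 0] by auto
  have "Q dvd g * q"
    using aq(2) by (metis dvd_refl dvd_smult)
  \<comment> \<open>If Q divides g it divides b p, hence p or the constant b, and both are
    impossible. If Q divides q, cancelling Q leaves g as a divisor of the constant a.\<close>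
  then consider "Q dvd g" | "Q dvd q"
    using Q(1) by (auto simp: prime_elem_dvd_mult_iff)
  then have "degree g = 0"
  proof cases
    case 1
    then have "Q dvd [:b:] * p"
      using bq(2) by simp
    then show ?thesis
      using Q(1) ndvd not_const[OF bq(1)] by (simp add: prime_elem_dvd_mult_iff del: mult_pCons_left)
  next
    case 2
    then obtain s where "q = Q * s" ..
    then have "Q * [:a:] = Q * (g * s)"
      using aq(2) by (simp add: mult.left_commute)
    then have gs: "[:a:] = g * s"
      using Qnz by (simp del: mult_pCons_right)
    then have "s \<noteq> 0"
      using aq(1) by auto
    with gs g(1) show ?thesis
      by (metis add_is_0 degree_mult_eq degree_pCons_0)
  qed
  then show ?thesis
    using g by (metis degree_eq_zeroE pCons_eq_0_iff)
qed

lemma eval2_simps: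
  "eval2 (p + q) z = eval2 p z + eval2 q z" "eval2 (p * q) z = eval2 p z * eval2 q z"
  "eval2 (p - q) z = eval2 p z - eval2 q z"
  using rhom_simps[OF rhom_eval2[of z]] by auto

lemma eval2_const: "eval2 [:c:] z = poly c (fst z)"
  by (simp add: eval2_pCons)

lemma finite_fibre:
  assumes "lead_coeff Q = [:u:]"  "u \<noteq> 0"
  shows "finite {r. eval2 Q (m, r) = 0}"
proof -
  have "coeff (map_poly (\<lambda>c. poly c m) Q) (degree Q) \<noteq> 0"
    using assms by (simp add: coeff_map_poly)
  then have "map_poly (\<lambda>c. poly c m) Q \<noteq> 0"
    by auto
  then show ?thesis
    unfolding eval2_def by (simp add: poly_roots_finite)
qed

text \<open>A weak Bezout theorem. If Q does not divide p, eliminating r gives a nonzero polynomial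
  in m that vanishes at all common zeros, and each fibre of Q is finite because its leading
  coefficient is constant; so there are only finitely many common zeros.\<close>

lemma prime_elem_vanishing:
  assumes Q: "prime_elem Q" "degree Q \<ge> 1" "lead_coeff Q = [:u:]" "u \<noteq> 0"
    and S: "infinite S" "\<And>z. z \<in> S \<Longrightarrow> eval2 Q z = 0" "\<And>z. z \<in> S \<Longrightarrow> eval2 p z = 0"
    and z: "eval2 Q z = 0"
  shows "eval2 p z = 0"
proof (rule ccontr)
  assume nz: "eval2 p z \<noteq> 0"
  then have "\<not> Q dvd p"
    using z by (auto simp: eval2_simps elim!: dvdE)
  then obtain A B R where R: "R \<noteq> 0" "A * p + B * Q = [:R:]"
    using prime_elem_elimination[OF Q(1,2)] by blast
  have "S \<subseteq> (SIGMA m : {m. poly R m = 0}. {r. eval2 Q (m, r) = 0})"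
  proof
    fix w assume w: "w \<in> S"
    have "eval2 (A * p + B * Q) w = 0"
      using S(2,3)[OF w] by (simp add: eval2_simps)
    then show "w \<in> (SIGMA m : {m. poly R m = 0}. {r. eval2 Q (m, r) = 0})"
      using S(2)[OF w] by (cases w) (simp add: R(2) eval2_const)
  qed
  moreover have "finite (SIGMA m : {m. poly R m = 0}. {r. eval2 Q (m, r) = 0})"
    using poly_roots_finite[OF R(1)] finite_fibre[OF Q(3,4)] by (intro finite_SigmaI) auto
  ultimately show False
    using S(1) finite_subset by blast
qed

section \<open>Algebraic sets and the double covering r -> r^2\<close>

lemma algebraic_set_zero_set [simp]: "algebraic_set (zero_set F)"
  by (auto simp: algebraic_set_def)

lemma algebraic_set_Un:
  assumes "algebraic_set X" "algebraic_set Y"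
  shows "algebraic_set (X \<union> Y)"
proof -
  obtain F G where "X = zero_set F" "Y = zero_set G"
    using assms by (auto simp: algebraic_set_def)
  then have "X \<union> Y = zero_set ((\<lambda>(p, q). p * q) ` (F \<times> G))"
    by (fastforce simp: zero_set_def eval2_simps)
  then show ?thesis
    by simp
qed

lemma algebraic_set_Int:
  assumes "algebraic_set X" "algebraic_set Y"
  shows "algebraic_set (X \<inter> Y)"
proof -
  obtain F G where "X = zero_set F" "Y = zero_set G"
    using assms by (auto simp: algebraic_set_def)
  then have "X \<inter> Y = zero_set (F \<union> G)"
    by (auto simp: zero_set_def)
  then show ?thesis
    by simp
qed

lemma algebraic_set_vimage_square:
  assumes "algebraic_set X"
  shows "algebraic_set ((\<lambda>(m, r). (m, r ^ 2)) -` X)"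
proof -
  obtain F where F: "X = zero_set F"
    using assms by (auto simp: algebraic_set_def)
  have "\<exists>p'. \<forall>m r. eval2 p' (m, r) = eval2 p (m, r ^ 2)" for p
  proof (induction p rule: pCons_induct)
    case (pCons a p)
    then obtain p' where p': "eval2 p' (m, r) = eval2 p (m, r ^ 2)" for m r
      by blast
    have "\<forall>m r. eval2 (pCons a (pCons 0 p')) (m, r) = eval2 (pCons a p) (m, r ^ 2)"
      by (simp add: eval2_pCons p' power2_eq_square)
    then show ?case
      by blast
  qed (auto intro: exI[of _ 0])
  then obtain f where f: "eval2 (f p) (m, r) = eval2 p (m, r ^ 2)" for p m r
    by metis
  have "(\<lambda>(m, r). (m, r ^ 2)) -` X = zero_set (f ` F)"
    by (auto simp: F zero_set_def f)
  then show ?thesis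
    by simp
qed

lemma even_odd_parts: "\<exists>E D. \<forall>m r. eval2 p (m, r) = eval2 E (m, r ^ 2) + r * eval2 D (m, r ^ 2)"
proof (induction p rule: pCons_induct)
  case (pCons a p)
  then obtain E D where ED: "eval2 p (m, r) = eval2 E (m, r ^ 2) + r * eval2 D (m, r ^ 2)" for m r
    by blast
  have "\<forall>m r. eval2 (pCons a p) (m, r) = eval2 (pCons a D) (m, r ^ 2) + r * eval2 E (m, r ^ 2)"
    by (simp add: eval2_pCons ED power2_eq_square algebra_simps)
  then show ?case
    by blast
next
  case 0
  have "\<forall>m r. eval2 0 (m, r) = eval2 0 (m, r ^ 2) + r * eval2 0 (m, r ^ 2)"
    by simp
  then show ?case
    by blast
qed

text \<open>\<open>P\<close> is the norm of \<open>p\<close> along the double covering \<open>s = r\<^sup>2\<close>.\<close>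

lemma norm_polynomial: "\<exists>P. \<forall>m r. eval2 P (m, r ^ 2) = eval2 p (m, r) * eval2 p (m, - r)"
proof -
  obtain E D where "\<forall>m r. eval2 p (m, r) = eval2 E (m, r ^ 2) + r * eval2 D (m, r ^ 2)"
    using even_odd_parts by blast
  then have "eval2 (E * E - [:0, 1:] * D * D) (m, r ^ 2) = eval2 p (m, r) * eval2 p (m, - r)" for m r
    by (simp add: eval2_simps eval2_pCons eval2_const power2_eq_square algebra_simps)
  then show ?thesis
    by blast
qed

lemma algebraic_curveI:
  assumes "X = zero_set {p}" "z \<in> X" "w \<notin> X"
  shows "algebraic_curve X"
proof -
  have "nonconstant2 p"
  proof (rule ccontr)
    assume "\<not> nonconstant2 p"
    then have "p = [:[:coeff (coeff p 0) 0:]:]"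
      by (metis degree_0_id nonconstant2_def coeff_pCons_0 degree_eq_zeroE)
    then have "eval2 p z = eval2 p w"
      by (metis eval2_const poly_const_conv)
    then show False
      using assms by (simp add: zero_set_def)
  qed
  then show ?thesis
    using assms(1) by (auto simp: algebraic_curve_def)
qed

lemma zariski_closure_eqI:
  assumes "algebraic_set X" "S \<subseteq> X" "\<And>Y. algebraic_set Y \<Longrightarrow> S \<subseteq> Y \<Longrightarrow> X \<subseteq> Y"
  shows "zariski_closure S = X"
  using assms unfolding zariski_closure_def by blast

text \<open>The constant leading coefficient in r makes the projection to m surjective with finite
  fibres. Surjectivity gives infinitely many points; finiteness together with primality makes every
  infinite subset dense.\<close>

locale prime_curve =
  fixes Q :: poly2 and u :: complex
  assumes prime_Q: "prime_elem Q" and degree_Q: "degree Q \<ge> 1"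
    and lead_Q: "lead_coeff Q = [:u:]" and u: "u \<noteq> 0"
begin

abbreviation V where "V \<equiv> zero_set {Q}"

lemma infinite_subset_dense:
  assumes "infinite S" "S \<subseteq> V" "S \<subseteq> Y" "algebraic_set Y"
  shows "V \<subseteq> Y"
proof
  fix z assume "z \<in> V"
  obtain F where F: "Y = zero_set F"
    using assms(4) by (auto simp: algebraic_set_def)
  have "eval2 p z = 0" if "p \<in> F" for p
    using prime_elem_vanishing[OF prime_Q degree_Q lead_Q u assms(1), of p z] assms(2,3) \<open>z \<in> V\<close> that
    by (auto simp: F zero_set_def)
  then show "z \<in> Y"
    by (simp add: F zero_set_def)
qed

lemma fibre_nonempty: "\<exists>r. (m, r) \<in> V"
proof -
  let ?q = "map_poly (\<lambda>c. poly c m) Q"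
  have "coeff ?q (degree Q) \<noteq> 0"
    using lead_Q u by (simp add: coeff_map_poly)
  then have "degree ?q \<ge> 1"
    using degree_Q le_degree order.trans by blast
  then have "\<not> constant (poly ?q)"
    by (simp add: constant_degree)
  then obtain r where "poly ?q r = 0"
    using fundamental_theorem_of_algebra by blast
  then show ?thesis
    by (auto simp: zero_set_def eval2_def)
qed

lemma infinite_V: "infinite V"
proof
  assume "finite V"
  moreover have "fst ` V = UNIV"
    using fibre_nonempty by force
  ultimately show False
    using finite_imageI infinite_UNIV_char_0 by metis
qed

text \<open>Of two algebraic sets covering the infinite set \<open>V\<close>, one is infinite and
  therefore contains \<open>V\<close>.\<close>

lemma irreducible_V: "irreducible_alg V"
  unfolding irreducible_alg_def
proof (intro conjI allI impI)
  show "V \<noteq> {}"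
    using infinite_V by auto
  fix Y Z assume YZ: "algebraic_set Y \<and> algebraic_set Z \<and> V = Y \<union> Z"
  then have "infinite Y \<or> infinite Z"
    using infinite_V by auto
  then show "V = Y \<or> V = Z"
    using infinite_subset_dense[of Y Y] infinite_subset_dense[of Z Z] YZ by blast
qed simp

lemma closure_infinite_subset:
  assumes "infinite S" "S \<subseteq> V"
  shows "zariski_closure S = V"
  by (rule zariski_closure_eqI) (use infinite_subset_dense[OF assms] assms in auto)

end

text \<open>Continuous images of irreducible spaces are irreducible; continuity is
  \<open>algebraic_set_vimage_square\<close>.\<close>

lemma irreducible_alg_square_image:
  assumes "irreducible_alg X" "algebraic_set ((\<lambda>(m, r). (m, r ^ 2)) ` X)"
  shows "irreducible_alg ((\<lambda>(m, r). (m, r ^ 2)) ` X)"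
  unfolding irreducible_alg_def
proof (intro conjI allI impI)
  let ?f = "\<lambda>(m::complex, r::complex). (m, r ^ 2)"
  fix Y Z assume YZ: "algebraic_set Y \<and> algebraic_set Z \<and> ?f ` X = Y \<union> Z"
  have "algebraic_set X"
    using assms(1) by (simp add: irreducible_alg_def)
  then have "algebraic_set (X \<inter> ?f -` Y)" "algebraic_set (X \<inter> ?f -` Z)"
    using YZ algebraic_set_vimage_square by (auto intro!: algebraic_set_Int)
  moreover have "X = (X \<inter> ?f -` Y) \<union> (X \<inter> ?f -` Z)"
    using YZ by blast
  ultimately have "X = X \<inter> ?f -` Y \<or> X = X \<inter> ?f -` Z"
    using assms(1) unfolding irreducible_alg_def by blast
  then show "?f ` X = Y \<or> ?f ` X = Z"
    using YZ by blast
qed (use assms in \<open>auto simp: irreducible_alg_def\<close>)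

lemma irr_components_Un:
  assumes X: "irreducible_alg X" and Y: "irreducible_alg Y" and "\<not> X \<subseteq> Y" "\<not> Y \<subseteq> X"
  shows "irr_components (X \<union> Y) = {X, Y}"
proof -
  have sub: "Z \<subseteq> X \<or> Z \<subseteq> Y" if Z: "irreducible_alg Z" "Z \<subseteq> X \<union> Y" for Z
  proof -
    have "algebraic_set (Z \<inter> X)" "algebraic_set (Z \<inter> Y)" "Z = (Z \<inter> X) \<union> (Z \<inter> Y)"
      using assms Z by (auto simp: irreducible_alg_def intro!: algebraic_set_Int)
    then have "Z = Z \<inter> X \<or> Z = Z \<inter> Y"
      using Z(1) unfolding irreducible_alg_def by blast
    then show ?thesis
      by blast
  qed
  show ?thesis
  proof (intro equalityI subsetI)
    fix Z assume "Z \<in> irr_components (X \<union> Y)"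
    then have Z: "irreducible_alg Z" "Z \<subseteq> X \<union> Y"
      and max: "\<And>W. irreducible_alg W \<Longrightarrow> Z \<subseteq> W \<Longrightarrow> W \<subseteq> X \<union> Y \<Longrightarrow> W = Z"
      by (auto simp: irr_components_def)
    from sub[OF Z] show "Z \<in> {X, Y}"
      using max[OF X] max[OF Y] by blast
  next
    fix Z assume "Z \<in> {X, Y}"
    then show "Z \<in> irr_components (X \<union> Y)"
      using assms sub unfolding irr_components_def by blast
  qed
qed

section \<open>The curves Q(m, r) = 0 and Q(m, -r) = 0\<close>

lemma prime_curve_qpoly:
  assumes "l \<ge> 1" "e \<noteq> 0"
  shows "prime_curve (qpoly l e) (e ^ l)"
  using assms prime_elem_qpoly[OF assms] degree_qpoly[OF assms] coeff_qpoly_top[of l e]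
  by unfold_locales auto

definition qcurve :: "nat \<Rightarrow> complex \<Rightarrow> (complex \<times> complex) set" where
  "qcurve l e = zero_set {qpoly l e}"

lemma qcurve_iff: "(m, r) \<in> qcurve l e \<longleftrightarrow> chQ l m (e * r) = 0"
  by (simp add: qcurve_def zero_set_def eval2_qpoly)

lemma qcurve_at_0:
  assumes "l \<ge> 1"
  shows "(1, 0) \<notin> qcurve l e"
  using chQ_at_0[OF assms, of "1::complex"] by (auto simp: qcurve_iff)

text \<open>The fibre over m = 1 is nonempty, and \<open>chQ_mirror\<close> forbids common points
  over any nonzero m.\<close>

lemma qcurve_not_subset:
  assumes "l \<ge> 1" "e \<noteq> 0"
  shows "\<not> qcurve l e \<subseteq> qcurve l (- e)"
proof
  interpret prime_curve "qpoly l e" "e ^ l"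
    using assms by (rule prime_curve_qpoly)
  assume sub: "qcurve l e \<subseteq> qcurve l (- e)"
  obtain r where "(1, r) \<in> qcurve l e"
    using fibre_nonempty unfolding qcurve_def by blast
  then have "(1, r) \<in> qcurve l e" "(1, r) \<in> qcurve l (- e)"
    using sub by auto
  then show False
    using chQ_mirror[of 1 l "e * r"] assms(1) by (simp add: qcurve_iff)
qed

lemma qcurve_square_image:
  "(\<lambda>(m, r). (m, r ^ 2)) ` qcurve l (- e) = (\<lambda>(m, r). (m, r ^ 2)) ` qcurve l e"
proof -
  have sub: "(\<lambda>(m, r). (m, r ^ 2)) ` qcurve l (- e) \<subseteq> (\<lambda>(m, r). (m, r ^ 2)) ` qcurve l e" for e
  proof clarify
    fix m r assume "(m, r) \<in> qcurve l (- e)"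
    then have "(m, - r) \<in> qcurve l e"
      by (simp add: qcurve_iff)
    then show "(m, r ^ 2) \<in> (\<lambda>(m, r). (m, r ^ 2)) ` qcurve l e"
      by (intro image_eqI[of _ _ "(m, - r)"]) auto
  qed
  from sub[of e] sub[of "- e"] show ?thesis
    by auto
qed

text \<open>The image is closed: if the norm vanishes at (m, s), one of the two points over it, with
  r a square root of s, lies on the curve.\<close>

lemma qcurve_square_image_zero_set:
  "\<exists>P. (\<lambda>(m, r). (m, r ^ 2)) ` qcurve l e = zero_set {P}"
proof -
  obtain P where P: "eval2 P (m, r ^ 2) = eval2 (qpoly l e) (m, r) * eval2 (qpoly l e) (m, - r)" for m r
    using norm_polynomial by blast
  have "(\<lambda>(m, r). (m, r ^ 2)) ` qcurve l e = zero_set {P}"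
  proof (intro equalityI subsetI)
    fix z assume "z \<in> (\<lambda>(m, r). (m, r ^ 2)) ` qcurve l e"
    then show "z \<in> zero_set {P}"
      by (auto simp: qcurve_def zero_set_def P)
  next
    fix z assume z: "z \<in> zero_set {P}"
    obtain m s where ms: "z = (m, s)"
      by (cases z)
    have "eval2 P (m, (csqrt s) ^ 2) = 0"
      using z by (simp add: ms zero_set_def)
    then have "(m, csqrt s) \<in> qcurve l e \<or> (m, - csqrt s) \<in> qcurve l e"
      unfolding P by (auto simp: qcurve_def zero_set_def)
    then show "z \<in> (\<lambda>(m, r). (m, r ^ 2)) ` qcurve l e"
    proof
      assume "(m, csqrt s) \<in> qcurve l e"
      then show ?thesis
        by (intro image_eqI[of _ _ "(m, csqrt s)"]) (auto simp: ms)
    next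
      assume "(m, - csqrt s) \<in> qcurve l e"
      then show ?thesis
        by (intro image_eqI[of _ _ "(m, - csqrt s)"]) (auto simp: ms)
    qed
  qed
  then show ?thesis
    by blast
qed

text \<open>The interface between algebra and dynamics. Containment and infinitude are enough to
  identify all three closures, because density in a prime curve is automatic.\<close>

lemma zariski_closures_on_qcurves:
  fixes S :: "(real \<times> real) set"
  assumes l: "l \<ge> 1"
    and sub: "complexify S \<subseteq> qcurve l 1 \<union> qcurve l (- 1)" "Sp \<subseteq> S" "Sm \<subseteq> S"
    and p: "infinite Sp" "complexify Sp \<subseteq> qcurve l 1"
    and m: "infinite Sm" "complexify Sm \<subseteq> qcurve l (- 1)"
  defines "H \<equiv> zariski_closure (complexify S)"
    and "Hp \<equiv> zariski_closure (complexify Sp)"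
    and "Hm \<equiv> zariski_closure (complexify Sm)"
  shows "irreducible_alg ((\<lambda>(\<mu>, r). (\<mu>, r ^ 2)) ` H)
       \<and> algebraic_curve ((\<lambda>(\<mu>, r). (\<mu>, r ^ 2)) ` H)
       \<and> irr_components H = {Hp, Hm} \<and> Hp \<noteq> Hm \<and> algebraic_curve Hp \<and> algebraic_curve Hm"
proof -
  interpret P: prime_curve "qpoly l 1" "1 ^ l"
    using l by (rule prime_curve_qpoly) simp
  interpret M: prime_curve "qpoly l (- 1)" "(- 1) ^ l"
    using l by (rule prime_curve_qpoly) simp
  have inj: "inj (\<lambda>(a, b). (complex_of_real a, complex_of_real b))"
    by (auto simp: inj_def)
  have infp: "infinite (complexify Sp)" and infm: "infinite (complexify Sm)"
    using p(1) m(1) unfolding complexify_def by (simp_all add: finite_image_iff inj_on_subset[OF inj])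
  have Hp: "Hp = qcurve l 1"
    unfolding Hp_def using P.closure_infinite_subset[OF infp] p(2) by (simp add: qcurve_def)
  have Hm: "Hm = qcurve l (- 1)"
    unfolding Hm_def using M.closure_infinite_subset[OF infm] m(2) by (simp add: qcurve_def)
  have subc: "complexify Sp \<subseteq> complexify S" "complexify Sm \<subseteq> complexify S"
    using sub(2,3) by (auto simp: complexify_def)
  have H: "H = qcurve l 1 \<union> qcurve l (- 1)"
    unfolding H_def
  proof (rule zariski_closure_eqI)
    show "algebraic_set (qcurve l 1 \<union> qcurve l (- 1))"
      by (simp add: qcurve_def algebraic_set_Un)
    fix Y assume "algebraic_set Y" "complexify S \<subseteq> Y"
    then show "qcurve l 1 \<union> qcurve l (- 1) \<subseteq> Y"
      using P.infinite_subset_dense[OF infp, of Y] M.infinite_subset_dense[OF infm, of Y] p(2) m(2) subc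
      unfolding qcurve_def by blast
  qed (rule sub(1))
  have image_H: "(\<lambda>(\<mu>, r). (\<mu>, r ^ 2)) ` H = (\<lambda>(\<mu>, r). (\<mu>, r ^ 2)) ` qcurve l 1"
    using qcurve_square_image[of l 1] by (simp add: H image_Un)
  obtain N where N: "(\<lambda>(\<mu>, r). (\<mu>, r ^ 2)) ` qcurve l 1 = zero_set {N}"
    using qcurve_square_image_zero_set by blast
  have irr: "irreducible_alg (qcurve l 1)" "irreducible_alg (qcurve l (- 1))"
    unfolding qcurve_def by (rule P.irreducible_V M.irreducible_V)+
  then have ne: "\<exists>z. z \<in> qcurve l 1" "\<exists>z. z \<in> qcurve l (- 1)"
    by (auto simp: irreducible_alg_def)
  have nin: "(1, 0) \<notin> (\<lambda>(\<mu>, r). (\<mu>, r ^ 2)) ` qcurve l 1"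
    using qcurve_at_0[OF l, of 1] by auto
  have "irreducible_alg ((\<lambda>(\<mu>, r). (\<mu>, r ^ 2)) ` H)"
    unfolding image_H using irr(1) by (rule irreducible_alg_square_image) (simp add: N)
  moreover have "algebraic_curve ((\<lambda>(\<mu>, r). (\<mu>, r ^ 2)) ` H)"
    unfolding image_H using ne(1) nin by (blast intro: algebraic_curveI[OF N])
  moreover have "irr_components H = {Hp, Hm}"
    unfolding H Hp Hm using irr
    by (rule irr_components_Un) (use qcurve_not_subset[OF l, of 1] qcurve_not_subset[OF l, of "-1"] in auto)
  moreover have "Hp \<noteq> Hm"
    unfolding Hp Hm using qcurve_not_subset[OF l, of 1] by auto
  moreover have "algebraic_curve Hp" "algebraic_curve Hm"
    unfolding Hp Hm using ne qcurve_at_0[OF l] by (auto intro!: algebraic_curveI simp: qcurve_def)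
  ultimately show ?thesis
    by blast
qed

section \<open>The recurrence on the integers\<close>

definition rsys :: "nat \<Rightarrow> real \<Rightarrow> real \<Rightarrow> (int \<Rightarrow> real) \<Rightarrow> bool" where
  "rsys l m R x \<longleftrightarrow> (\<forall>j. (of_int j - real l) * x (j - 1) + R * x (int l - 1 - j) = m * x j)"

lemma rsysD: "rsys l m R x \<Longrightarrow> (of_int j - real l) * x (j - 1) + R * x (int l - 1 - j) = m * x j"
  by (simp add: rsys_def)

definition bseq :: "(int \<Rightarrow> real) \<Rightarrow> bool" where
  "bseq x \<longleftrightarrow> (\<exists>C. \<forall>j. \<bar>x j\<bar> \<le> C)"

text \<open>The path never stops: its even places run down through all indices below l, its odd
  places run up through all indices from 0. So it reaches every integer, and an index of the block
  is met twice. The places l - 1 and l are the two consecutive visits to the index where the path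
  turns.\<close>

fun zig :: "nat \<Rightarrow> (int \<Rightarrow> real) \<Rightarrow> nat \<Rightarrow> real" where
  "zig l x n = (if even n then x (int l - 1 - int (n div 2)) else x (int (n div 2)))"

declare zig.simps [simp del]

lemma zig_even: "zig l x (2 * i) = x (int l - 1 - int i)"
  and zig_odd: "zig l x (Suc (2 * i)) = x (int i)"
  by (simp_all add: zig.simps)

lemma zig_close:
  assumes "l \<ge> 1"
  shows "zig l x l = zig l x (l - 1)"
proof (cases "even l")
  case True
  with assms obtain k where l: "l = 2 * Suc k"
    by (metis One_nat_def dvd_def even_Suc mult_0_right not0_implies_Suc not_less_eq_eq zero_le)
  show ?thesis
    using zig_even[of l x "Suc k"] zig_odd[of l x k] by (simp add: l)
next
  case False
  then obtain k where l: "l = Suc (2 * k)"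
    by (auto elim: oddE)
  show ?thesis
    using zig_even[of l x k] zig_odd[of l x k] by (simp add: l)
qed

text \<open>The product of the factors m and i + 1 by which \<open>zrec\<close> divides during the
  first n steps.\<close>

definition zscale :: "real \<Rightarrow> nat \<Rightarrow> real" where
  "zscale m n = m ^ (Suc n div 2) * fact (n div 2)"

lemma zscale_even: "zscale m (2 * i) = m ^ i * fact i"
  and zscale_odd: "zscale m (Suc (2 * i)) = m ^ Suc i * fact i"
  by (simp_all add: zscale_def)

lemma zscale_nonzero: "m \<noteq> 0 \<Longrightarrow> zscale m n \<noteq> 0"
  by (simp add: zscale_def)

lemma zscale_close:
  assumes "l \<ge> 1"
  shows "zscale m l = (if odd l then m else of_nat (l div 2)) * zscale m (l - 1)"
proof (cases "even l")
  case True
  with assms obtain k where l: "l = 2 * Suc k"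
    by (metis One_nat_def dvd_def even_Suc mult_0_right not0_implies_Suc not_less_eq_eq zero_le)
  show ?thesis
    using zscale_even[of m "Suc k"] zscale_odd[of m k] by (simp add: l)
next
  case False
  then obtain k where l: "l = Suc (2 * k)"
    by (auto elim: oddE)
  show ?thesis
    using zscale_even[of m k] zscale_odd[of m k] by (simp add: l)
qed

text \<open>Along the path \<open>l-1, 0, l-2, 1, \<dots>\<close> the system is a three-term recursion; \<open>v\<close> is the value
  at the index \<open>-1\<close> preceding the path.\<close>

definition zrec :: "nat \<Rightarrow> real \<Rightarrow> real \<Rightarrow> real \<Rightarrow> (nat \<Rightarrow> real) \<Rightarrow> bool" where
  "zrec l m R v y \<longleftrightarrow>
     (\<forall>i. m * y (Suc (2 * i)) = R * y (2 * i) - (real l - real i) * (if i = 0 then v else y (2 * i - 1))) \<and>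
     (\<forall>i. real (Suc i) * y (2 * Suc i) = R * y (Suc (2 * i)) - m * y (2 * i))"

lemma zrecD:
  assumes "zrec l m R v y"
  shows "m * y (Suc (2 * i)) = R * y (2 * i) - (real l - real i) * (if i = 0 then v else y (2 * i - 1))"
    "real (Suc i) * y (2 * Suc i) = R * y (Suc (2 * i)) - m * y (2 * i)"
  using assms unfolding zrec_def by blast+

lemma zrec_zig:
  assumes "rsys l m R x"
  shows "zrec l m R (x (- 1)) (zig l x)"
  unfolding zrec_def
proof (intro conjI allI)
  fix i
  have pred: "(if i = 0 then x (- 1) else zig l x (2 * i - 1)) = x (int i - 1)"
    using zig_odd[of l x "i - 1"] by (cases i) auto
  show "m * zig l x (Suc (2 * i)) = R * zig l x (2 * i) -
      (real l - real i) * (if i = 0 then x (- 1) else zig l x (2 * i - 1))"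
    using rsysD[OF assms, of "int i"] unfolding pred zig_even zig_odd by (simp add: algebra_simps)
  have "int l - 1 - int i - 1 = int l - 1 - int (Suc i)" "int l - 1 - (int l - 1 - int i) = int i"
    by simp_all
  then show "real (Suc i) * zig l x (2 * Suc i) = R * zig l x (Suc (2 * i)) - m * zig l x (2 * i)"
    using rsysD[OF assms, of "int l - 1 - int i"]
    unfolding zig_even zig_odd by (simp add: algebra_simps)
qed

lemma zrec_chn:
  assumes "zrec l m R 0 y"
  shows "zscale m n * y n = chn l m R n * y 0"
proof -
  have "zscale m (2 * i) * y (2 * i) = chn l m R (2 * i) * y 0 \<and>
        zscale m (Suc (2 * i)) * y (Suc (2 * i)) = chn l m R (Suc (2 * i)) * y 0" for i
  proof (induction i)
    case 0
    then show ?case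
      using zrecD(1)[OF assms, of 0] by (simp add: zscale_def)
  next
    case (Suc i)
    have "zscale m (2 * Suc i) * y (2 * Suc i) = m ^ Suc i * fact i * (real (Suc i) * y (2 * Suc i))"
      unfolding zscale_even by (simp add: algebra_simps)
    also have "\<dots> = R * (zscale m (Suc (2 * i)) * y (Suc (2 * i))) - m\<^sup>2 * (zscale m (2 * i) * y (2 * i))"
      unfolding zrecD(2)[OF assms] zscale_even zscale_odd by (simp add: algebra_simps power2_eq_square)
    also have "\<dots> = chn l m R (2 * Suc i) * y 0"
      using Suc by (simp add: chc_def algebra_simps)
    finally have 1: "zscale m (2 * Suc i) * y (2 * Suc i) = chn l m R (2 * Suc i) * y 0" .
    have "zscale m (Suc (2 * Suc i)) * y (Suc (2 * Suc i)) =
        m ^ Suc i * fact (Suc i) * (m * y (Suc (2 * Suc i)))"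
      unfolding zscale_odd by (simp add: algebra_simps)
    also have "\<dots> = R * (zscale m (2 * Suc i) * y (2 * Suc i)) -
        real (Suc i) * (real l - real (Suc i)) * (zscale m (Suc (2 * i)) * y (Suc (2 * i)))"
      unfolding zrecD(1)[OF assms] zscale_even zscale_odd by (simp add: algebra_simps)
    also have "\<dots> = chn l m R (Suc (2 * Suc i)) * y 0"
      unfolding 1 using Suc by (simp add: chc_def algebra_simps)
    finally show ?case
      using 1 by blast
  qed
  from this[of "n div 2"] show ?thesis
    by (cases "even n") (auto elim!: evenE oddE)
qed

text \<open>The loop entry in \<open>chQ\<close> equals the last factor of \<open>zscale\<close>. So
  \<open>chQ\<close> measures the mismatch between the two visits to the turning index, and its
  vanishing is the condition for closing up the block.\<close>

lemma zrec_close: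
  assumes "zrec l m R 0 y" "l \<ge> 1" "m \<noteq> 0"
  shows "chQ l m R * y 0 = zscale m l * (y l - y (l - 1))"
proof -
  have "chQ l m R * y 0 = chn l m R l * y 0 -
      (if odd l then m else of_nat (l div 2)) * (chn l m R (l - 1) * y 0)"
    by (simp add: chQ_def algebra_simps)
  also have "\<dots> = zscale m l * y l - (if odd l then m else of_nat (l div 2)) * zscale m (l - 1) * y (l - 1)"
    unfolding zrec_chn[OF assms(1), symmetric] by simp
  finally show ?thesis
    unfolding zscale_close[OF assms(2), of m, symmetric] by (simp add: algebra_simps)
qed

text \<open>When \<open>x (- 1)\<close> vanishes the recursion along the path is homogeneous and
  \<open>zig l x 0\<close> determines every value. As the path reaches every integer, that value is
  nonzero, and the equal values at the turning index force \<open>chQ\<close> to vanish.\<close>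

lemma rsys_chQ_zero:
  assumes sys: "rsys l m R x" and m: "m \<noteq> 0" and l: "l \<ge> 1" and x: "x (- 1) = 0" "x k \<noteq> 0"
  shows "chQ l m R = 0"
proof -
  have z: "zrec l m R 0 (zig l x)"
    using zrec_zig[OF sys] x(1) by simp
  have "zig l x 0 \<noteq> 0"
  proof
    assume "zig l x 0 = 0"
    then have zero: "zig l x n = 0" for n
      using zrec_chn[OF z, of n] zscale_nonzero[OF m, of n] by simp
    have "x k = 0"
    proof (cases "k \<ge> 0")
      case True
      then show ?thesis
        using zig_odd[of l x "nat k"] zero by simp
    next
      case False
      then show ?thesis
        using zig_even[of l x "nat (int l - 1 - k)"] zero by simp
    qed
    with x(2) show False ..
  qed
  then show ?thesis
    using zrec_close[OF z l m] zig_close[OF l, of x] by simp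
qed

lemma zrec_exists:
  assumes "m \<noteq> 0"
  shows "\<exists>y. zrec l m R v y \<and> y 0 = y0"
proof -
  \<comment> \<open>The state before step i is the pair of y (2i - 1) and y (2i), with v in the role
    of y at -1.\<close>
  define step where "step i p = (case p of (a, b) \<Rightarrow>
      let c = (R * b - (real l - real i) * a) / m in (c, (R * c - m * b) / real (Suc i)))"
    for i :: nat and p :: "real \<times> real"
  define s where "s = rec_nat (v, y0) step"
  have s: "s 0 = (v, y0)" "s (Suc i) = step i (s i)" for i
    by (simp_all add: s_def)
  define y where "y n = (if even n then snd (s (n div 2)) else fst (s (Suc (n div 2))))" for n
  have y: "y (2 * i) = snd (s i)" "y (Suc (2 * i)) = fst (s (Suc i))" for i
    by (simp_all add: y_def)
  have pr: "(if i = 0 then v else y (2 * i - 1)) = fst (s i)" for i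
    using s(1) y(2)[of "i - 1"] by (cases i) auto
  have "zrec l m R v y"
    unfolding zrec_def pr y using assms
    by (auto simp: s step_def Let_def split: prod.splits)
  moreover have "y 0 = y0"
    using y(1)[of 0] s(1) by simp
  ultimately show ?thesis
    by blast
qed

text \<open>The system is triangular. Equations with j < 0 or j > l involve outer values only, and
  so does j = l because its coefficient j - l is 0. The block sees the outside only through the
  index -1 in the equation j = 0.\<close>

lemma rsys_glue:
  assumes y: "zrec l m R (w (- 1)) y" "y l = y (l - 1)" and l: "l \<ge> 1"
    and w: "\<And>j. j < 0 \<or> j \<ge> int l \<Longrightarrow>
        (of_int j - real l) * w (j - 1) + R * w (int l - 1 - j) = m * w j"
  defines "x \<equiv> \<lambda>j. if 0 \<le> j \<and> j < int l
      then (if 2 * j + 1 \<le> int l then y (nat (2 * j + 1)) else y (nat (2 * (int l - 1 - j)))) else w j"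
  shows "rsys l m R x" "x (int l - 1) = y 0"
proof -
  have odd_y: "x (int i) = y (Suc (2 * i))" if "2 * i + 1 \<le> l" for i
    using that l by (auto simp: x_def nat_add_distrib nat_mult_distrib)
  have even_y: "x (int l - 1 - int i) = y (2 * i)" if "2 * i \<le> l" "i < l" for i
  proof (cases "2 * (int l - 1 - int i) + 1 \<le> int l")
    \<comment> \<open>This is the turning index. There x stores the value of the other visit, and
      the hypothesis \<open>y l = y (l - 1)\<close> identifies the two.\<close>
    case True
    then have "l = 2 * i \<or> l = Suc (2 * i)"
      using that by presburger
    then show ?thesis
    proof
      assume eq: "l = 2 * i"
      then have "2 * (int l - 1 - int i) + 1 = int (l - 1)"
        using that by (simp add: of_nat_diff)
      then have "nat (2 * (int l - 1 - int i) + 1) = l - 1"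
        by simp
      then show ?thesis
        using True that y(2) eq by (simp add: x_def)
    next
      assume eq: "l = Suc (2 * i)"
      then have "2 * (int l - 1 - int i) + 1 = int l"
        by simp
      then have "nat (2 * (int l - 1 - int i) + 1) = l"
        by simp
      then show ?thesis
        using True that y(2) eq by (simp add: x_def)
    qed
  next
    case False
    then show ?thesis
      using that by (simp add: x_def nat_mult_distrib)
  qed
  show "x (int l - 1) = y 0"
    using even_y[of 0] l by simp
  show "rsys l m R x"
    unfolding rsys_def
  proof
    fix j
    consider "j < 0 \<or> j > int l" | "j = int l" | "0 \<le> j" "2 * j + 1 \<le> int l" | "int l < 2 * j + 1" "j < int l"
      by linarith
    then show "(of_int j - real l) * x (j - 1) + R * x (int l - 1 - j) = m * x j"
    proof cases
      case 1
      then have "x j = w j" "x (j - 1) = w (j - 1)" "x (int l - 1 - j) = w (int l - 1 - j)"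
        by (auto simp: x_def)
      then show ?thesis
        using w[of j] 1 by auto
    next
      case 2
      then show ?thesis
        using w[of j] by (simp add: x_def)
    next
      case 3
      define i where "i = nat j"
      have i: "j = int i" "2 * i + 1 \<le> l"
        using 3 by (auto simp: i_def)
      have "x (j - 1) = (if i = 0 then w (- 1) else y (2 * i - 1))"
      proof (cases i)
        case (Suc k)
        then have "j - 1 = int k"
          using i by simp
        then show ?thesis
          using odd_y[of k] Suc i by simp
      qed (simp add: i x_def)
      then show ?thesis
        using zrecD(1)[OF y(1), of i] odd_y[of i] even_y[of i] i by (simp add: algebra_simps)
    next
      case 4
      define i where "i = nat (int l - 1 - j)"
      have i: "j = int l - 1 - int i" "2 * i + 2 \<le> l"
        using 4 by (auto simp: i_def)
      have 1: "x (j - 1) = y (2 * Suc i)"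
      proof -
        have jj: "j - 1 = int l - 1 - int (Suc i)"
          using i(1) by simp
        show ?thesis
          unfolding jj using even_y[of "Suc i"] i(2) by simp
      qed
      have 2: "x (int l - 1 - j) = y (Suc (2 * i))" "x j = y (2 * i)"
        using odd_y[of i] even_y[of i] i by simp_all
      have 3: "of_int j - real l = - real (Suc i)"
        using i by simp
      show ?thesis
        unfolding 1 2 3 using zrecD(2)[OF y(1), of i] by linarith
    qed
  qed
qed

lemma rsys_from_zero:
  assumes "chQ l m R = 0" "m \<noteq> 0" "l \<ge> 1"
  shows "\<exists>x k. rsys l m R x \<and> bseq x \<and> x k \<noteq> 0"
proof -
  obtain y where y: "zrec l m R 0 y" "y 0 = 1"
    using zrec_exists[OF assms(2)] by blast
  have "y l = y (l - 1)"
    using zrec_close[OF y(1) assms(3,2)] assms(1) zscale_nonzero[OF assms(2), of l] by simp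
  note g = rsys_glue[of l m R "\<lambda>_. 0", OF y(1) this assms(3)]
  define x where "x = (\<lambda>j. if 0 \<le> j \<and> j < int l
      then (if 2 * j + 1 \<le> int l then y (nat (2 * j + 1)) else y (nat (2 * (int l - 1 - j)))) else 0)"
  have "\<bar>x j\<bar> \<le> (\<Sum>n\<le>2 * l. \<bar>y n\<bar>)" for j
  proof -
    have "\<bar>y n\<bar> \<le> (\<Sum>n\<le>2 * l. \<bar>y n\<bar>)" if "n \<le> 2 * l" for n
      using that by (intro member_le_sum) auto
    then show ?thesis
      by (auto simp: x_def sum_nonneg)
  qed
  then have "bseq x"
    by (auto simp: bseq_def)
  moreover have "rsys l m R x" "x (int l - 1) \<noteq> 0"
    using g y(2) by (simp_all add: x_def)
  ultimately show ?thesis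
    by blast
qed

text \<open>Outside \<open>{0..<l}\<close> the two systems with parameters \<open>R\<close> and \<open>-R\<close> are exchanged by a
  change of sign on the right half; only the middle block has to be solved anew, and there the
  number of unknowns exceeds the number of equations by one.\<close>

lemma rsys_mirror:
  assumes sys: "rsys l m R x" and b: "bseq x" and "x (- 1) \<noteq> 0" "m \<noteq> 0" "l \<ge> 1"
  shows "\<exists>x' k. rsys l m (- R) x' \<and> bseq x' \<and> x' k \<noteq> 0"
proof -
  obtain y1 where y1: "zrec l m (- R) (x (- 1)) y1" "y1 0 = 0"
    using zrec_exists[OF assms(4)] by blast
  obtain y2 where y2: "zrec l m (- R) 0 y2" "y2 0 = 1"
    using zrec_exists[OF assms(4)] by blast
  \<comment> \<open>The outer scale c and the starting value d of the block are free, against the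
    single closing condition.\<close>
  obtain c d where cd: "c * (y1 l - y1 (l - 1)) + d * (y2 l - y2 (l - 1)) = 0" "c \<noteq> 0 \<or> d \<noteq> 0"
  proof -
    have "\<exists>c d. c * a + d * b = 0 \<and> (c \<noteq> 0 \<or> d \<noteq> 0)" for a b :: real
    proof (cases "b = 0")
      case True
      then show ?thesis
        by (intro exI[of _ 0] exI[of _ 1]) simp
    next
      case False
      then show ?thesis
        by (intro exI[of _ b] exI[of _ "- a"]) (simp add: mult.commute)
    qed
    then show ?thesis
      using that by blast
  qed
  define y where "y n = c * y1 n + d * y2 n" for n
  define w where "w j = (if j < 0 then c * x j else - c * x j)" for j
  have "zrec l m (- R) (w (- 1)) y"
    unfolding zrec_def
  proof (intro conjI allI)
    fix i
    have "(if i = 0 then w (- 1) else y (2 * i - 1)) = c * (if i = 0 then x (- 1) else y1 (2 * i - 1))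
        + d * (if i = 0 then 0 else y2 (2 * i - 1))"
      by (simp add: w_def y_def)
    moreover have "m * y (Suc (2 * i)) = c * (m * y1 (Suc (2 * i))) + d * (m * y2 (Suc (2 * i)))"
      by (simp add: y_def algebra_simps)
    ultimately show "m * y (Suc (2 * i)) = - R * y (2 * i) - (real l - real i) * (if i = 0 then w (- 1) else y (2 * i - 1))"
      unfolding zrecD(1)[OF y1(1)] zrecD(1)[OF y2(1)] by (simp add: y_def algebra_simps)
    have "real (Suc i) * y (2 * Suc i) = c * (real (Suc i) * y1 (2 * Suc i)) + d * (real (Suc i) * y2 (2 * Suc i))"
      by (simp add: y_def algebra_simps)
    then show "real (Suc i) * y (2 * Suc i) = - R * y (Suc (2 * i)) - m * y (2 * i)"
      unfolding zrecD(2)[OF y1(1)] zrecD(2)[OF y2(1)] by (simp add: y_def algebra_simps)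
  qed
  moreover have "y l = y (l - 1)"
    using cd(1) by (simp add: y_def algebra_simps)
  moreover have "(of_int j - real l) * w (j - 1) + - R * w (int l - 1 - j) = m * w j"
    if "j < 0 \<or> j \<ge> int l" for j
  proof -
    define s where "s = (if j < 0 then c else - c)"
    have w1: "w j = s * x j"
      by (simp add: s_def w_def)
    have w2: "(of_int j - real l) * w (j - 1) = s * ((of_int j - real l) * x (j - 1))"
    \<comment> \<open>Only at j = l do j - 1 and j lie on different sides of the sign change, and
      there the coefficient is 0.\<close>
    proof (cases "j = int l")
      case False
      then have "w (j - 1) = s * x (j - 1)"
        using that by (auto simp: w_def s_def)
      then show ?thesis
        by simp
    qed simp
    have w3: "- R * w (int l - 1 - j) = s * (R * x (int l - 1 - j))"
      using that assms(5) by (auto simp: w_def s_def)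
    show ?thesis
      unfolding w1 w2 w3 distrib_left[symmetric] rsysD[OF sys] by simp
  qed
  ultimately have g: "zrec l m (- R) (w (- 1)) y" "y l = y (l - 1)"
    "\<And>j. j < 0 \<or> j \<ge> int l \<Longrightarrow> (of_int j - real l) * w (j - 1) + - R * w (int l - 1 - j) = m * w j"
    by blast+
  define x' where "x' = (\<lambda>j. if 0 \<le> j \<and> j < int l
      then (if 2 * j + 1 \<le> int l then y (nat (2 * j + 1)) else y (nat (2 * (int l - 1 - j)))) else w j)"
  have x': "rsys l m (- R) x'" "x' (int l - 1) = y 0"
    unfolding x'_def using rsys_glue[of l m "- R" w y, OF g(1,2) assms(5) g(3)] by simp_all
  obtain K where K: "\<bar>x j\<bar> \<le> K" for j
    using b by (auto simp: bseq_def)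
  have "\<bar>x' j\<bar> \<le> (\<Sum>n\<le>2 * l. \<bar>y n\<bar>) + \<bar>c\<bar> * K" for j
  proof -
    have K0: "0 \<le> \<bar>c\<bar> * K"
      using K[of 0] by simp
    have S0: "0 \<le> (\<Sum>n\<le>2 * l. \<bar>y n\<bar>)"
      by (simp add: sum_nonneg)
    have "\<bar>y n\<bar> \<le> (\<Sum>n\<le>2 * l. \<bar>y n\<bar>) + \<bar>c\<bar> * K" if "n \<le> 2 * l" for n
      using K0 member_le_sum[of n "{..2 * l}" "\<lambda>n. \<bar>y n\<bar>"] that by simp
    moreover have "\<bar>w j\<bar> \<le> (\<Sum>n\<le>2 * l. \<bar>y n\<bar>) + \<bar>c\<bar> * K"
    proof -
      have "\<bar>w j\<bar> = \<bar>c\<bar> * \<bar>x j\<bar>"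
        by (simp add: w_def abs_mult)
      then show ?thesis
        using S0 mult_left_mono[OF K[of j], of "\<bar>c\<bar>"] by linarith
    qed
    ultimately show ?thesis
      by (auto simp: x'_def)
  qed
  then have "bseq x'"
    by (auto simp: bseq_def)
  \<comment> \<open>The start of the block carries d and the index -1 carries c times a nonzero
    value, so either choice leaves a nonzero entry.\<close>
  moreover have "\<exists>k. x' k \<noteq> 0"
  proof (cases "c = 0")
    case True
    then have "x' (int l - 1) \<noteq> 0"
      using cd(2) x'(2) y1(2) y2(2) by (simp add: y_def)
    then show ?thesis ..
  next
    case False
    then have "x' (- 1) \<noteq> 0"
      using assms(3) by (simp add: x'_def w_def)
    then show ?thesis ..
  qed
  ultimately show ?thesis
    using x'(1) by blast
qed

text \<open>Each use of the recursion gains a factor \<open>1/|j|\<close>.\<close>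

lemma rsys_decay_step:
  assumes sys: "rsys l m R x" and C: "\<And>j. \<bar>x j\<bar> * (1 + \<bar>of_int j\<bar>) ^ n \<le> C"
  shows "\<exists>C'. \<forall>j. \<bar>x j\<bar> * (1 + \<bar>of_int j\<bar>) ^ Suc n \<le> C'"
proof -
  have C0: "C \<ge> 0"
    using C[of 0] by simp
  \<comment> \<open>Chosen so that 1 + |j| is at most L (1 + |i|) for both neighbours i = j + 1 and
    i = l - 2 - j in the recursion.\<close>
  define L where "L = real l + 3"
  have L: "L \<ge> 3"
    by (simp add: L_def)
  have shift: "\<bar>x i\<bar> * (1 + \<bar>of_int j\<bar>) ^ n \<le> C * L ^ n"
    if "1 + \<bar>of_int j :: real\<bar> \<le> L * (1 + \<bar>of_int i\<bar>)" for i j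
  proof -
    have "(1 + \<bar>of_int j :: real\<bar>) ^ n \<le> (L * (1 + \<bar>of_int i\<bar>)) ^ n"
      using that by (intro power_mono) auto
    then have "\<bar>x i\<bar> * (1 + \<bar>of_int j\<bar>) ^ n \<le> \<bar>x i\<bar> * (L * (1 + \<bar>of_int i\<bar>)) ^ n"
      by (intro mult_left_mono) auto
    also have "\<dots> = (\<bar>x i\<bar> * (1 + \<bar>of_int i\<bar>) ^ n) * L ^ n"
      by (simp add: power_mult_distrib)
    also have "\<dots> \<le> C * L ^ n"
      using C[of i] L by (intro mult_right_mono) auto
    finally show ?thesis .
  qed
  have grow: "L * (1 + \<bar>of_int i\<bar>) \<ge> real l + 3 + \<bar>of_int i\<bar>" for i :: int
  proof -
    have "1 * \<bar>of_int i :: real\<bar> \<le> L * \<bar>of_int i\<bar>"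
      using L by (intro mult_right_mono) auto
    then show ?thesis
      unfolding distrib_left by (simp add: L_def)
  qed
  have main: "\<bar>x j\<bar> * (1 + \<bar>of_int j\<bar>) ^ n * \<bar>of_int (j + 1) - real l\<bar> \<le> (\<bar>m\<bar> + \<bar>R\<bar>) * (C * L ^ n)" for j
  proof -
    have "(of_int (j + 1) - real l) * x j = m * x (j + 1) - R * x (int l - 2 - j)"
      using rsysD[OF sys, of "j + 1"] by (simp add: algebra_simps)
    then have "\<bar>of_int (j + 1) - real l\<bar> * \<bar>x j\<bar> = \<bar>m * x (j + 1) - R * x (int l - 2 - j)\<bar>"
      by (metis abs_mult)
    also have "\<dots> \<le> \<bar>m\<bar> * \<bar>x (j + 1)\<bar> + \<bar>R\<bar> * \<bar>x (int l - 2 - j)\<bar>"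
      unfolding abs_mult[symmetric] by (rule abs_triangle_ineq4)
    finally have "\<bar>of_int (j + 1) - real l\<bar> * \<bar>x j\<bar> * (1 + \<bar>of_int j\<bar>) ^ n
        \<le> (\<bar>m\<bar> * \<bar>x (j + 1)\<bar> + \<bar>R\<bar> * \<bar>x (int l - 2 - j)\<bar>) * (1 + \<bar>of_int j\<bar>) ^ n"
      by (intro mult_right_mono) auto
    also have "\<dots> = \<bar>m\<bar> * (\<bar>x (j + 1)\<bar> * (1 + \<bar>of_int j\<bar>) ^ n) + \<bar>R\<bar> * (\<bar>x (int l - 2 - j)\<bar> * (1 + \<bar>of_int j\<bar>) ^ n)"
      by (simp add: algebra_simps)
    also have "\<dots> \<le> \<bar>m\<bar> * (C * L ^ n) + \<bar>R\<bar> * (C * L ^ n)"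
      using grow[of "j + 1"] grow[of "int l - 2 - j"] by (intro add_mono mult_left_mono shift) auto
    finally show ?thesis
      by (simp add: algebra_simps)
  qed
  have "\<bar>x j\<bar> * (1 + \<bar>of_int j\<bar>) ^ Suc n \<le> (\<bar>m\<bar> + \<bar>R\<bar>) * (C * L ^ n) + L * C" for j
  proof -
    have "\<bar>x j\<bar> * (1 + \<bar>of_int j\<bar>) ^ Suc n = \<bar>x j\<bar> * (1 + \<bar>of_int j\<bar>) ^ n * (1 + \<bar>of_int j\<bar>)"
      by (simp add: algebra_simps)
    also have "\<dots> \<le> \<bar>x j\<bar> * (1 + \<bar>of_int j\<bar>) ^ n * (\<bar>of_int (j + 1) - real l\<bar> + L)"
      by (intro mult_left_mono) (auto simp: L_def)
    also have "\<dots> = \<bar>x j\<bar> * (1 + \<bar>of_int j\<bar>) ^ n * \<bar>of_int (j + 1) - real l\<bar> + L * (\<bar>x j\<bar> * (1 + \<bar>of_int j\<bar>) ^ n)"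
      by (simp add: algebra_simps)
    also have "\<dots> \<le> (\<bar>m\<bar> + \<bar>R\<bar>) * (C * L ^ n) + L * C"
      using main[of j] C[of j] L by (intro add_mono mult_left_mono) auto
    finally show ?thesis .
  qed
  then show ?thesis
    by blast
qed

lemma rsys_decay:
  assumes "rsys l m R x" "bseq x"
  shows "\<exists>C. \<forall>j. \<bar>x j\<bar> * (1 + \<bar>of_int j\<bar>) ^ n \<le> C"
proof (induction n)
  case 0
  then show ?case
    using assms(2) by (simp add: bseq_def)
qed (use rsys_decay_step[OF assms(1)] in blast)

text \<open>For small \<open>m\<close> the values on the right half are nondecreasing in modulus, against
  \<open>rsys_decay\<close>.\<close>

lemma rsys_divergent:
  assumes sys: "rsys l m R x" and b: "bseq x" and m: "m \<noteq> 0" "\<bar>m\<bar> \<le> 1 / 2" and R: "R \<noteq> 0" and l: "l \<ge> 1"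
  shows "x (- 1) = 0"
proof (rule ccontr)
  assume v: "x (- 1) \<noteq> 0"
  define u where "u i = x (int l + int i)" for i
  \<comment> \<open>The right half u and the left half are coupled through R. Eliminating the left
    half leaves the three-term recursions \<open>rec0\<close> and \<open>rec\<close> for u
    alone.\<close>
  have eu: "m * u (Suc i) = real (Suc i) * u i + R * x (- 1 - int (Suc i))" for i
    using rsysD[OF sys, of "int l + int (Suc i)"] by (simp add: u_def algebra_simps)
  have ev: "real (l + Suc i) * x (- 1 - int (Suc i)) = R * u i - m * x (- 1 - int i)" for i
    using rsysD[OF sys, of "- 1 - int i"] by (simp add: u_def algebra_simps)
  have u0: "m * u 0 = R * x (- 1)"
    using rsysD[OF sys, of "int l"] by (simp add: u_def)
  have rec0: "real (Suc l) * m * u 1 = (real (Suc l) + R\<^sup>2 - m\<^sup>2) * u 0"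
  proof -
    have "real (Suc l) * m * u 1 = real (Suc l) * (m * u (Suc 0))"
      by simp
    also have "\<dots> = real (Suc l) * u 0 + R * (real (l + Suc 0) * x (- 1 - int (Suc 0)))"
      unfolding eu by (simp add: algebra_simps)
    also have "\<dots> = real (Suc l) * u 0 + R * R * u 0 - m * (R * x (- 1))"
      unfolding ev by (simp add: algebra_simps)
    finally show ?thesis
      unfolding u0[symmetric] by (simp add: algebra_simps power2_eq_square)
  qed
  have rec: "real (l + Suc (Suc i)) * m * u (Suc (Suc i)) =
      (real (Suc (Suc i)) * real (l + Suc (Suc i)) + R\<^sup>2 - m\<^sup>2) * u (Suc i) + m * real (Suc i) * u i" for i
  proof -
    have "real (l + Suc (Suc i)) * m * u (Suc (Suc i)) = real (l + Suc (Suc i)) * (m * u (Suc (Suc i)))"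
      by simp
    also have "\<dots> = real (l + Suc (Suc i)) * real (Suc (Suc i)) * u (Suc i)
        + R * (real (l + Suc (Suc i)) * x (- 1 - int (Suc (Suc i))))"
      unfolding eu by (simp add: algebra_simps)
    also have "\<dots> = real (l + Suc (Suc i)) * real (Suc (Suc i)) * u (Suc i)
        + R * R * u (Suc i) - m * (R * x (- 1 - int (Suc i)))"
      unfolding ev by (simp add: algebra_simps)
    also have "R * x (- 1 - int (Suc i)) = m * u (Suc i) - real (Suc i) * u i"
      using eu[of i] by simp
    finally show ?thesis
      by (simp add: algebra_simps power2_eq_square)
  qed
  have m2: "m\<^sup>2 \<le> 1 / 4"
    using abs_le_square_iff[of m "1 / 2"] m(2) by (simp add: power2_eq_square)
  have R2: "R\<^sup>2 \<ge> 0"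
    by simp
  have mono: "\<bar>u i\<bar> \<le> \<bar>u (Suc i)\<bar>" for i
  proof (induction i)
    case 0
    have "real (Suc l) * \<bar>m\<bar> * \<bar>u 1\<bar> = \<bar>real (Suc l) * m * u 1\<bar>"
      by (simp add: abs_mult)
    also have "\<dots> = (real (Suc l) + R\<^sup>2 - m\<^sup>2) * \<bar>u 0\<bar>"
    proof -
      have "real (Suc l) + R\<^sup>2 - m\<^sup>2 \<ge> 0"
        using m2 R2 by linarith
      then show ?thesis
        unfolding rec0 abs_mult by simp
    qed
    also have "\<dots> \<ge> (real (Suc l) * \<bar>m\<bar>) * \<bar>u 0\<bar>"
    proof (rule mult_right_mono)
      have "q * \<bar>m\<bar> \<le> q + R\<^sup>2 - m\<^sup>2" if "q \<ge> 1" for q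
      proof -
        have "q * \<bar>m\<bar> \<le> q * (1 / 2)"
          using m(2) that by (intro mult_left_mono) auto
        then show ?thesis
          using m2 R2 that by linarith
      qed
      from this[of "real (Suc l)"] show "real (Suc l) * \<bar>m\<bar> \<le> real (Suc l) + R\<^sup>2 - m\<^sup>2"
        by simp
    qed simp
    finally have "(real (Suc l) * \<bar>m\<bar>) * \<bar>u 0\<bar> \<le> (real (Suc l) * \<bar>m\<bar>) * \<bar>u 1\<bar>" .
    then show ?case
      using m(1) by (subst (asm) mult_le_cancel_left_pos) auto
  next
    case (Suc i)
    define k where "k = real (Suc (Suc i))"
    define q where "q = real (l + Suc (Suc i))"
    have kq: "k \<ge> 2" "q \<ge> k + 1"
      using l by (auto simp: k_def q_def)
    \<comment> \<open>Here \<open>\<bar>m\<bar> \<le> 1 / 2\<close> enters. The main term k q is at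
      least 2 q, while the competing terms amount to at most q/2 + (k - 1)/2 + 1/4 with k <
      q.\<close>
    have lower: "k * q + R\<^sup>2 - m\<^sup>2 - \<bar>m\<bar> * (k - 1) \<ge> q * \<bar>m\<bar>"
    proof -
      have "\<bar>m\<bar> * (k - 1) \<le> (1 / 2) * (k - 1)" "q * \<bar>m\<bar> \<le> q * (1 / 2)" "2 * q \<le> k * q"
        using m(2) kq by (auto intro!: mult_right_mono mult_left_mono)
      note le = this
      have "b \<le> c + s - t - a"
        if "a \<le> (1 / 2) * (k - 1)" "b \<le> q * (1 / 2)" "2 * q \<le> c" "t \<le> 1 / 4" "0 \<le> s" for a b c s t
        using that kq by (simp add: field_simps)
      from this[OF le m2 R2] show ?thesis .
    qed
    have "\<bar>m * (k - 1) * u i\<bar> \<le> \<bar>m\<bar> * (k - 1) * \<bar>u (Suc i)\<bar>"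
      using Suc kq by (simp add: abs_mult mult_left_mono)
    moreover have "(k * q + R\<^sup>2 - m\<^sup>2) * \<bar>u (Suc i)\<bar> = \<bar>(k * q + R\<^sup>2 - m\<^sup>2) * u (Suc i)\<bar>"
    proof -
      have "q * \<bar>m\<bar> \<ge> 0" "\<bar>m\<bar> * (k - 1) \<ge> 0"
        using kq by auto
      then have "k * q + R\<^sup>2 - m\<^sup>2 \<ge> 0"
        using lower by linarith
      then show ?thesis
        by (simp add: abs_mult)
    qed
    moreover have "q * m * u (Suc (Suc i)) = (k * q + R\<^sup>2 - m\<^sup>2) * u (Suc i) + m * (k - 1) * u i"
      using rec[of i] by (simp add: k_def q_def)
    ultimately have ge: "\<bar>q * m * u (Suc (Suc i))\<bar> \<ge> (k * q + R\<^sup>2 - m\<^sup>2) * \<bar>u (Suc i)\<bar> - \<bar>m\<bar> * (k - 1) * \<bar>u (Suc i)\<bar>"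
      by linarith
    have "(q * \<bar>m\<bar>) * \<bar>u (Suc i)\<bar> \<le> (k * q + R\<^sup>2 - m\<^sup>2 - \<bar>m\<bar> * (k - 1)) * \<bar>u (Suc i)\<bar>"
      using lower by (rule mult_right_mono) simp
    also have "\<dots> = (k * q + R\<^sup>2 - m\<^sup>2) * \<bar>u (Suc i)\<bar> - \<bar>m\<bar> * (k - 1) * \<bar>u (Suc i)\<bar>"
      by (simp add: algebra_simps)
    also note ge
    also have "\<bar>q * m * u (Suc (Suc i))\<bar> = (q * \<bar>m\<bar>) * \<bar>u (Suc (Suc i))\<bar>"
      using kq by (simp add: abs_mult)
    finally have "(q * \<bar>m\<bar>) * \<bar>u (Suc i)\<bar> \<le> (q * \<bar>m\<bar>) * \<bar>u (Suc (Suc i))\<bar>" .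
    then show ?case
      using m(1) kq by (subst (asm) mult_le_cancel_left_pos) auto
  qed
  have "\<bar>u 0\<bar> \<le> \<bar>u i\<bar>" for i
    by (induction i) (use mono order.trans in auto)
  moreover obtain C where C: "\<bar>x j\<bar> * (1 + \<bar>of_int j\<bar>) ^ 1 \<le> C" for j
    using rsys_decay[OF sys b] by blast
  have "\<bar>u i\<bar> * (1 + real i) \<le> C" for i
  proof -
    have "\<bar>u i\<bar> * (1 + real i) \<le> \<bar>u i\<bar> * (1 + \<bar>of_int (int l + int i)\<bar>)"
      by (intro mult_left_mono) auto
    then show ?thesis
      using C[of "int l + int i"] by (simp add: u_def)
  qed
  ultimately have le: "\<bar>u 0\<bar> * (1 + real i) \<le> C" for i
    by (meson mult_right_mono order.trans add_nonneg_nonneg of_nat_0_le_iff zero_le_one)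
  have "u 0 \<noteq> 0"
    using u0 v R m(1) by auto
  then obtain n where "real n * \<bar>u 0\<bar> > C"
    using ex_less_of_nat_mult[of "\<bar>u 0\<bar>" C] by auto
  then show False
    using le[of n] \<open>u 0 \<noteq> 0\<close> by (simp add: algebra_simps) 
qed

section \<open>Ordinary differential equations\<close>

lemma gronwall_zero:
  fixes d d' :: "real \<Rightarrow> real"
  assumes der: "\<And>t. (d has_real_derivative d' t) (at t)" and bound: "\<And>t. \<bar>d' t\<bar> \<le> K * d t"
    and nonneg: "\<And>t. d t \<ge> 0" and zero: "d t0 = 0"
  shows "d t = 0"
proof (cases "t0 \<le> t")
  case True
  have "d t * exp (- K * t) \<le> d t0 * exp (- K * t0)"
  proof (rule DERIV_nonpos_imp_nonincreasing[OF True])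
    fix s
    have "((\<lambda>s. d s * exp (- K * s)) has_real_derivative (d' s - K * d s) * exp (- K * s)) (at s)"
      by (auto intro!: derivative_eq_intros der simp: algebra_simps)
    moreover have "(d' s - K * d s) * exp (- K * s) \<le> 0"
      using bound[of s] by (intro mult_nonpos_nonneg) auto
    ultimately show "\<exists>y. ((\<lambda>s. d s * exp (- K * s)) has_real_derivative y) (at s) \<and> y \<le> 0"
      by blast
  qed
  then have "d t \<le> 0"
    by (simp add: zero mult_le_0_iff)
  then show ?thesis
    using nonneg[of t] by simp
next
  case False
  then have "t \<le> t0"
    by simp
  have "d t * exp (K * t) \<le> d t0 * exp (K * t0)"
  proof (rule DERIV_nonneg_imp_nondecreasing[OF \<open>t \<le> t0\<close>])
    fix s
    have "((\<lambda>s. d s * exp (K * s)) has_real_derivative (d' s + K * d s) * exp (K * s)) (at s)"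
      by (auto intro!: derivative_eq_intros der simp: algebra_simps)
    moreover have "(d' s + K * d s) * exp (K * s) \<ge> 0"
      using bound[of s] by (intro mult_nonneg_nonneg) auto
    ultimately show "\<exists>y. ((\<lambda>s. d s * exp (K * s)) has_real_derivative y) (at s) \<and> y \<ge> 0"
      by blast
  qed
  then have "d t \<le> 0"
    by (simp add: zero mult_le_0_iff)
  then show ?thesis
    using nonneg[of t] by simp
qed

lemma antiderivative_UNIV:
  fixes h :: "real \<Rightarrow> real"
  assumes "continuous_on UNIV h"
  shows "\<exists>H. H 0 = 0 \<and> (\<forall>t. (H has_real_derivative h t) (at t))"
proof -
  have "isCont h t" for t
    using assms by (simp add: continuous_on_eq_continuous_at)
  then obtain H where H: "(H has_vector_derivative h t) (at t)" for t
    using einterval_antiderivative[of "-\<infinity>" "\<infinity>" h] by auto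
  then have "((\<lambda>t. H t - H 0) has_real_derivative h t) (at t)" for t
    by (auto intro!: derivative_eq_intros simp: has_real_derivative_iff_has_vector_derivative)
  then show ?thesis
    by (intro exI[of _ "\<lambda>t. H t - H 0"]) simp
qed

lemma antiderivative_exp_bound_aux:
  fixes H h :: "real \<Rightarrow> real"
  assumes "H 0 = 0" "\<And>t. (H has_real_derivative h t) (at t)" "\<And>t. \<bar>h t\<bar> \<le> c * exp (k * \<bar>t\<bar>)"
    and "k > 0" "c \<ge> 0" "t \<ge> 0"
  shows "H t \<le> c / k * exp (k * \<bar>t\<bar>)"
proof -
  have "H t - c / k * exp (k * t) \<le> H 0 - c / k * exp (k * 0)"
  proof (rule DERIV_nonpos_imp_nonincreasing[OF \<open>t \<ge> 0\<close>])
    fix s :: real assume s: "0 \<le> s" "s \<le> t"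
    have "((\<lambda>s. H s - c / k * exp (k * s)) has_real_derivative h s - c * exp (k * s)) (at s)"
      using \<open>k > 0\<close> by (auto intro!: derivative_eq_intros assms(2) simp: algebra_simps)
    moreover have "h s - c * exp (k * s) \<le> 0"
      using assms(3)[of s] s by simp
    ultimately show "\<exists>y. ((\<lambda>s. H s - c / k * exp (k * s)) has_real_derivative y) (at s) \<and> y \<le> 0"
      by blast
  qed
  moreover have "c / k \<ge> 0"
    using assms by simp
  ultimately show ?thesis
    using assms(1,6) by simp
qed

lemma antiderivative_exp_bound:
  fixes H h :: "real \<Rightarrow> real"
  assumes H: "H 0 = 0" "\<And>t. (H has_real_derivative h t) (at t)" and h: "\<And>t. \<bar>h t\<bar> \<le> c * exp (k * \<bar>t\<bar>)"
    and k: "k > 0" and c: "c \<ge> 0"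
  shows "\<bar>H t\<bar> \<le> c / k * exp (k * \<bar>t\<bar>)"
proof -
  have refl: "((\<lambda>t. H (- t)) has_real_derivative - h (- t)) (at t)" for t
    using DERIV_chain2[OF H(2) DERIV_minus[OF DERIV_ident], of t UNIV] by simp
  have neg: "((\<lambda>t. - H t) has_real_derivative - h t) (at t)"
    "((\<lambda>t. - H (- t)) has_real_derivative h (- t)) (at t)"
    "((\<lambda>t. H (- t)) has_real_derivative - h (- t)) (at t)" for t
    using DERIV_minus[OF H(2)] DERIV_minus[OF refl] refl by simp_all
  show ?thesis
  proof (cases "t \<ge> 0")
    case True
    then show ?thesis
      using antiderivative_exp_bound_aux[of H h c k t] antiderivative_exp_bound_aux[of "\<lambda>t. - H t" "\<lambda>t. - h t" c k t]
        H h k c neg(1) by (simp add: abs_le_iff)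
  next
    case False
    have "\<bar>h (- t)\<bar> \<le> c * exp (k * \<bar>t\<bar>)" for t
      using h[of "- t"] by simp
    then show ?thesis
      using antiderivative_exp_bound_aux[of "\<lambda>t. - H (- t)" "\<lambda>t. h (- t)" c k "- t"]
        antiderivative_exp_bound_aux[of "\<lambda>t. H (- t)" "\<lambda>t. - h (- t)" c k "- t"]
        H(1) k c neg(2,3) False by (simp add: abs_le_iff)
  qed
qed

text \<open>Picard iteration is a contraction in the weighted norm \<open>sup |f t| exp (- 2 K |t|)\<close>, which gives
  a solution on the whole line at once.\<close>

lemma ode_global_solution:
  fixes G :: "real \<Rightarrow> real \<Rightarrow> real"
  assumes cont: "\<And>f. continuous_on UNIV f \<Longrightarrow> continuous_on UNIV (\<lambda>t. G t (f t))"
    and bound: "\<And>t y. \<bar>G t y\<bar> \<le> M"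
    and lip: "\<And>t y z. \<bar>G t y - G t z\<bar> \<le> K * \<bar>y - z\<bar>" and K: "K > 0"
  shows "\<exists>f. f 0 = x0 \<and> (\<forall>t. (f has_real_derivative G t (f t)) (at t))"
proof -
  \<comment> \<open>The iteration acts on the bounded functions f / w. The exponent 2 K makes it
    contract by K / (2 K) = 1/2.\<close>
  define w where "w t = exp (2 * K * \<bar>t\<bar>)" for t :: real
  have w: "w t > 0" "w t \<ge> 1" "continuous_on UNIV w" for t
    using K by (auto simp: w_def intro!: continuous_intros)
  have M: "M \<ge> 0"
    using bound[of 0 0] by linarith
  have cont_w: "continuous_on UNIV (\<lambda>s. G s (w s * apply_bcontfun g s))" for g
    by (intro cont continuous_intros w) auto
  have "\<forall>g. \<exists>H. H 0 = 0 \<and> (\<forall>t. (H has_real_derivative G t (w t * apply_bcontfun g t)) (at t))"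
    using antiderivative_UNIV[OF cont_w] by blast
  then obtain I where I: "I g 0 = 0" "\<And>t. (I g has_real_derivative G t (w t * apply_bcontfun g t)) (at t)" for g
    by metis
  have I_bound: "\<bar>I g t\<bar> \<le> M / (2 * K) * w t" for g t
    unfolding w_def
  proof (rule antiderivative_exp_bound[OF I])
    show "\<bar>G s (w s * apply_bcontfun g s)\<bar> \<le> M * exp (2 * K * \<bar>s\<bar>)" for s
      using bound[of s "w s * apply_bcontfun g s"] mult_left_mono[OF w(2)[of s] M] by (simp add: w_def)
  qed (use K M in auto)
  define P where "P g = Bcontfun (\<lambda>t. (x0 + I g t) / w t)" for g
  have P: "apply_bcontfun (P g) t = (x0 + I g t) / w t" for g t
  proof -
    have "(\<lambda>t. (x0 + I g t) / w t) \<in> bcontfun"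
    proof (rule bcontfun_normI)
      have "continuous_on UNIV (I g)"
        by (meson I(2) DERIV_isCont continuous_at_imp_continuous_on)
      then show "continuous_on UNIV (\<lambda>t. (x0 + I g t) / w t)"
        using w(3) less_imp_neq[OF w(1)] by (intro continuous_intros) (auto simp: eq_commute[of 0])
      fix t
      have "\<bar>x0 + I g t\<bar> \<le> \<bar>x0\<bar> * w t + M / (2 * K) * w t"
        using I_bound[of g t] mult_left_mono[OF w(2)[of t], of "\<bar>x0\<bar>"] by linarith
      then show "norm ((x0 + I g t) / w t) \<le> \<bar>x0\<bar> + M / (2 * K)"
        using w(1)[of t] by (simp add: pos_divide_le_eq distrib_right)
    qed
    then show ?thesis
      by (simp add: P_def Bcontfun_inverse)
  qed
  have "dist (P g1) (P g2) \<le> 1 / 2 * dist g1 g2" for g1 g2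
  proof (rule dist_bound)
    fix t
    have der: "((\<lambda>t. I g1 t - I g2 t) has_real_derivative
        G t (w t * apply_bcontfun g1 t) - G t (w t * apply_bcontfun g2 t)) (at t)" for t
      by (intro derivative_intros I)
    have "\<bar>I g1 t - I g2 t\<bar> \<le> (K * dist g1 g2) / (2 * K) * exp (2 * K * \<bar>t\<bar>)"
    proof (rule antiderivative_exp_bound[OF _ der])
      fix s
      have "\<bar>G s (w s * apply_bcontfun g1 s) - G s (w s * apply_bcontfun g2 s)\<bar>
          \<le> K * \<bar>w s * apply_bcontfun g1 s - w s * apply_bcontfun g2 s\<bar>"
        by (rule lip)
      also have "\<dots> = K * (w s * dist (apply_bcontfun g1 s) (apply_bcontfun g2 s))"
        using w(1)[of s] by (simp add: dist_real_def abs_mult flip: right_diff_distrib)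
      also have "\<dots> \<le> K * (w s * dist g1 g2)"
        using K w(1)[of s] dist_bounded[of g1 s g2] by (intro mult_left_mono) auto
      finally show "\<bar>G s (w s * apply_bcontfun g1 s) - G s (w s * apply_bcontfun g2 s)\<bar>
          \<le> K * dist g1 g2 * exp (2 * K * \<bar>s\<bar>)"
        by (simp add: w_def mult_ac)
    qed (use K I(1) in auto)
    then have le: "\<bar>I g1 t - I g2 t\<bar> \<le> dist g1 g2 / 2 * w t"
      using K by (simp add: w_def)
    have "dist (apply_bcontfun (P g1) t) (apply_bcontfun (P g2) t) = \<bar>I g1 t - I g2 t\<bar> / w t"
      using w(1)[of t] by (simp add: P dist_real_def flip: diff_divide_distrib)
    also have "\<dots> \<le> dist g1 g2 / 2"
      using le w(1)[of t] by (simp add: pos_divide_le_eq)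
    finally show "dist (apply_bcontfun (P g1) t) (apply_bcontfun (P g2) t) \<le> 1 / 2 * dist g1 g2"
      by simp
  qed
  then obtain g where g: "P g = g"
    using banach_fix_type[of "1 / 2" P] by auto
  define f where "f t = x0 + I g t" for t
  have "w t * apply_bcontfun g t = f t" for t
    using P[of g t] w(1)[of t] by (simp add: g f_def)
  then have "(f has_real_derivative G t (f t)) (at t)" for t
    using I(2)[of g t] unfolding f_def by (auto intro!: derivative_eq_intros)
  moreover have "f 0 = x0"
    by (simp add: f_def I)
  ultimately show ?thesis
    by blast
qed

lemma abs_sin_diff_le: "\<bar>sin a - sin b\<bar> \<le> \<bar>a - b\<bar>" for a b :: real
proof -
  have "\<bar>sin a - sin b\<bar> = 2 * (\<bar>sin ((a - b) / 2)\<bar> * \<bar>cos ((a + b) / 2)\<bar>)"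
    by (simp add: sin_diff_sin abs_mult)
  also have "\<dots> \<le> 2 * (\<bar>(a - b) / 2\<bar> * 1)"
    by (intro mult_left_mono mult_mono abs_sin_x_le_abs_x) auto
  finally show ?thesis
    by simp
qed

section \<open>The vector field in the coordinates m, r\<close>

definition psol :: "real \<Rightarrow> nat \<Rightarrow> real \<Rightarrow> (real \<Rightarrow> real) \<Rightarrow> bool" where
  "psol r l m f \<longleftrightarrow> (\<forall>t. (f has_real_derivative (- 2 * r * sin (f t) + real l + 2 * m * cos t)) (at t))"

lemma psolD: "psol r l m f \<Longrightarrow> (f has_real_derivative (- 2 * r * sin (f t) + real l + 2 * m * cos t)) (at t)"
  by (simp add: psol_def)

lemma psol_exists:
  assumes "r > 0"
  shows "\<exists>f. f 0 = x \<and> psol r l m f"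
  unfolding psol_def
proof (rule ode_global_solution[where K = "2 * r" and M = "2 * r + real l + 2 * \<bar>m\<bar>"])
  show "continuous_on UNIV (\<lambda>t. - 2 * r * sin (f t) + real l + 2 * m * cos t)"
    if "continuous_on UNIV f" for f :: "real \<Rightarrow> real"
    by (intro continuous_intros that)
  show "\<bar>- 2 * r * sin y + real l + 2 * m * cos t\<bar> \<le> 2 * r + real l + 2 * \<bar>m\<bar>" for t y
  proof -
    have "\<bar>r * sin y\<bar> \<le> r * 1" "\<bar>m * cos t\<bar> \<le> \<bar>m\<bar> * 1"
      unfolding abs_mult using assms by (intro mult_mono; simp)+
    then show ?thesis
      using of_nat_0_le_iff[of l, where 'a = real] by (simp add: abs_le_iff)
  qed
  show "\<bar>- 2 * r * sin y + real l + 2 * m * cos t - (- 2 * r * sin z + real l + 2 * m * cos t)\<bar>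
      \<le> 2 * r * \<bar>y - z\<bar>" for t y z
  proof -
    have "\<bar>- 2 * r * sin y + real l + 2 * m * cos t - (- 2 * r * sin z + real l + 2 * m * cos t)\<bar>
        = \<bar>2 * r * (sin z - sin y)\<bar>"
      by (simp add: algebra_simps)
    also have "\<dots> \<le> 2 * r * \<bar>z - y\<bar>"
      unfolding abs_mult using assms abs_sin_diff_le[of z y] by simp
    finally show ?thesis
      by (simp add: abs_minus_commute)
  qed
qed (use assms in auto)

lemma psol_unique:
  assumes f: "psol r l m f" and g: "psol r l m g" and eq: "f t0 = g t0"
  shows "f = g"
proof
  fix t
  have "(f t - g t)\<^sup>2 = 0"
  proof (rule gronwall_zero[of "\<lambda>t. (f t - g t)\<^sup>2" _ _ t0])
    show "((\<lambda>t. (f t - g t)\<^sup>2) has_real_derivative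
        2 * (f t - g t) * (- 2 * r * (sin (f t) - sin (g t)))) (at t)" for t
      by (auto intro!: derivative_eq_intros psolD[OF f] psolD[OF g] simp: algebra_simps)
    show "\<bar>2 * (f t - g t) * (- 2 * r * (sin (f t) - sin (g t)))\<bar> \<le> (4 * \<bar>r\<bar>) * (f t - g t)\<^sup>2" for t
    proof -
      have "\<bar>2 * (f t - g t) * (- 2 * r * (sin (f t) - sin (g t)))\<bar>
          = 4 * \<bar>r\<bar> * \<bar>f t - g t\<bar> * \<bar>sin (f t) - sin (g t)\<bar>"
        unfolding abs_mult by simp
      also have "\<dots> \<le> 4 * \<bar>r\<bar> * \<bar>f t - g t\<bar> * \<bar>f t - g t\<bar>"
        by (intro mult_left_mono abs_sin_diff_le) auto
      finally show ?thesis
        by (simp add: power2_eq_square algebra_simps)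
    qed
  qed (use eq in auto)
  then show "f t = g t"
    by simp
qed

definition phi :: "real \<Rightarrow> nat \<Rightarrow> real \<Rightarrow> real \<Rightarrow> real \<Rightarrow> real" where
  "phi r l m x = jsol (1 / (2 * r)) (real l / (2 * r)) (m / r) x"

lemma phi_solution:
  assumes "r > 0"
  shows "psol r l m (phi r l m x)" "phi r l m x 0 = x"
proof -
  obtain f where f: "f 0 = x" "psol r l m f"
    using psol_exists[OF assms] by blast
  have eq: "(- sin y / (1 / (2 * r)) + real l / (2 * r) / (1 / (2 * r)) + 2 * (m / r / (2 * (1 / (2 * r)))) * cos t)
      = - 2 * r * sin y + real l + 2 * m * cos t" for y t
    using assms by (simp add: field_simps)
  have "phi r l m x = (THE f. f 0 = x \<and> psol r l m f)"
    unfolding phi_def jsol_def psol_def eq ..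
  also have "\<dots> = f"
  proof (rule the_equality)
    fix g assume "g 0 = x \<and> psol r l m g"
    then show "g = f"
      using f by (intro psol_unique[of r l m g f 0]) auto
  qed (use f in simp)
  finally have "phi r l m x = f" .
  then show "psol r l m (phi r l m x)" "phi r l m x 0 = x"
    using f by (simp_all only:)
qed

lemma poincare_phi: "poincare (1 / (2 * r)) (real l / (2 * r)) (m / r) x = phi r l m x (2 * pi)"
  by (simp add: poincare_def phi_def)

lemma psol_shift: "psol r l m f \<Longrightarrow> psol r l m (\<lambda>t. f (t + 2 * pi))"
  unfolding psol_def
proof
  fix t assume *: "\<forall>t. (f has_real_derivative - 2 * r * sin (f t) + real l + 2 * m * cos t) (at t)"
  have "((\<lambda>t. f (t + 2 * pi)) has_real_derivative
      - 2 * r * sin (f (t + 2 * pi)) + real l + 2 * m * cos (t + 2 * pi)) (at t)"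
    using *[rule_format, of "t + 2 * pi"] by (simp add: DERIV_shift)
  then show "((\<lambda>t. f (t + 2 * pi)) has_real_derivative
      - 2 * r * sin (f (t + 2 * pi)) + real l + 2 * m * cos t) (at t)"
    by simp
qed

lemma sin_plus_int_2pi: "sin (x + 2 * pi * of_int k) = sin x"
  by (simp add: sin_add cos_int_2pin sin_int_2pin)

lemma psol_add_2pi: "psol r l m f \<Longrightarrow> psol r l m (\<lambda>t. f t + 2 * pi * of_int k)"
  unfolding psol_def sin_plus_int_2pi by (auto intro!: derivative_eq_intros)

lemma psol_periods:
  assumes f: "psol r l m f" and k: "f (2 * pi) = f 0 + 2 * pi * of_int k"
  shows "f (2 * pi * real n) = f 0 + 2 * pi * of_int k * real n"
proof -
  have step: "f (t + 2 * pi) = f t + 2 * pi * of_int k" for t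
    using psol_unique[OF psol_shift[OF f] psol_add_2pi[OF f, of k], of 0] k by (simp add: fun_eq_iff)
  show ?thesis
  proof (induction n)
    case (Suc n)
    have "f (2 * pi * real (Suc n)) = f (2 * pi * real n + 2 * pi)"
      by (simp add: algebra_simps)
    then show ?case
      using step[of "2 * pi * real n"] Suc by (simp add: algebra_simps)
  qed simp
qed

lemma psol_continuous: "psol r l m f \<Longrightarrow> continuous_on S f"
  by (intro continuous_at_imp_continuous_on ballI DERIV_isCont[OF psolD])

lemma psol_less:
  assumes f: "psol r l m f" and g: "psol r l m g" and less: "f 0 < g 0" and t: "t \<ge> 0"
  shows "f t < g t"
proof (rule ccontr)
  assume "\<not> f t < g t"
  then have "\<exists>s\<ge>0. s \<le> t \<and> f s - g s = 0"
    using less t by (intro IVT' continuous_on_diff psol_continuous[OF f] psol_continuous[OF g]) auto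
  then obtain s where "f s - g s = 0"
    by blast
  then have "f = g"
    using psol_unique[OF f g, of s] by simp
  with less show False
    by simp
qed

text \<open>\<open>rotnum\<close> follows the orbit of 0. Orbits do not cross, so it stays between
  the orbit of x lowered and raised by 2 pi, and the latter advances by exactly 2 pi k in each
  period.\<close>

lemma rotnum_eq:
  assumes r: "r > 0" and x: "\<bar>x\<bar> \<le> pi" and k: "phi r l m x (2 * pi) = x + 2 * pi * of_int k"
  shows "rotnum (1 / (2 * r)) (real l / (2 * r)) (m / r) = of_int k"
proof -
  let ?f = "phi r l m x" and ?g = "phi r l m 0"
  note f = phi_solution[OF r, of l m x] and g = phi_solution[OF r, of l m 0]
  have per: "?f (2 * pi * real n) = x + 2 * pi * of_int k * real n" for n
    using psol_periods[OF f(1)] k f(2) by simp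
  have x2: "x + 2 * pi > 0" "x - 2 * pi < 0"
    using x pi_gt_zero by linarith+
  have "\<bar>?g t - ?f t\<bar> \<le> 2 * pi" if "t \<ge> 0" for t
    using psol_less[OF g(1) psol_add_2pi[OF f(1), of 1] _ that]
      psol_less[OF psol_add_2pi[OF f(1), of "- 1"] g(1) _ that] f(2) g(2) x2 by (simp add: abs_le_iff)
  then have bnd: "\<bar>?g (2 * pi * real n) - (x + 2 * pi * of_int k * real n)\<bar> \<le> 2 * pi" for n
    using per[of n] by (metis mult_nonneg_nonneg of_nat_0_le_iff pi_ge_zero zero_le_numeral)
  have "(\<lambda>n. ?g (2 * pi * real n) / (2 * pi * real n) - of_int k) \<longlonglongrightarrow> 0"
  proof (rule Lim_null_comparison)
    show "\<forall>\<^sub>F n in sequentially. norm (?g (2 * pi * real n) / (2 * pi * real n) - of_int k) \<le> 3 / 2 * (1 / real n)"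
    proof (rule eventually_sequentiallyI[of 1])
      fix n :: nat assume n: "1 \<le> n"
      have "?g (2 * pi * real n) / (2 * pi * real n) - of_int k
          = (?g (2 * pi * real n) - 2 * pi * of_int k * real n) / (2 * pi * real n)"
        using n by (simp add: field_simps)
      then have "norm (?g (2 * pi * real n) / (2 * pi * real n) - of_int k)
          = \<bar>?g (2 * pi * real n) - 2 * pi * of_int k * real n\<bar> / (2 * pi * real n)"
        by (simp add: abs_mult)
      also have "\<dots> \<le> 3 * pi / (2 * pi * real n)"
        using bnd[of n] x by (intro divide_right_mono) (linarith, simp)
      also have "\<dots> = 3 / 2 * (1 / real n)"
        using n by simp
      finally show "norm (?g (2 * pi * real n) / (2 * pi * real n) - of_int k) \<le> 3 / 2 * (1 / real n)" .
    qed
    show "(\<lambda>n. 3 / 2 * (1 / real n)) \<longlonglongrightarrow> 0"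
      using tendsto_mult_right_zero[OF lim_1_over_n[where 'a = real], of "3 / 2"] by simp
  qed
  then have "(\<lambda>n. ?g (2 * pi * real n) / (2 * pi * real n)) \<longlonglongrightarrow> of_int k"
    by (simp add: LIM_zero_iff)
  then show ?thesis
    unfolding rotnum_def phi_def by (rule limI)
qed

section \<open>The linear system\<close>

text \<open>A real-linear planar system written as one complex equation: the reversing symmetry
  becomes F(t) -> cnj (F (-t)), and multiplication by the imaginary unit exchanges R and -R, so both
  signs are treated by one system.\<close>

definition fsol :: "nat \<Rightarrow> real \<Rightarrow> real \<Rightarrow> (real \<Rightarrow> complex) \<Rightarrow> bool" where
  "fsol l m R F \<longleftrightarrow> (\<forall>t. (F has_vector_derivative
     \<i> * (complex_of_real (real l / 2 + m * cos t) * F t - complex_of_real R * cnj (F t))) (at t))"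

lemma fsol_iff:
  "fsol l m R F \<longleftrightarrow>
     (\<forall>t. ((\<lambda>t. Re (F t)) has_real_derivative - (real l / 2 + m * cos t + R) * Im (F t)) (at t) \<and>
          ((\<lambda>t. Im (F t)) has_real_derivative (real l / 2 + m * cos t - R) * Re (F t)) (at t))"
proof -
  have "Re (\<i> * (complex_of_real c * z - complex_of_real R * cnj z)) = - (c + R) * Im z"
    "Im (\<i> * (complex_of_real c * z - complex_of_real R * cnj z)) = (c - R) * Re z" for c z
    by (simp_all add: algebra_simps)
  then show ?thesis
    by (simp only: fsol_def has_vector_derivative_complex_iff)
qed

lemma fsolD:
  assumes "fsol l m R F"
  shows "((\<lambda>t. Re (F t)) has_real_derivative - (real l / 2 + m * cos t + R) * Im (F t)) (at t)"
    "((\<lambda>t. Im (F t)) has_real_derivative (real l / 2 + m * cos t - R) * Re (F t)) (at t)"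
  using assms by (simp_all add: fsol_iff)

lemma fsol_vector_derivative:
  "fsol l m R F \<Longrightarrow> (F has_vector_derivative
     \<i> * (complex_of_real (real l / 2 + m * cos t) * F t - complex_of_real R * cnj (F t))) (at t)"
  by (simp add: fsol_def)

lemma fsol_unique:
  assumes F: "fsol l m R F" and G: "fsol l m R G" and eq: "F t0 = G t0"
  shows "F = G"
proof
  fix t
  define p where "p t = Re (F t) - Re (G t)" for t
  define q where "q t = Im (F t) - Im (G t)" for t
  have p: "(p has_real_derivative - (real l / 2 + m * cos t + R) * q t) (at t)" for t
    unfolding p_def q_def using DERIV_diff[OF fsolD(1)[OF F] fsolD(1)[OF G]] by (simp add: algebra_simps)
  have q: "(q has_real_derivative (real l / 2 + m * cos t - R) * p t) (at t)" for t
    unfolding p_def q_def using DERIV_diff[OF fsolD(2)[OF F] fsolD(2)[OF G]] by (simp add: algebra_simps)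
  have "(p t)\<^sup>2 + (q t)\<^sup>2 = 0"
  proof (rule gronwall_zero[of "\<lambda>t. (p t)\<^sup>2 + (q t)\<^sup>2" _ _ t0])
    \<comment> \<open>The coefficient l/2 + m cos t only rotates the plane and cancels; R alone
      changes the norm.\<close>
    show "((\<lambda>t. (p t)\<^sup>2 + (q t)\<^sup>2) has_real_derivative - 4 * R * (p t * q t)) (at t)" for t
      by (auto intro!: derivative_eq_intros p q simp: algebra_simps)
    show "\<bar>- 4 * R * (p t * q t)\<bar> \<le> (2 * \<bar>R\<bar>) * ((p t)\<^sup>2 + (q t)\<^sup>2)" for t
    proof -
      have "2 * (\<bar>p t\<bar> * \<bar>q t\<bar>) \<le> \<bar>p t\<bar>\<^sup>2 + \<bar>q t\<bar>\<^sup>2"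
        using sum_squares_bound[of "\<bar>p t\<bar>" "\<bar>q t\<bar>"] by simp
      then have "2 * \<bar>R\<bar> * (2 * (\<bar>p t\<bar> * \<bar>q t\<bar>)) \<le> 2 * \<bar>R\<bar> * ((p t)\<^sup>2 + (q t)\<^sup>2)"
        by (intro mult_left_mono) auto
      then show ?thesis
        by (simp add: abs_mult)
    qed
    show "(p t0)\<^sup>2 + (q t0)\<^sup>2 = 0"
      using eq by (simp add: p_def q_def)
  qed simp
  then show "F t = G t"
    by (simp add: p_def q_def complex_eq_iff sum_power2_eq_zero_iff)
qed

lemma fsol_combination:
  assumes "fsol l m R F" "fsol l m R G"
  shows "fsol l m R (\<lambda>t. complex_of_real a * F t + complex_of_real b * G t)"
  unfolding fsol_def
  by (auto intro!: derivative_eq_intros fsol_vector_derivative[OF assms(1)] fsol_vector_derivative[OF assms(2)]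
    simp: algebra_simps)

lemma fsol_scale: "fsol l m R F \<Longrightarrow> fsol l m R (\<lambda>t. complex_of_real a * F t)"
  using fsol_combination[of l m R F F a 0] by simp

lemma fsol_rotate:
  assumes "fsol l m R F"
  shows "fsol l m (- R) (\<lambda>t. \<i> * F t)"
  unfolding fsol_def
  by (auto intro!: derivative_eq_intros fsol_vector_derivative[OF assms] simp: algebra_simps)

lemma fsol_shift:
  assumes "fsol l m R F"
  shows "fsol l m R (\<lambda>t. F (t + 2 * pi))"
  unfolding fsol_iff
proof (intro allI conjI)
  fix t
  show "((\<lambda>t. Re (F (t + 2 * pi))) has_real_derivative - (real l / 2 + m * cos t + R) * Im (F (t + 2 * pi))) (at t)"
    using fsolD(1)[OF assms, of "t + 2 * pi"] DERIV_shift[of "\<lambda>t. Re (F t)" _ t "2 * pi"] by simp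
  show "((\<lambda>t. Im (F (t + 2 * pi))) has_real_derivative (real l / 2 + m * cos t - R) * Re (F (t + 2 * pi))) (at t)"
    using fsolD(2)[OF assms, of "t + 2 * pi"] DERIV_shift[of "\<lambda>t. Im (F t)" _ t "2 * pi"] by simp
qed

lemma fsol_reflect:
  assumes "fsol l m R F"
  shows "fsol l m R (\<lambda>t. cnj (F (- t)))"
  unfolding fsol_iff
proof (intro allI conjI)
  fix t
  have "((\<lambda>t. Re (F (- t))) has_real_derivative - (- (real l / 2 + m * cos (- t) + R) * Im (F (- t)))) (at t)"
    using DERIV_chain2[OF fsolD(1)[OF assms] DERIV_minus[OF DERIV_ident], of t UNIV] by simp
  then show "((\<lambda>t. Re (cnj (F (- t)))) has_real_derivative
      - (real l / 2 + m * cos t + R) * Im (cnj (F (- t)))) (at t)"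
    by (simp add: algebra_simps)
  have "((\<lambda>t. Im (F (- t))) has_real_derivative - ((real l / 2 + m * cos (- t) - R) * Re (F (- t)))) (at t)"
    using DERIV_chain2[OF fsolD(2)[OF assms] DERIV_minus[OF DERIV_ident], of t UNIV] by simp
  then show "((\<lambda>t. Im (cnj (F (- t)))) has_real_derivative
      (real l / 2 + m * cos t - R) * Re (cnj (F (- t)))) (at t)"
    using DERIV_minus by fastforce
qed

text \<open>The Riccati substitution: \<open>\<phi>\<close> is twice the argument of a solution of the linear system.\<close>

lemma psol_to_fsol:
  assumes f: "psol r l m f" and e: "e = 1 \<or> e = - 1"
  shows "\<exists>\<rho>. \<rho> 0 = 0 \<and> fsol l m (e * r) (\<lambda>t. complex_of_real (exp (\<rho> t)) * cis ((f t - e * pi / 2) / 2))"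
proof -
  have "continuous_on UNIV (\<lambda>t. r * cos (f t))"
    by (intro continuous_intros psol_continuous[OF f])
  then obtain \<rho> where \<rho>: "\<rho> 0 = 0" "\<And>t. (\<rho> has_real_derivative r * cos (f t)) (at t)"
    using antiderivative_UNIV by blast
  \<comment> \<open>The shift by e pi/2 turns the starting angle e pi/2 into the positive real
    direction, so that orbit has F 0 = 1.\<close>
  define \<theta> where "\<theta> t = (f t - e * pi / 2) / 2" for t
  have \<theta>: "(\<theta> has_real_derivative - r * sin (f t) + (real l / 2 + m * cos t)) (at t)" for t
    unfolding \<theta>_def by (auto intro!: derivative_eq_intros psolD[OF f] simp: field_simps)
  have f\<theta>: "f t = 2 * \<theta> t + e * pi / 2" for t
    by (simp add: \<theta>_def field_simps)
  have c: "cos (f t) * cos (\<theta> t) + sin (f t) * sin (\<theta> t) = - e * sin (\<theta> t)" for t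
  proof -
    have "cos (f t) * cos (\<theta> t) + sin (f t) * sin (\<theta> t) = cos (f t - \<theta> t)"
      by (simp add: cos_diff)
    also have "f t - \<theta> t = \<theta> t + e * (pi / 2)"
      by (simp add: f\<theta>)
    finally show ?thesis
      using e by (auto simp: cos_add)
  qed
  have s: "cos (f t) * sin (\<theta> t) - sin (f t) * cos (\<theta> t) = - e * cos (\<theta> t)" for t
  proof -
    have "cos (f t) * sin (\<theta> t) - sin (f t) * cos (\<theta> t) = - sin (f t - \<theta> t)"
      by (simp add: sin_diff)
    also have "f t - \<theta> t = \<theta> t + e * (pi / 2)"
      by (simp add: f\<theta>)
    finally show ?thesis
      using e by (auto simp: sin_add)
  qed
  have "((\<lambda>t. exp (\<rho> t) * cos (\<theta> t)) has_real_derivative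
      - (real l / 2 + m * cos t + e * r) * (exp (\<rho> t) * sin (\<theta> t))) (at t)" for t
  proof -
    have "((\<lambda>t. exp (\<rho> t) * cos (\<theta> t)) has_real_derivative
        exp (\<rho> t) * (r * (cos (f t) * cos (\<theta> t) + sin (f t) * sin (\<theta> t)) - (real l / 2 + m * cos t) * sin (\<theta> t))) (at t)"
      by (auto intro!: derivative_eq_intros \<rho>(2) \<theta> simp: algebra_simps)
    then show ?thesis
      unfolding c by (simp add: algebra_simps)
  qed
  moreover have "((\<lambda>t. exp (\<rho> t) * sin (\<theta> t)) has_real_derivative
      (real l / 2 + m * cos t - e * r) * (exp (\<rho> t) * cos (\<theta> t))) (at t)" for t
  proof -
    have "((\<lambda>t. exp (\<rho> t) * sin (\<theta> t)) has_real_derivative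
        exp (\<rho> t) * (r * (cos (f t) * sin (\<theta> t) - sin (f t) * cos (\<theta> t)) + (real l / 2 + m * cos t) * cos (\<theta> t))) (at t)"
      by (auto intro!: derivative_eq_intros \<rho>(2) \<theta> simp: algebra_simps)
    then show ?thesis
      unfolding s by (simp add: algebra_simps)
  qed
  ultimately have "fsol l m (e * r) (\<lambda>t. complex_of_real (exp (\<rho> t)) * cis (\<theta> t))"
    by (simp add: fsol_iff)
  with \<rho>(1) show ?thesis
    unfolding \<theta>_def by blast
qed

lemma cis_half_turns: "cis (pi * of_int k) = (if even k then 1 else - 1)"
proof -
  have "cis (pi * of_int (2 * n)) = 1" for n
    using cis_multiple_2pi[of "of_int n"] by (simp add: mult.left_commute mult.assoc)
  moreover have "cis (pi * of_int (2 * n + 1)) = - 1" for n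
    using \<open>cis (pi * of_int (2 * n)) = 1\<close> by (simp add: distrib_left flip: cis_mult)
  ultimately show ?thesis
    by (auto elim!: evenE oddE)
qed

lemma minus_one_power_cis: "(- 1) ^ l = cis (pi * real l)"
  using cis_half_turns[of "int l"] by simp

lemma polar_angle:
  assumes "complex_of_real (exp \<rho>) * cis \<theta> = (- 1) ^ l * cis \<theta>'"
  shows "\<exists>n::int. \<theta> = \<theta>' + pi * real l + 2 * pi * n"
proof -
  have "norm (complex_of_real (exp \<rho>) * cis \<theta>) = norm ((- 1) ^ l * cis \<theta>')"
    by (simp only: assms)
  then have "exp \<rho> = 1"
    by (simp add: norm_mult norm_power)
  then have "cis \<theta> = cis (\<theta>' + pi * real l)"
    using assms by (simp add: minus_one_power_cis cis_mult add.commute)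
  then have "sin \<theta> = sin (\<theta>' + pi * real l) \<and> cos \<theta> = cos (\<theta>' + pi * real l)"
    by (simp add: complex_eq_iff)
  then show ?thesis
    by (simp only: sin_cos_eq_iff)
qed

text \<open>\<open>antiper\<close>: the solution through a fixed direction of the reversing symmetry has multiplier
  \<open>(-1)\<^sup>l\<close>.\<close>

definition antiper :: "nat \<Rightarrow> real \<Rightarrow> real \<Rightarrow> (real \<Rightarrow> complex) \<Rightarrow> bool" where
  "antiper l m R F \<longleftrightarrow> fsol l m R F \<and> F 0 = 1 \<and> F (2 * pi) = (- 1) ^ l"

text \<open>The argument of F is half the angle: a multiplier \<open>(- 1) ^ l\<close> advances it
  by pi l modulo 2 pi, hence the angle by 2 pi times an integer of the parity of l.\<close>

lemma antiper_imp_fixed: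
  assumes r: "r > 0" and e: "e = 1 \<or> e = - 1" and F: "antiper l m (e * r) F"
  shows "\<exists>k::int. even (k - int l) \<and> phi r l m (e * pi / 2) (2 * pi) = e * pi / 2 + 2 * pi * k"
proof -
  let ?f = "phi r l m (e * pi / 2)"
  note f = phi_solution[OF r, of l m "e * pi / 2"]
  obtain \<rho> where \<rho>: "\<rho> 0 = 0"
    "fsol l m (e * r) (\<lambda>t. complex_of_real (exp (\<rho> t)) * cis ((?f t - e * pi / 2) / 2))"
    using psol_to_fsol[OF f(1) e] by blast
  have "F = (\<lambda>t. complex_of_real (exp (\<rho> t)) * cis ((?f t - e * pi / 2) / 2))"
    using F by (intro fsol_unique[OF _ \<rho>(2), of _ 0]) (auto simp: antiper_def \<rho>(1) f(2))
  then have "complex_of_real (exp (\<rho> (2 * pi))) * cis ((?f (2 * pi) - e * pi / 2) / 2) = (- 1) ^ l * cis 0"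
    using F by (auto simp: antiper_def fun_eq_iff)
  from polar_angle[OF this] obtain n :: int
    where "(?f (2 * pi) - e * pi / 2) / 2 = pi * real l + 2 * pi * n"
    by auto
  then have "?f (2 * pi) = e * pi / 2 + 2 * pi * (int l + 2 * n)"
    by (simp add: field_simps)
  then show ?thesis
    by (intro exI[of _ "int l + 2 * n"]) auto
qed

text \<open>A fixed direction gives a real multiplier c, so F(-2 pi) = 1/c. The reflection symmetry
  gives F(-2 pi) = c. Hence c^2 = 1, and the parity of k decides the sign.\<close>

lemma fixed_imp_antiper:
  assumes r: "r > 0" and e: "e = 1 \<or> e = - 1" and k: "even (k - int l)"
    "phi r l m (e * pi / 2) (2 * pi) = e * pi / 2 + 2 * pi * of_int k"
  shows "\<exists>F. antiper l m (e * r) F"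
proof -
  let ?f = "phi r l m (e * pi / 2)"
  note f = phi_solution[OF r, of l m "e * pi / 2"]
  obtain \<rho> where \<rho>: "\<rho> 0 = 0"
    "fsol l m (e * r) (\<lambda>t. complex_of_real (exp (\<rho> t)) * cis ((?f t - e * pi / 2) / 2))"
    using psol_to_fsol[OF f(1) e] by blast
  define F where "F t = complex_of_real (exp (\<rho> t)) * cis ((?f t - e * pi / 2) / 2)" for t
  have F: "fsol l m (e * r) F" "F 0 = 1"
    using \<rho> by (simp_all add: F_def[abs_def] f(2))
  have "(?f (2 * pi) - e * pi / 2) / 2 = pi * of_int k"
    using k(2) by simp
  moreover have "cis (pi * of_int k) = (- 1) ^ l"
    using k(1) by (auto simp: cis_half_turns)
  ultimately have F2: "F (2 * pi) = complex_of_real (exp (\<rho> (2 * pi))) * (- 1) ^ l"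
    by (simp add: F_def)
  define c where "c = exp (\<rho> (2 * pi)) * (- 1) ^ l"
  have c: "F (2 * pi) = complex_of_real c"
    by (simp add: F2 c_def)
  have "(\<lambda>t. F (t + 2 * pi)) = (\<lambda>t. complex_of_real c * F t)"
    by (rule fsol_unique[OF fsol_shift[OF F(1)] fsol_scale[OF F(1)], of 0]) (simp add: c F(2))
  then have "F (t + 2 * pi) = complex_of_real c * F t" for t
    by (simp add: fun_eq_iff)
  from this[of "- 2 * pi"] have "complex_of_real c * F (- (2 * pi)) = 1"
    using F(2) by simp
  moreover have "(\<lambda>t. cnj (F (- t))) = F"
    by (rule fsol_unique[OF fsol_reflect[OF F(1)] F(1), of 0]) (simp add: F(2))
  then have "cnj (F (- (2 * pi))) = F (2 * pi)"
    by (simp add: fun_eq_iff)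
  then have "F (- (2 * pi)) = complex_of_real c"
    unfolding c by (metis complex_cnj_cnj complex_cnj_complex_of_real)
  ultimately have "complex_of_real (c * c) = 1"
    by simp
  then have "c\<^sup>2 = 1"
    by (simp only: of_real_eq_1_iff power2_eq_square)
  then have "(exp (\<rho> (2 * pi)))\<^sup>2 = 1"
    by (simp add: c_def power_mult_distrib flip: power_mult)
  then have "exp (\<rho> (2 * pi)) = 1"
    by (simp add: power2_eq_1_iff) (metis exp_gt_zero less_minus_one_simps(1) not_less_iff_gr_or_eq)
  then have "F (2 * pi) = (- 1) ^ l"
    using F2 by simp
  with F show ?thesis
    unfolding antiper_def by blast
qed

text \<open>F and the rotated G form a real basis of solutions with the same multiplier
  \<open>(- 1) ^ l\<close>, so the monodromy is a scalar and fixes every direction.\<close>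

lemma antiper_both_imp_circle_id:
  assumes r: "r > 0" and F: "antiper l m r F" and G: "antiper l m (- r) G"
  shows "circle_id (\<lambda>x. phi r l m x (2 * pi))"
proof -
  have G': "fsol l m r (\<lambda>t. \<i> * G t)"
    using fsol_rotate[of l m "- r" G] G by (simp add: antiper_def)
  have "\<exists>k::int. phi r l m x (2 * pi) = x + 2 * pi * k" for x
  proof -
    let ?f = "phi r l m x"
    note f = phi_solution[OF r, of l m x]
    obtain \<rho> where \<rho>: "\<rho> 0 = 0"
      "fsol l m (1 * r) (\<lambda>t. complex_of_real (exp (\<rho> t)) * cis ((?f t - 1 * pi / 2) / 2))"
      using psol_to_fsol[OF f(1), of 1] by blast
    define z where "z = cis ((x - pi / 2) / 2)"
    have eq: "(\<lambda>t. complex_of_real (exp (\<rho> t)) * cis ((?f t - 1 * pi / 2) / 2))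
        = (\<lambda>t. complex_of_real (Re z) * F t + complex_of_real (Im z) * (\<i> * G t))"
    proof (rule fsol_unique[OF \<rho>(2), of _ 0])
      show "fsol l m (1 * r) (\<lambda>t. complex_of_real (Re z) * F t + complex_of_real (Im z) * (\<i> * G t))"
        using fsol_combination[OF _ G'] F by (simp add: antiper_def)
      show "complex_of_real (exp (\<rho> 0)) * cis ((?f 0 - 1 * pi / 2) / 2)
          = complex_of_real (Re z) * F 0 + complex_of_real (Im z) * (\<i> * G 0)"
        using F G by (simp add: antiper_def \<rho>(1) f(2) z_def complex_eq_iff)
    qed
    have "complex_of_real (exp (\<rho> (2 * pi))) * cis ((?f (2 * pi) - 1 * pi / 2) / 2)
        = complex_of_real (Re z) * F (2 * pi) + complex_of_real (Im z) * (\<i> * G (2 * pi))"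
      using fun_cong[OF eq, of "2 * pi"] .
    also have "\<dots> = (- 1) ^ l * z"
    proof -
      have "complex_of_real (Re z) * F (2 * pi) + complex_of_real (Im z) * (\<i> * G (2 * pi))
          = (- 1) ^ l * (complex_of_real (Re z) + \<i> * complex_of_real (Im z))"
        using F G by (simp add: antiper_def algebra_simps)
      then show ?thesis
        using complex_eq[of z] by simp
    qed
    finally obtain n :: int where "(?f (2 * pi) - 1 * pi / 2) / 2 = (x - pi / 2) / 2 + pi * real l + 2 * pi * n"
      unfolding z_def using polar_angle by blast
    then have "?f (2 * pi) = x + 2 * pi * (int l + 2 * n)"
      by (simp add: field_simps)
    then show ?thesis
      by blast
  qed
  then show ?thesis
    by (simp add: circle_id_def fixes_mod_def)
qed

section \<open>Fourier coefficients\<close>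

text \<open>Unnormalised Fourier coefficients. The interval is symmetric for the sake of
  \<open>fc_reflect\<close>, and it has 0, where a derivative is taken in
  \<open>fc_all_zero\<close>, in its interior.\<close>

definition fc :: "(real \<Rightarrow> complex) \<Rightarrow> int \<Rightarrow> complex" where
  "fc f j = integral {- pi..pi} (\<lambda>t. f t * cis (- of_int j * t))"

lemma cis_vector_derivative: "((\<lambda>t. cis (a * t)) has_vector_derivative \<i> * complex_of_real a * cis (a * t)) (at t within S)"
  unfolding has_vector_derivative_complex_iff by (auto intro!: derivative_eq_intros)

lemma cis_int_pi: "cis (of_int k * pi) = cis (- of_int k * pi)"
  using cis_half_turns[of k] cis_half_turns[of "- k"] by (simp add: mult.commute)

lemma fc_cis: "integral {- pi..pi} (\<lambda>t. cis (of_int k * t)) = (if k = 0 then 2 * pi else 0)"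
proof (cases "k = 0")
  case False
  have "((\<lambda>t. cis (of_int k * t)) has_integral
      cis (of_int k * pi) / (\<i> * of_int k) - cis (of_int k * - pi) / (\<i> * of_int k)) {- pi..pi}"
  proof (rule fundamental_theorem_of_calculus)
    fix t
    show "((\<lambda>t. cis (of_int k * t) / (\<i> * of_int k)) has_vector_derivative cis (of_int k * t)) (at t within {- pi..pi})"
      using has_vector_derivative_divide[OF cis_vector_derivative[of "of_int k" t "{- pi..pi}"], of "\<i> * of_int k"] False
      by simp
  qed simp
  then show ?thesis
    using False cis_int_pi[of k] by (simp add: integral_unique)
qed (simp add: scaleR_conv_of_real)

lemma vector_derivative_quotient:
  fixes f :: "real \<Rightarrow> complex"
  assumes "(f has_vector_derivative D) (at 0)"
  shows "((\<lambda>t. (f t - f 0) / complex_of_real t) \<longlongrightarrow> D) (at 0)"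
proof -
  have "((\<lambda>t. norm (f t - f 0 - t *\<^sub>R D) / norm t) \<longlongrightarrow> 0) (at 0)"
    using assms by (simp add: has_vector_derivative_def has_derivative_at)
  moreover have "\<forall>\<^sub>F t in at 0. norm (f t - f 0 - t *\<^sub>R D) / norm t = norm ((f t - f 0) / complex_of_real t - D)"
    using eventually_neq_at_within[of 0]
  proof eventually_elim
    case (elim t)
    then have "(f t - f 0) / complex_of_real t - D = (f t - f 0 - t *\<^sub>R D) / complex_of_real t"
      by (simp add: field_simps scaleR_conv_of_real)
    then show ?case
      by (simp add: norm_divide)
  qed
  ultimately have "((\<lambda>t. norm ((f t - f 0) / complex_of_real t - D)) \<longlongrightarrow> 0) (at 0)"
    by (rule Lim_transform_eventually)
  then show ?thesis
    by (simp add: tendsto_norm_zero_iff LIM_zero_iff)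
qed

lemma fc_continuous: "continuous_on {- pi..pi} f \<Longrightarrow> (\<lambda>t. f t * cis (- of_int j * t)) integrable_on {- pi..pi}"
  by (intro integrable_continuous_interval continuous_intros) auto

text \<open>Bessel's inequality for a constant string of coefficients along an arithmetic progression.\<close>

lemma fc_progression_zero:
  assumes cont: "continuous_on {- pi..pi} g" and s: "s \<noteq> 0"
    and G: "\<And>n::nat. fc g (a + s * int n) = G"
  shows "G = 0"
proof -
  have "compact (g ` {- pi..pi})"
    using cont by (intro compact_continuous_image) auto
  then obtain K where K: "\<And>t. t \<in> {- pi..pi} \<Longrightarrow> norm (g t) \<le> K"
    using compact_imp_bounded bounded_iff by (metis imageI)
  have K0: "K \<ge> 0"
    using order.trans[OF norm_ge_zero K[of 0]] by simp
  have main: "real N * norm G \<le> pi * (K\<^sup>2 + 1) * sqrt (real N)" if N: "N \<ge> 1" for N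
  proof -
    define D where "D t = (\<Sum>n<N. cis (- of_int (a + s * int n) * t))" for t :: real
    have D_cont: "continuous_on S D" for S
      unfolding D_def by (intro continuous_intros)
    \<comment> \<open>The weight in the inequality 2 K |D| <= K^2 \<beta> + |D|^2 / \<beta>. Since
      |D|^2 integrates to 2 pi N, the choice sqrt N balances the terms and bounds N |G| by a
      multiple of sqrt N.\<close>
    define \<beta> where "\<beta> = sqrt (real N)"
    have \<beta>: "\<beta> > 0" "\<beta> * \<beta> = real N"
      using N by (simp_all add: \<beta>_def)
    have gD: "integral {- pi..pi} (\<lambda>t. g t * D t) = of_nat N * G"
    proof -
      have "integral {- pi..pi} (\<lambda>t. g t * D t)
          = integral {- pi..pi} (\<lambda>t. \<Sum>n<N. g t * cis (- of_int (a + s * int n) * t))"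
        by (simp add: D_def sum_distrib_left)
      also have "\<dots> = (\<Sum>n<N. fc g (a + s * int n))"
        unfolding fc_def by (intro integral_sum fc_continuous[OF cont]) simp
      finally show ?thesis
        by (simp add: G)
    qed
    have DD: "((\<lambda>t. (norm (D t))\<^sup>2) has_integral 2 * pi * real N) {- pi..pi}"
    proof -
      have "complex_of_real ((norm (D t))\<^sup>2) = (\<Sum>n<N. \<Sum>k<N. cis (of_int (s * (int k - int n)) * t))" for t
      proof -
        have "complex_of_real ((norm (D t))\<^sup>2) = D t * cnj (D t)"
          by (rule complex_norm_square)
        also have "\<dots> = (\<Sum>n<N. \<Sum>k<N. cis (- of_int (a + s * int n) * t) * cnj (cis (- of_int (a + s * int k) * t)))"
          by (simp add: D_def sum_product)
        also have "\<dots> = (\<Sum>n<N. \<Sum>k<N. cis (of_int (s * (int k - int n)) * t))"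
          by (intro sum.cong refl) (simp add: cis_cnj cis_mult algebra_simps)
        finally show ?thesis .
      qed
      moreover have "((\<lambda>t. \<Sum>n<N. \<Sum>k<N. cis (of_int (s * (int k - int n)) * t)) has_integral
          (\<Sum>n<N. \<Sum>k<N. (if k = n then complex_of_real (2 * pi) else 0))) {- pi..pi}"
      proof (intro has_integral_sum)
        fix n k
        have "(\<lambda>t. cis (of_int (s * (int k - int n)) * t)) integrable_on {- pi..pi}"
          by (intro integrable_continuous_interval continuous_intros)
        then have "((\<lambda>t. cis (of_int (s * (int k - int n)) * t)) has_integral
            (if s * (int k - int n) = 0 then 2 * pi else 0)) {- pi..pi}"
          using fc_cis[of "s * (int k - int n)"] by (metis integrable_integral)
        then show "((\<lambda>t. cis (of_int (s * (int k - int n)) * t)) has_integral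
            (if k = n then complex_of_real (2 * pi) else 0)) {- pi..pi}"
          using s by (simp split: if_splits)
      qed simp_all
      moreover have "(\<Sum>n<N. \<Sum>k<N. (if k = n then complex_of_real (2 * pi) else 0)) = complex_of_real (2 * pi * real N)"
        by simp
      ultimately have "((\<lambda>t. complex_of_real ((norm (D t))\<^sup>2)) has_integral complex_of_real (2 * pi * real N)) {- pi..pi}"
        by (simp only:)
      from has_integral_linear[OF this bounded_linear_Re] show ?thesis
        by (simp add: o_def)
    qed
    have bound: "((\<lambda>t. (K\<^sup>2 * \<beta> + (norm (D t))\<^sup>2 / \<beta>) / 2) has_integral pi * (K\<^sup>2 + 1) * \<beta>) {- pi..pi}"
    proof -
      have "((\<lambda>t. (K\<^sup>2 * \<beta> + (norm (D t))\<^sup>2 / \<beta>) / 2) has_integral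
          (K\<^sup>2 * \<beta> * (2 * pi) + 2 * pi * real N / \<beta>) / 2) {- pi..pi}"
        using has_integral_const_real[of "K\<^sup>2 * \<beta>" "- pi" pi]
        by (intro has_integral_divide has_integral_add DD) (simp add: mult.commute)
      moreover have "(K\<^sup>2 * \<beta> * (2 * pi) + 2 * pi * real N / \<beta>) / 2 = pi * (K\<^sup>2 + 1) * \<beta>"
        using \<beta>(1) unfolding \<beta>(2)[symmetric] by (simp add: algebra_simps)
      ultimately show ?thesis
        by simp
    qed
    have "norm (of_nat N * G) \<le> pi * (K\<^sup>2 + 1) * \<beta>"
      unfolding gD[symmetric] integral_unique[OF bound, symmetric]
    proof (rule integral_norm_bound_integral)
      show "(\<lambda>t. g t * D t) integrable_on {- pi..pi}"
        by (intro integrable_continuous_interval continuous_intros cont D_cont)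
      show "(\<lambda>t. (K\<^sup>2 * \<beta> + (norm (D t))\<^sup>2 / \<beta>) / 2) integrable_on {- pi..pi}"
        using bound by blast
      fix t assume t: "t \<in> {- pi..pi}"
      have "norm (g t * D t) \<le> K * norm (D t)"
        unfolding norm_mult using K[OF t] by (intro mult_right_mono) auto
      also have "\<dots> \<le> (K\<^sup>2 * \<beta> + (norm (D t))\<^sup>2 / \<beta>) / 2"
      proof -
        have "0 \<le> (K * \<beta> - norm (D t))\<^sup>2 / \<beta>"
          using \<beta>(1) by simp
        also have "\<dots> = K\<^sup>2 * \<beta> + (norm (D t))\<^sup>2 / \<beta> - 2 * (K * norm (D t))"
          using \<beta>(1) by (simp add: field_simps power2_eq_square)
        finally show ?thesis
          by simp
      qed
      finally show "norm (g t * D t) \<le> (K\<^sup>2 * \<beta> + (norm (D t))\<^sup>2 / \<beta>) / 2" .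
    qed
    then show ?thesis
      by (simp add: norm_mult \<beta>_def)
  qed
  have "norm G * sqrt (real N) \<le> pi * (K\<^sup>2 + 1)" if "N \<ge> 1" for N
  proof -
    have "sqrt (real N) * (norm G * sqrt (real N)) = (sqrt (real N) * sqrt (real N)) * norm G"
      by (simp only: mult_ac)
    also have "\<dots> = real N * norm G"
      by simp
    also have "\<dots> \<le> sqrt (real N) * (pi * (K\<^sup>2 + 1))"
      using main[OF that] by (simp only: mult.commute)
    finally have "sqrt (real N) * (norm G * sqrt (real N)) \<le> sqrt (real N) * (pi * (K\<^sup>2 + 1))" .
    then show ?thesis
      using that by (subst (asm) mult_le_cancel_left_pos) auto
  qed
  note le = this
  show ?thesis
  proof (rule ccontr)
    assume "G \<noteq> 0"
    then obtain n where n: "real n * norm G > pi * (K\<^sup>2 + 1)"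
      using ex_less_of_nat_mult[of "norm G" "pi * (K\<^sup>2 + 1)"] by auto
    have "n \<noteq> 0"
    proof
      assume "n = 0"
      with n have "pi * (K\<^sup>2 + 1) < 0"
        by simp
      moreover have "pi * (K\<^sup>2 + 1) \<ge> 0"
        by (intro mult_nonneg_nonneg add_nonneg_nonneg) simp_all
      ultimately show False
        by simp
    qed
    \<comment> \<open>With N = n^2 the factor sqrt N is n.\<close>
    then show False
      using le[of "n\<^sup>2"] n by (simp add: mult.commute)
  qed
qed

text \<open>Chernoff's argument: if all coefficients of \<open>U\<close> vanish, those of
  \<open>(U t - U 0) / (cis t - 1)\<close> are constant on both half-lines.\<close>

lemma fc_all_zero:
  assumes cont: "continuous_on {- pi..pi} U" and der: "(U has_vector_derivative D) (at 0)"
    and zero: "\<And>j. fc U j = 0"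
  shows "U 0 = 0"
proof -
  have nz: "cis t \<noteq> 1" if "t \<in> {- pi..pi}" "t \<noteq> 0" for t
  proof
    assume "cis t = 1"
    then have "cos t = 1"
      by (simp add: complex_eq_iff)
    then obtain n :: int where n: "t = of_int n * 2 * pi"
      using cos_one_2pi_int by auto
    with that(2) have "\<bar>of_int n :: real\<bar> \<ge> 1"
      by auto
    then have "\<bar>t\<bar> \<ge> 1 * (2 * pi)"
      unfolding n by (simp add: abs_mult)
    with that show False
      using pi_gt_zero by auto
  qed
  \<comment> \<open>The value at 0 is the limit of the quotient, because (cis t - 1) / t tends to
    the imaginary unit.\<close>
  define g where "g t = (if t = 0 then D / \<i> else (U t - U 0) / (cis t - 1))" for t
  have g: "g t * (cis t - 1) = U t - U 0" if "t \<in> {- pi..pi}" for t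
    using nz[OF that] by (auto simp: g_def)
  have g_cont: "continuous_on {- pi..pi} g"
    unfolding continuous_on_eq_continuous_within
  proof
    fix t assume t: "t \<in> {- pi..pi}"
    show "continuous (at t within {- pi..pi}) g"
    proof (cases "t = 0")
      case True
      have "((\<lambda>s. ((U s - U 0) / complex_of_real s) / ((cis s - 1) / complex_of_real s)) \<longlongrightarrow> D / \<i>) (at 0)"
        using vector_derivative_quotient[OF der] vector_derivative_quotient[of cis \<i>]
          cis_vector_derivative[of 1 0 UNIV] by (intro tendsto_divide) simp_all
      moreover have "\<forall>\<^sub>F s in at 0. ((U s - U 0) / complex_of_real s) / ((cis s - 1) / complex_of_real s) = g s"
        using eventually_neq_at_within[of 0] by (rule eventually_mono) (simp add: g_def)
      ultimately have "(g \<longlongrightarrow> g 0) (at 0)"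
        by (simp add: g_def Lim_transform_eventually)
      then have "(g \<longlongrightarrow> g 0) (at 0 within {- pi..pi})"
        by (rule tendsto_within_subset) simp
      then show ?thesis
        using True by (simp add: continuous_within)
    next
      case False
      have "\<forall>\<^sub>F s in at t within {- pi..pi}. g s = (U s - U 0) / (cis s - 1)"
        using eventually_neq_at_within[of 0 t] by (rule eventually_mono) (simp add: g_def)
      moreover have "continuous (at t within {- pi..pi}) (\<lambda>s. (U s - U 0) / (cis s - 1))"
      proof (intro continuous_intros)
        show "continuous (at t within {- pi..pi}) U"
          using cont t by (simp add: continuous_on_eq_continuous_within)
        show "continuous (at t within {- pi..pi}) cis"
          using cis_vector_derivative[of 1 t] by (intro has_vector_derivative_continuous) auto
        show "cis t - 1 \<noteq> 0"
          using nz[OF t False] by simp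
      qed
      ultimately show ?thesis
        using False by (simp add: continuous_within g_def tendsto_cong)
    qed
  qed
  \<comment> \<open>The constant U 0 has only the coefficient with index 0, so the coefficients of g
    jump there and nowhere else.\<close>
  have step: "fc g (j - 1) - fc g j = - U 0 * (if j = 0 then 2 * pi else 0)" for j
  proof -
    have "fc g (j - 1) - fc g j = integral {- pi..pi} (\<lambda>t. g t * cis (- of_int (j - 1) * t) - g t * cis (- of_int j * t))"
      unfolding fc_def by (intro integral_diff[symmetric] fc_continuous g_cont)
    also have "\<dots> = integral {- pi..pi} (\<lambda>t. U t * cis (- of_int j * t) - U 0 * cis (of_int (- j) * t))"
    proof (rule integral_cong)
      fix t assume t: "t \<in> {- pi..pi}"
      have e: "cis (- of_int (j - 1) * t) = cis t * cis (- of_int j * t)"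
        by (simp add: cis_mult algebra_simps)
      have "g t * cis (- of_int (j - 1) * t) - g t * cis (- of_int j * t) = (g t * (cis t - 1)) * cis (- of_int j * t)"
        unfolding e by (simp add: algebra_simps)
      then show "g t * cis (- of_int (j - 1) * t) - g t * cis (- of_int j * t)
          = U t * cis (- of_int j * t) - U 0 * cis (of_int (- j) * t)"
        unfolding g[OF t] by (simp add: algebra_simps)
    qed
    also have "\<dots> = fc U j - integral {- pi..pi} (\<lambda>t. U 0 * cis (of_int (- j) * t))"
      unfolding fc_def
      by (intro integral_diff fc_continuous cont integrable_continuous_interval continuous_intros)
    also have "\<dots> = - U 0 * (if j = 0 then 2 * pi else 0)"
      using fc_cis[of "- j"] by (simp add: zero)
    finally show ?thesis .
  qed
  have "fc g (0 + 1 * int n) = fc g 0" for n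
  proof (induction n)
    case (Suc n)
    then show ?case
      using step[of "int (Suc n)"] by simp
  qed simp
  from fc_progression_zero[OF g_cont _ this] have "fc g 0 = 0"
    by simp
  moreover have "fc g (- 1 + (- 1) * int n) = fc g (- 1)" for n
  proof (induction n)
    case (Suc n)
    have e: "- 1 + (- 1) * int (Suc n) = (- 1 - int n) - 1"
      by simp
    show ?case
      unfolding e using step[of "- 1 - int n"] Suc by simp
  qed simp
  from fc_progression_zero[OF g_cont _ this] have "fc g (- 1) = 0"
    by simp
  ultimately show ?thesis
    using step[of 0] by simp
qed


text \<open>Gauging away the factor \<open>cis ((l/2 - 1) t) exp (- m cos t)\<close> turns the linear system into the
  recurrence \<open>rsys\<close> for the Fourier coefficients.\<close>

definition gfac :: "nat \<Rightarrow> real \<Rightarrow> real \<Rightarrow> complex" where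
  "gfac l m t = cis ((real l / 2 - 1) * t) * complex_of_real (exp (- m * cos t))"

text \<open>The gauge replaces m cos t by m cis (-t), which shifts Fourier indices in one direction
  only, and it makes the remaining frequencies integral.\<close>

definition usol :: "nat \<Rightarrow> real \<Rightarrow> real \<Rightarrow> (real \<Rightarrow> complex) \<Rightarrow> bool" where
  "usol l m R U \<longleftrightarrow> (\<forall>t. (U has_vector_derivative \<i> * (of_real (real l - 1) * U t
     + of_real m * cis (- t) * U t - of_real R * cis ((real l - 2) * t) * cnj (U t))) (at t))"

lemma usol_vector_derivative:
  "usol l m R U \<Longrightarrow> (U has_vector_derivative \<i> * (of_real (real l - 1) * U t
     + of_real m * cis (- t) * U t - of_real R * cis ((real l - 2) * t) * cnj (U t))) (at t within S)"
  unfolding usol_def by (blast intro: has_vector_derivative_at_within)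

lemma exp_cos_vector_derivative:
  "((\<lambda>t. complex_of_real (exp (a * cos t))) has_vector_derivative
     - of_real (a * sin t) * complex_of_real (exp (a * cos t))) (at t)"
  unfolding has_vector_derivative_complex_iff by (auto intro!: derivative_eq_intros)

lemma cis_minus_expand: "cis (- t) = of_real (cos t) - \<i> * of_real (sin t)"
  by (simp add: complex_eq_iff)

lemma fsol_to_usol:
  assumes F: "fsol l m R F"
  shows "usol l m R (\<lambda>t. gfac l m t * F t)"
  unfolding usol_def
proof
  fix t
  let ?c = "cis ((real l / 2 - 1) * t)" and ?e = "complex_of_real (exp (- m * cos t))"
  have "((\<lambda>t. gfac l m t * F t) has_vector_derivative
      ?c * ?e * (\<i> * (of_real (real l / 2 + m * cos t) * F t - of_real R * cnj (F t)))
      + (?c * (of_real (m * sin t) * ?e) + \<i> * of_real (real l / 2 - 1) * ?c * ?e) * F t) (at t)"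
    unfolding gfac_def
    using exp_cos_vector_derivative[of "- m" t]
    by (intro has_vector_derivative_mult fsol_vector_derivative[OF F] cis_vector_derivative) simp
  note der = this
  have "cis ((real l - 2) * t) * cis (- ((real l / 2 - 1) * t)) = ?c"
    by (simp add: cis_mult algebra_simps)
  then have cn: "cis ((real l - 2) * t) * cnj (gfac l m t * F t) = ?c * ?e * cnj (F t)"
    by (simp add: gfac_def cis_cnj mult.assoc[symmetric])
  have "?c * ?e * (\<i> * (of_real (real l / 2 + m * cos t) * F t - of_real R * cnj (F t)))
      + (?c * (of_real (m * sin t) * ?e) + \<i> * of_real (real l / 2 - 1) * ?c * ?e) * F t
      = \<i> * (of_real (real l - 1) * (gfac l m t * F t)
        + of_real m * cis (- t) * (gfac l m t * F t)
        - of_real R * cis ((real l - 2) * t) * cnj (gfac l m t * F t))"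
    unfolding mult.assoc[of "of_real R" "cis ((real l - 2) * t)"] cn unfolding gfac_def cis_minus_expand
    by (simp add: algebra_simps)
  with der show "((\<lambda>t. gfac l m t * F t) has_vector_derivative \<i> * (of_real (real l - 1) * (gfac l m t * F t)
      + of_real m * cis (- t) * (gfac l m t * F t)
      - of_real R * cis ((real l - 2) * t) * cnj (gfac l m t * F t))) (at t)"
    by (rule back_subst[of "\<lambda>D. (_ has_vector_derivative D) _"])
qed

lemma usol_to_fsol:
  assumes U: "usol l m R U"
  shows "fsol l m R (\<lambda>t. U t / gfac l m t)"
  unfolding fsol_def
proof
  fix t
  define h where "h t = cis ((1 - real l / 2) * t) * complex_of_real (exp (m * cos t))" for t
  have h: "inverse (gfac l m t) = h t" for t
  proof -
    have "inverse (exp (- m * cos t)) = exp (m * cos t)"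
      by (simp add: exp_minus)
    moreover have "- ((real l / 2 - 1) * t) = (1 - real l / 2) * t"
      by (simp add: algebra_simps)
    ultimately show ?thesis
      by (simp only: gfac_def h_def inverse_mult_distrib cis_inverse of_real_inverse[symmetric])
  qed
  have quot: "U t / gfac l m t = h t * U t" for t
    unfolding divide_inverse h by (rule mult.commute)
  let ?c = "cis ((1 - real l / 2) * t)" and ?e = "complex_of_real (exp (m * cos t))"
  have Ut: "(U has_vector_derivative \<i> * (of_real (real l - 1) * U t
     + of_real m * cis (- t) * U t - of_real R * cis ((real l - 2) * t) * cnj (U t))) (at t)"
    using U by (simp add: usol_def)
  have "((\<lambda>t. h t * U t) has_vector_derivative
      ?c * ?e * (\<i> * (of_real (real l - 1) * U t + of_real m * cis (- t) * U t
        - of_real R * cis ((real l - 2) * t) * cnj (U t)))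
      + (?c * (- of_real (m * sin t) * ?e) + \<i> * of_real (1 - real l / 2) * ?c * ?e) * U t) (at t)"
    unfolding h_def
    by (intro has_vector_derivative_mult exp_cos_vector_derivative cis_vector_derivative Ut)
  note der = this
  have "?c * cis ((real l - 2) * t) = cis (- ((1 - real l / 2) * t))"
    by (simp add: cis_mult algebra_simps)
  then have cn: "cnj (h t * U t) = ?e * (?c * cis ((real l - 2) * t)) * cnj (U t)"
    by (simp add: h_def cis_cnj)
  have "?c * ?e * (\<i> * (of_real (real l - 1) * U t + of_real m * cis (- t) * U t
        - of_real R * cis ((real l - 2) * t) * cnj (U t)))
      + (?c * (- of_real (m * sin t) * ?e) + \<i> * of_real (1 - real l / 2) * ?c * ?e) * U t
      = \<i> * (of_real (real l / 2 + m * cos t) * (h t * U t) - of_real R * cnj (h t * U t))"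
    unfolding cn unfolding h_def cis_minus_expand by (simp add: algebra_simps)
  with der have "((\<lambda>t. h t * U t) has_vector_derivative
      \<i> * (of_real (real l / 2 + m * cos t) * (h t * U t) - of_real R * cnj (h t * U t))) (at t)"
    by (rule back_subst[of "\<lambda>D. (_ has_vector_derivative D) _"])
  then show "((\<lambda>t. U t / gfac l m t) has_vector_derivative
      \<i> * (of_real (real l / 2 + m * cos t) * (U t / gfac l m t) - of_real R * cnj (U t / gfac l m t))) (at t)"
    by (simp only: quot)
qed

text \<open>The gauge factor itself has multiplier \<open>(- 1) ^ l\<close>, so
  \<open>antiper\<close> turns into plain periodicity of U.\<close>

lemma gfac_shift: "gfac l m (2 * pi) = (- 1) ^ l * gfac l m 0"
proof -
  have eq: "(real l / 2 - 1) * (2 * pi) = pi * of_int (int l - 2)"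
    by (simp add: algebra_simps)
  show ?thesis
    unfolding gfac_def eq cis_half_turns by simp
qed

lemma gfac_pi: "gfac l m pi = (- 1) ^ l * gfac l m (- pi)"
proof -
  have "cis ((real l / 2 - 1) * pi) = cis ((real l / 2 - 1) * (- pi)) * cis (pi * of_int (int l - 2))"
    by (simp add: cis_mult algebra_simps)
  then show ?thesis
    using cis_half_turns[of "int l - 2"] by (simp add: gfac_def)
qed

lemma gfac_reflect: "gfac l m (- t) = cnj (gfac l m t)"
  by (simp add: gfac_def cis_cnj)

lemma gfac_nonzero: "gfac l m t \<noteq> 0"
  by (simp add: gfac_def)

lemma fc_reflect:
  assumes "\<And>t. V t = U (- t)"
  shows "fc V j = fc U (- j)"
proof -
  have "fc U (- j) = integral {- pi..pi} (\<lambda>t. U (- t) * cis (- of_int (- j) * - t))"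
    unfolding fc_def using Henstock_Kurzweil_Integration.integral_reflect_real[of pi "- pi" "\<lambda>t. U t * cis (- of_int (- j) * t)"] by simp
  then show ?thesis
    by (simp add: fc_def assms)
qed

text \<open>The derivative of U(t) cis ((1 - j) t) integrates to 0 over a period. The coefficients
  of \<open>cnj (U t)\<close> become those of U by the reflection symmetry, which produces the index
  l - 1 - j.\<close>

lemma usol_fc:
  assumes U: "usol l m R U" and per: "U pi = U (- pi)" and refl: "\<And>t. cnj (U t) = U (- t)"
  shows "(of_int j - of_nat l) * fc U (j - 1) + of_real R * fc U (int l - 1 - j) = of_real m * fc U j"
proof -
  have Ut: "(U has_vector_derivative \<i> * (of_real (real l - 1) * U t
     + of_real m * cis (- t) * U t - of_real R * cis ((real l - 2) * t) * cnj (U t))) (at t within S)" for t S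
    by (rule usol_vector_derivative[OF U])
  have U_cont: "continuous_on {- pi..pi} U"
    using Ut by (rule continuous_on_vector_derivative)
  have V_cont: "continuous_on {- pi..pi} (\<lambda>t. cnj (U t))"
    by (intro continuous_intros U_cont)
  define A where "A t = \<i> * ((of_nat l - of_int j) * (U t * cis (- of_int (j - 1) * t))
      + of_real m * (U t * cis (- of_int j * t)) - of_real R * (cnj (U t) * cis (- of_int (j + 1 - int l) * t)))" for t
  have "(A has_integral U pi * cis (of_int (1 - j) * pi) - U (- pi) * cis (of_int (1 - j) * (- pi))) {- pi..pi}"
  proof (rule fundamental_theorem_of_calculus)
    fix t
    let ?k = "cis (of_int (1 - j) * t)"
    have "((\<lambda>t. U t * cis (of_int (1 - j) * t)) has_vector_derivative
        U t * (\<i> * complex_of_real (of_int (1 - j)) * ?k) + \<i> * (of_real (real l - 1) * U t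
         + of_real m * cis (- t) * U t - of_real R * cis ((real l - 2) * t) * cnj (U t)) * ?k)
       (at t within {- pi..pi})"
      by (intro has_vector_derivative_mult Ut cis_vector_derivative)
    moreover have e: "cis (- t) * ?k = cis (- of_int j * t)"
      "cis ((real l - 2) * t) * ?k = cis (- of_int (j + 1 - int l) * t)" "cis (- of_int (j - 1) * t) = ?k"
      by (simp_all add: cis_mult algebra_simps)
    have "A t = U t * (\<i> * complex_of_real (of_int (1 - j)) * ?k) + \<i> * (of_real (real l - 1) * U t
         + of_real m * cis (- t) * U t - of_real R * cis ((real l - 2) * t) * cnj (U t)) * ?k"
      unfolding A_def e(3) e(1,2)[symmetric] by (simp add: algebra_simps)
    ultimately show "((\<lambda>t. U t * cis (of_int (1 - j) * t)) has_vector_derivative A t) (at t within {- pi..pi})"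
      by simp
  qed simp
  moreover have "U pi * cis (of_int (1 - j) * pi) - U (- pi) * cis (of_int (1 - j) * (- pi)) = 0"
    unfolding per cis_int_pi[of "1 - j"] by (simp only: mult_minus_left mult_minus_right diff_self)
  ultimately have "integral {- pi..pi} A = 0"
    by (simp only: integral_unique)
  moreover have "(A has_integral \<i> * ((of_nat l - of_int j) * fc U (j - 1) + of_real m * fc U j
      - of_real R * fc (\<lambda>t. cnj (U t)) (j + 1 - int l))) {- pi..pi}"
    unfolding A_def fc_def
    by (intro has_integral_mult_right has_integral_diff has_integral_add integrable_integral fc_continuous U_cont V_cont)
  ultimately have "(of_nat l - of_int j) * fc U (j - 1) + of_real m * fc U j
      - of_real R * fc (\<lambda>t. cnj (U t)) (j + 1 - int l) = 0"
    by (simp add: integral_unique)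
  moreover have "fc (\<lambda>t. cnj (U t)) (j + 1 - int l) = fc U (int l - 1 - j)"
  proof -
    have e: "int l - 1 - j = - (j + 1 - int l)"
      by simp
    show ?thesis
      unfolding e by (rule fc_reflect) (rule refl)
  qed
  ultimately show ?thesis
    by (simp add: algebra_simps)
qed

lemma antiper_to_rsys:
  assumes F: "antiper l m R F"
  shows "\<exists>x k. rsys l m R x \<and> bseq x \<and> x k \<noteq> 0"
proof -
  have Fs: "fsol l m R F" "F 0 = 1" "F (2 * pi) = (- 1) ^ l"
    using F by (auto simp: antiper_def)
  have "(\<lambda>t. F (t + 2 * pi)) = (\<lambda>t. complex_of_real ((- 1) ^ l) * F t)"
    by (rule fsol_unique[OF fsol_shift[OF Fs(1)] fsol_scale[OF Fs(1)], of 0]) (simp add: Fs)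
  from fun_cong[OF this, of "- pi"] have F_pi: "F pi = (- 1) ^ l * F (- pi)"
    by simp
  have "(\<lambda>t. cnj (F (- t))) = F"
    by (rule fsol_unique[OF fsol_reflect[OF Fs(1)] Fs(1), of 0]) (simp add: Fs)
  then have F_refl: "cnj (F t) = F (- t)" for t
    by (metis complex_cnj_cnj)
  define U where "U t = gfac l m t * F t" for t
  have U: "usol l m R U"
    unfolding U_def[abs_def] by (rule fsol_to_usol[OF Fs(1)])
  have per: "U pi = U (- pi)"
    by (simp add: U_def F_pi gfac_pi flip: power_mult_distrib)
  have refl: "cnj (U t) = U (- t)" for t
    by (simp add: U_def gfac_reflect F_refl)
  note rec = usol_fc[OF U per refl]
  have U0: "U 0 \<noteq> 0"
    by (simp add: U_def Fs gfac_nonzero)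
  have Ut: "(U has_vector_derivative \<i> * (of_real (real l - 1) * U t
     + of_real m * cis (- t) * U t - of_real R * cis ((real l - 2) * t) * cnj (U t))) (at t within S)" for t S
    by (rule usol_vector_derivative[OF U])
  have U_cont: "continuous_on {- pi..pi} U"
    using Ut by (rule continuous_on_vector_derivative)
  obtain k where k: "fc U k \<noteq> 0"
    using fc_all_zero[OF U_cont Ut] U0 by blast
  \<comment> \<open>The recurrence has real coefficients, so real and imaginary parts solve it
    separately, and one of them is nonzero.\<close>
  have sys: "rsys l m R (\<lambda>j. Re (fc U j))" "rsys l m R (\<lambda>j. Im (fc U j))"
    unfolding rsys_def using arg_cong[OF rec, of Re] arg_cong[OF rec, of Im] by simp_all
  have "(\<lambda>t. norm (U t)) integrable_on {- pi..pi}"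
    by (intro integrable_continuous_interval continuous_intros U_cont)
  then have "norm (fc U j) \<le> integral {- pi..pi} (\<lambda>t. norm (U t))" for j
    unfolding fc_def
    by (intro integral_norm_bound_integral fc_continuous U_cont) (simp_all add: norm_mult)
  then have "bseq (\<lambda>j. Re (fc U j))" "bseq (\<lambda>j. Im (fc U j))"
    unfolding bseq_def by (meson abs_Re_le_cmod abs_Im_le_cmod order.trans)+
  moreover have "Re (fc U k) \<noteq> 0 \<or> Im (fc U k) \<noteq> 0"
    using k by (simp add: complex_eq_iff)
  ultimately show ?thesis
    using sys by blast
qed

section \<open>From the recurrence back to a solution of the linear system\<close>

lemma int_decode_lower: "real (Suc n) \<le> 2 * (1 + \<bar>of_int (int_decode n)\<bar>)"
  by (auto simp: int_decode_def sum_decode_def elim!: evenE oddE)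

text \<open>Bounded solutions decay faster than any power, so their Fourier series may be
  differentiated termwise. \<open>int_decode\<close> enumerates the frequencies to make it an
  ordinary series.\<close>

lemma usol_series:
  assumes sys: "rsys l m R x" and b: "bseq x"
  shows "\<exists>U. usol l m R U \<and> (\<forall>t. U (t + 2 * pi) = U t) \<and> Im (U 0) = 0 \<and>
           (\<forall>k. ((\<lambda>t. U t * cis (- of_int k * t)) has_integral 2 * pi * complex_of_real (x k)) {- pi..pi})"
proof -
  define e where "e = int_decode"
  have bij_e: "bij e"
    by (simp add: e_def bij_int_decode)
  define a where "a n = x (e n)" for n
  \<comment> \<open>Cubic decay: one power pays for the derivative, two for summability.\<close>
  obtain C where C: "\<And>j. \<bar>x j\<bar> * (1 + \<bar>of_int j\<bar>) ^ 3 \<le> C"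
    using rsys_decay[OF sys b, of 3] by blast
  have C0: "C \<ge> 0"
    using C[of 0] by simp
  have a_bound: "\<bar>a n\<bar> * (1 + \<bar>of_int (e n)\<bar>) \<le> 4 * C * (1 / (real n + 1)\<^sup>2)" for n
  proof -
    define y where "y = 1 + \<bar>of_int (e n) :: real\<bar>"
    have "(real n + 1)\<^sup>2 \<le> (2 * y)\<^sup>2"
      using int_decode_lower[of n] by (intro power_mono) (auto simp: y_def e_def)
    then have "\<bar>a n\<bar> * y * (real n + 1)\<^sup>2 \<le> \<bar>a n\<bar> * y * (2 * y)\<^sup>2"
      by (intro mult_left_mono) (auto simp: y_def)
    also have "\<dots> = 4 * (\<bar>a n\<bar> * y ^ 3)"
      by (simp add: power2_eq_square power3_eq_cube)
    also have "\<dots> \<le> 4 * C"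
      using C[of "e n"] by (simp add: a_def y_def)
    finally show ?thesis
      by (simp add: y_def pos_le_divide_eq add_pos_nonneg)
  qed
  have sum1: "summable (\<lambda>n. \<bar>a n\<bar> * (1 + \<bar>of_int (e n)\<bar>))"
  proof (rule summable_comparison_test')
    show "summable (\<lambda>n. 4 * C * (1 / (real n + 1)\<^sup>2))"
      using inverse_squares_sums by (intro summable_mult) (auto simp: summable_def add.commute)
    show "norm (\<bar>a n\<bar> * (1 + \<bar>of_int (e n)\<bar>)) \<le> 4 * C * (1 / (real n + 1)\<^sup>2)" if "n \<ge> 0" for n
      using a_bound[of n] by (simp add: abs_mult)
  qed
  have sum_a: "summable (\<lambda>n. \<bar>a n\<bar>)"
    by (rule summable_comparison_test'[OF sum1, of 0]) (simp add: distrib_left)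
  have sum_ae: "summable (\<lambda>n. \<bar>a n\<bar> * \<bar>of_int (e n)\<bar>)"
    by (rule summable_comparison_test'[OF sum1, of 0]) (simp add: distrib_left abs_mult)
  define U where "U t = Complex (\<Sum>n. a n * cos (of_int (e n) * t)) (\<Sum>n. a n * sin (of_int (e n) * t))" for t
  define W where "W t = Complex (\<Sum>n. - (a n * of_int (e n) * sin (of_int (e n) * t)))
      (\<Sum>n. a n * of_int (e n) * cos (of_int (e n) * t))" for t
  have trig: "\<bar>c * sin t\<bar> \<le> \<bar>c\<bar>" "\<bar>c * cos t\<bar> \<le> \<bar>c\<bar>" for c t :: real
    using mult_left_mono[OF abs_sin_le_one, of "\<bar>c\<bar>" t] mult_left_mono[OF abs_cos_le_one, of "\<bar>c\<bar>" t]
    by (simp_all add: abs_mult)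
  have summ: "summable (\<lambda>n. a n * cos (of_int (e n) * t))" "summable (\<lambda>n. a n * sin (of_int (e n) * t))"
    "summable (\<lambda>n. - (a n * of_int (e n) * sin (of_int (e n) * t)))"
    "summable (\<lambda>n. a n * of_int (e n) * cos (of_int (e n) * t))" for t
    by (rule summable_comparison_test'[OF sum_a, of 0] summable_comparison_test'[OF sum_ae, of 0];
        unfold real_norm_def abs_minus_cancel abs_mult[symmetric]; rule trig)+
  have "((\<lambda>t. \<Sum>n. a n * cos (of_int (e n) * t)) has_real_derivative
      (\<Sum>n. - (a n * of_int (e n) * sin (of_int (e n) * t)))) (at t)" for t
  proof (rule has_field_derivative_series'(2)[of UNIV _ _ 0])
    show "((\<lambda>t. a n * cos (of_int (e n) * t)) has_real_derivative - (a n * of_int (e n) * sin (of_int (e n) * s))) (at s within UNIV)" for n s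
      by (auto intro!: derivative_eq_intros)
    show "uniformly_convergent_on UNIV (\<lambda>N s. \<Sum>n<N. - (a n * of_int (e n) * sin (of_int (e n) * s)))"
      by (rule Weierstrass_m_test'[OF _ sum_ae]) (use trig(1)[of "a _ * of_int (e _)"] in \<open>simp flip: abs_mult\<close>)
  qed (use summ summable_rabs_cancel[OF sum_a] in auto)
  moreover have "((\<lambda>t. \<Sum>n. a n * sin (of_int (e n) * t)) has_real_derivative
      (\<Sum>n. a n * of_int (e n) * cos (of_int (e n) * t))) (at t)" for t
  proof (rule has_field_derivative_series'(2)[of UNIV _ _ 0])
    show "((\<lambda>t. a n * sin (of_int (e n) * t)) has_real_derivative a n * of_int (e n) * cos (of_int (e n) * s)) (at s within UNIV)" for n s
      by (auto intro!: derivative_eq_intros)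
    show "uniformly_convergent_on UNIV (\<lambda>N s. \<Sum>n<N. a n * of_int (e n) * cos (of_int (e n) * s))"
      by (rule Weierstrass_m_test'[OF _ sum_ae]) (use trig(2)[of "a _ * of_int (e _)"] in \<open>simp flip: abs_mult\<close>)
  qed (use summ summable_rabs_cancel[OF sum_a] in auto)
  ultimately have U_der: "(U has_vector_derivative W t) (at t)" for t
    by (simp add: has_vector_derivative_complex_iff U_def W_def)
  have U_sums: "(\<lambda>n. of_real (a n) * cis (of_int (e n) * t)) sums U t"
    and W_sums: "(\<lambda>n. \<i> * of_int (e n) * of_real (a n) * cis (of_int (e n) * t)) sums W t" for t
  proof -
    have "of_real (a n) * cis (of_int (e n) * t) = Complex (a n * cos (of_int (e n) * t)) (a n * sin (of_int (e n) * t))"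
      "\<i> * of_int (e n) * of_real (a n) * cis (of_int (e n) * t)
        = Complex (- (a n * of_int (e n) * sin (of_int (e n) * t))) (a n * of_int (e n) * cos (of_int (e n) * t))" for n
      by (simp_all add: complex_eq_iff)
    then show "(\<lambda>n. of_real (a n) * cis (of_int (e n) * t)) sums U t"
      "(\<lambda>n. \<i> * of_int (e n) * of_real (a n) * cis (of_int (e n) * t)) sums W t"
      unfolding sums_complex_iff U_def W_def using summ[of t] by (simp_all only: complex.sel summable_sums)
  qed
  have U_has_sum: "((\<lambda>j. of_real (x j) * cis (of_int j * t)) has_sum U t) UNIV" for t
  proof -
    have "((\<lambda>n. of_real (a n) * cis (of_int (e n) * t)) has_sum U t) UNIV"
      by (rule norm_summable_imp_has_sum[OF _ U_sums]) (simp add: norm_mult sum_a)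
    then show ?thesis
      using has_sum_reindex_bij_betw[OF bij_e, of "\<lambda>j. of_real (x j) * cis (of_int j * t)"] by (simp add: a_def)
  qed
  have W_has_sum: "((\<lambda>j. \<i> * of_int j * of_real (x j) * cis (of_int j * t)) has_sum W t) UNIV" for t
  proof -
    have "((\<lambda>n. \<i> * of_int (e n) * of_real (a n) * cis (of_int (e n) * t)) has_sum W t) UNIV"
      by (rule norm_summable_imp_has_sum[OF _ W_sums]) (use sum_ae in \<open>simp add: norm_mult mult.commute\<close>)
    then show ?thesis
      using has_sum_reindex_bij_betw[OF bij_e, of "\<lambda>j. \<i> * of_int j * of_real (x j) * cis (of_int j * t)"]
      by (simp add: a_def)
  qed
  have "W t = \<i> * (of_real (real l - 1) * U t
     + of_real m * cis (- t) * U t - of_real R * cis ((real l - 2) * t) * cnj (U t))" for t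
  \<comment> \<open>Comparing coefficients needs the shifts j -> j - 1 and j -> l - 1 - j, which
    unordered sums over the integers permit.\<close>
  proof (rule has_sum_unique)
    have bij1: "bij (\<lambda>j::int. j - 1)"
      by (rule bij_betw_byWitness[of _ "\<lambda>j. j + 1"]) auto
    have bij2: "bij (\<lambda>j::int. int l - 1 - j)"
      by (rule bij_betw_byWitness[of _ "\<lambda>j. int l - 1 - j"]) auto
    let ?w = "\<lambda>j. \<i> * of_int (j - 1) * of_real (x (j - 1)) * cis (of_int (j - 1) * t)"
    show "(?w has_sum W t) UNIV"
      using has_sum_reindex_bij_betw[OF bij1, of "\<lambda>j. \<i> * of_int j * of_real (x j) * cis (of_int j * t)" "W t"]
        W_has_sum[of t] by simp
    have h1: "((\<lambda>j. of_real (x (j - 1)) * cis (of_int (j - 1) * t)) has_sum U t) UNIV"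
      using has_sum_reindex_bij_betw[OF bij1, of "\<lambda>j. of_real (x j) * cis (of_int j * t)" "U t"] U_has_sum[of t] by simp
    have h3: "((\<lambda>j. of_real (x (int l - 1 - j)) * cis (- of_int (int l - 1 - j) * t)) has_sum cnj (U t)) UNIV"
    proof -
      have "((\<lambda>j. cnj (of_real (x j) * cis (of_int j * t))) has_sum cnj (U t)) UNIV"
        using U_has_sum[of t] by (simp only: has_sum_cnj_iff)
      then have "((\<lambda>j. of_real (x j) * cis (- of_int j * t)) has_sum cnj (U t)) UNIV"
        by (simp add: cis_cnj)
      then show ?thesis
        using has_sum_reindex_bij_betw[OF bij2, of "\<lambda>j. of_real (x j) * cis (- of_int j * t)" "cnj (U t)"] by simp
    qed
    have hs: "((\<lambda>j. \<i> * (of_real (real l - 1) * (of_real (x (j - 1)) * cis (of_int (j - 1) * t))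
        + of_real m * cis (- t) * (of_real (x j) * cis (of_int j * t))
        + (- of_real R * cis ((real l - 2) * t)) * (of_real (x (int l - 1 - j)) * cis (- of_int (int l - 1 - j) * t))))
        has_sum \<i> * (of_real (real l - 1) * U t + of_real m * cis (- t) * U t
          + (- of_real R * cis ((real l - 2) * t)) * cnj (U t))) UNIV"
      by (intro has_sum_cmult_right has_sum_add h1 h3 U_has_sum)
    have summand: "\<i> * (of_real (real l - 1) * (of_real (x (j - 1)) * cis (of_int (j - 1) * t))
        + of_real m * cis (- t) * (of_real (x j) * cis (of_int j * t))
        + (- of_real R * cis ((real l - 2) * t)) * (of_real (x (int l - 1 - j)) * cis (- of_int (int l - 1 - j) * t)))
        = ?w j" for j
    proof -
      have c: "cis (- t) * cis (of_int j * t) = cis (of_int (j - 1) * t)"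
        "cis ((real l - 2) * t) * cis (- of_int (int l - 1 - j) * t) = cis (of_int (j - 1) * t)"
        by (simp_all add: cis_mult algebra_simps)
      have "of_real (real l - 1) * (of_real (x (j - 1)) * cis (of_int (j - 1) * t))
        + of_real m * cis (- t) * (of_real (x j) * cis (of_int j * t))
        + (- of_real R * cis ((real l - 2) * t)) * (of_real (x (int l - 1 - j)) * cis (- of_int (int l - 1 - j) * t))
        = of_real (real l - 1) * of_real (x (j - 1)) * cis (of_int (j - 1) * t)
        + of_real (m * x j) * (cis (- t) * cis (of_int j * t))
        - of_real (R * x (int l - 1 - j)) * (cis ((real l - 2) * t) * cis (- of_int (int l - 1 - j) * t))"
        by (simp add: mult_ac)
      also have "\<dots> = of_real ((real l - 1) * x (j - 1) + m * x j - R * x (int l - 1 - j)) * cis (of_int (j - 1) * t)"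
        unfolding c by (simp add: algebra_simps)
      also have "(real l - 1) * x (j - 1) + m * x j - R * x (int l - 1 - j) = of_int (j - 1) * x (j - 1)"
        using rsysD[OF sys, of j] by (simp add: algebra_simps)
      finally show ?thesis
        by (simp add: mult_ac)
    qed
    show "(?w has_sum \<i> * (of_real (real l - 1) * U t
        + of_real m * cis (- t) * U t - of_real R * cis ((real l - 2) * t) * cnj (U t))) UNIV"
      using hs unfolding summand by (simp only: diff_conv_add_uminus mult_minus_left)
  qed
  then have us: "usol l m R U"
    using U_der by (simp add: usol_def)
  have per: "U (t + 2 * pi) = U t" for t
  proof -
    have arg: "of_int (e n) * (t + 2 * pi) = of_int (e n) * t + 2 * pi * of_int (e n)" for n
      by (simp add: algebra_simps)
    have "cos (s + 2 * pi * of_int k) = cos s" for s k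
      by (simp add: cos_add cos_int_2pin sin_int_2pin)
    then show ?thesis
      unfolding U_def arg sin_plus_int_2pi by simp
  qed
  have im: "Im (U 0) = 0"
    by (simp add: U_def)
  have coeff: "((\<lambda>t. U t * cis (- of_int k * t)) has_integral 2 * pi * complex_of_real (x k)) {- pi..pi}" for k
  proof -
    let ?f = "\<lambda>n t. of_real (a n) * cis (of_int (e n) * t) * cis (- of_int k * t)"
    have "(\<lambda>n. ?f n t) sums (U t * cis (- of_int k * t))" for t
      by (rule sums_mult2[OF U_sums])
    then have lim: "(\<Sum>n. ?f n t) = U t * cis (- of_int k * t)" for t
      by (simp add: sums_iff)
    have unif: "uniform_limit {- pi..pi} (\<lambda>N t. \<Sum>n<N. ?f n t) (\<lambda>t. \<Sum>n. ?f n t) sequentially"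
      by (rule Weierstrass_m_test[OF _ sum_a]) (simp add: norm_mult)
    have cont: "continuous_on {- pi..pi} (\<lambda>t. \<Sum>n<N. ?f n t)" for N
      by (intro continuous_intros)
    obtain I J where I: "\<And>N. ((\<lambda>t. \<Sum>n<N. ?f n t) has_integral I N) {- pi..pi}"
      and J: "((\<lambda>t. \<Sum>n. ?f n t) has_integral J) {- pi..pi}" and IJ: "I \<longlonglongrightarrow> J"
      by (rule uniform_limit_integral[OF unif cont trivial_limit_sequentially]) (rule that)
    have I_eq: "I N = (\<Sum>n<N. complex_of_real (a n) * complex_of_real (if e n = k then 2 * pi else 0))" for N
    proof (rule has_integral_unique[OF I])
      show "((\<lambda>t. \<Sum>n<N. ?f n t) has_integral (\<Sum>n<N. complex_of_real (a n) * complex_of_real (if e n = k then 2 * pi else 0))) {- pi..pi}"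
      proof (rule has_integral_sum)
        fix n
        have "(\<lambda>t. cis (of_int (e n - k) * t)) integrable_on {- pi..pi}"
          by (intro integrable_continuous_interval continuous_intros)
        from integrable_integral[OF this]
        have "((\<lambda>t. cis (of_int (e n - k) * t)) has_integral complex_of_real (if e n = k then 2 * pi else 0)) {- pi..pi}"
          unfolding fc_cis by (simp split: if_splits)
        then have "((\<lambda>t. of_real (a n) * cis (of_int (e n - k) * t)) has_integral
            of_real (a n) * complex_of_real (if e n = k then 2 * pi else 0)) {- pi..pi}"
          by (rule has_integral_mult_right)
        moreover have "?f n t = of_real (a n) * cis (of_int (e n - k) * t)" for t
          by (simp add: cis_mult algebra_simps)
        ultimately show "(?f n has_integral of_real (a n) * complex_of_real (if e n = k then 2 * pi else 0)) {- pi..pi}"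
          by (simp only:)
      qed simp
    qed
    obtain n0 where n0: "e n0 = k"
      using bij_e by (metis bij_pointE)
    have "I N = 2 * pi * complex_of_real (x k)" if "N > n0" for N
    proof -
      have "I N = (\<Sum>n<N. if n = n0 then complex_of_real (a n) * complex_of_real (2 * pi) else 0)"
        unfolding I_eq using bij_e n0 by (intro sum.cong refl) (auto simp: bij_def inj_def)
      then show ?thesis
        using that n0 by (simp add: a_def mult_ac)
    qed
    then have "\<forall>\<^sub>F N in sequentially. I N = 2 * pi * complex_of_real (x k)"
      by (rule eventually_mono[OF eventually_gt_at_top[of n0]])
    then have "I \<longlonglongrightarrow> 2 * pi * complex_of_real (x k)"
      by (rule tendsto_eventually)
    then have "J = 2 * pi * complex_of_real (x k)"
      by (rule LIMSEQ_unique[OF IJ])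
    then show ?thesis
      using J by (simp only: lim)
  qed
  show ?thesis
    by (intro exI[of _ U] conjI allI us per im coeff)
qed

text \<open>F 0 is real because the coefficients are. It is nonzero, as otherwise uniqueness would
  make U vanish together with its coefficient \<open>x k\<close>. So F can be scaled to F 0 =
  1.\<close>

lemma rsys_to_antiper:
  assumes sys: "rsys l m R x" and b: "bseq x" and k: "x k \<noteq> 0"
  shows "\<exists>F. antiper l m R F"
proof -
  obtain U where U_all: "usol l m R U \<and> (\<forall>t. U (t + 2 * pi) = U t) \<and> Im (U 0) = 0 \<and>
      (\<forall>k. ((\<lambda>t. U t * cis (- of_int k * t)) has_integral 2 * pi * complex_of_real (x k)) {- pi..pi})"
    using usol_series[OF sys b] ..
  have U: "usol l m R U" "U (t + 2 * pi) = U t" "Im (U 0) = 0"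
    "((\<lambda>t. U t * cis (- of_int k * t)) has_integral 2 * pi * complex_of_real (x k)) {- pi..pi}" for t
    using U_all by (simp_all only:)
  define F where "F t = U t / gfac l m t" for t
  have F: "fsol l m R F"
    unfolding F_def[abs_def] by (rule usol_to_fsol[OF U(1)])
  have "F 0 \<noteq> 0"
  proof
    assume "F 0 = 0"
    have "fsol l m R (\<lambda>t. complex_of_real 0 * F t)"
      by (rule fsol_scale[OF F])
    then have "F = (\<lambda>t. complex_of_real 0 * F t)"
      using \<open>F 0 = 0\<close> by (intro fsol_unique[OF F, of _ 0]) simp_all
    then have "F t = 0" for t
      by (metis mult_zero_left of_real_0)
    then have "U t = 0" for t
      using gfac_nonzero[of l m t] by (metis F_def divide_eq_0_iff)
    then have "((\<lambda>t. 0) has_integral 2 * pi * complex_of_real (x k)) {- pi..pi}"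
      using U(4) by simp
    then have "2 * pi * complex_of_real (x k) = 0"
      by (rule has_integral_unique[OF _ has_integral_0])
    with k show False
      by simp
  qed
  have g0: "gfac l m 0 = complex_of_real (exp (- m))"
    by (simp add: gfac_def)
  have U0: "U 0 = complex_of_real (Re (U 0))"
    using U(3) by (simp add: complex_eq_iff)
  have "F 0 = complex_of_real (Re (U 0)) / complex_of_real (exp (- m))"
    by (simp only: F_def g0 U0[symmetric])
  then have "F 0 = complex_of_real (Re (U 0) / exp (- m))"
    by (simp only: of_real_divide)
  then obtain c where c: "F 0 = complex_of_real c"
    by blast
  have "F (2 * pi) = (- 1) ^ l * F 0"
  proof -
    have "F (2 * pi) = U 0 / ((- 1) ^ l * gfac l m 0)"
      using U(2)[of 0] by (simp only: F_def gfac_shift add_0)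
    then show ?thesis
      by (cases "even l") (simp_all add: F_def)
  qed
  then have "antiper l m R (\<lambda>t. complex_of_real (1 / c) * F t)"
    using \<open>F 0 \<noteq> 0\<close> fsol_scale[OF F, of "1 / c"] by (simp add: antiper_def c)
  then show ?thesis
    by blast
qed

section \<open>Generalised simple intersections\<close>

lemma chn_zero_tail:
  fixes R :: real
  assumes i: "i \<ge> 1" "R\<^sup>2 = real i * (real l - real i)" and n: "n \<ge> 2 * i + 1"
  shows "chn l 0 R n = 0"
proof -
  obtain k where k: "i = Suc k"
    using i(1) by (cases i) auto
  have "chn l 0 R (Suc (2 * i)) = (R\<^sup>2 - real i * (real l - real i)) * chn l 0 R (Suc (2 * k))"
    by (simp add: k chc_def power2_eq_square algebra_simps)
  then have 1: "chn l 0 R (Suc (2 * i)) = 0"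
    using i(2) by simp
  then have 2: "chn l 0 R (Suc (Suc (2 * i))) = 0"
    by (simp add: chc_def)
  have "chn l 0 R (Suc (2 * i) + j) = 0 \<and> chn l 0 R (Suc (Suc (2 * i)) + j) = 0" for j
    by (induction j) (use 1 2 in auto)
  from this[of "n - Suc (2 * i)"] n show ?thesis
    by simp
qed

text \<open>The path recursion divides by m, so m = 0 is treated apart. The equations then couple
  only the pairs x (j - 1), x (l - 1 - j); a nonzero pair forces R^2 = j (l - j), one of the factors
  of Q at m = 0.\<close>

lemma rsys_chQ_zero_m0:
  assumes sys: "rsys l 0 R x" and x: "x k \<noteq> 0" and R: "R \<noteq> 0" and l: "l \<ge> 1"
  shows "chQ l 0 R = 0"
proof -
  define j where "j = k + 1"
  have e1: "(of_int j - real l) * x k = - R * x (int l - 1 - j)"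
    using rsysD[OF sys, of j] by (simp add: j_def)
  have "R * x (int l - 1 - (int l - j)) = of_int j * x (int l - j - 1)"
    using rsysD[OF sys, of "int l - j"] by simp
  then have e2: "of_int j * x (int l - 1 - j) = R * x k"
    by (simp add: j_def algebra_simps)
  have "of_int j * ((of_int j - real l) * x k) = - R * (of_int j * x (int l - 1 - j))"
    unfolding e1 by simp
  also have "\<dots> = - (R\<^sup>2 * x k)"
    unfolding e2 by (simp add: power2_eq_square)
  finally have "(R\<^sup>2 - of_int j * (real l - of_int j)) * x k = 0"
    by (simp add: algebra_simps)
  then have R2: "R\<^sup>2 = of_int j * (real l - of_int j)"
    using x by simp
  then have pos: "of_int j * (real l - of_int j) > 0"
    using R by (metis zero_less_power2)
  then have j: "0 < j" "j < int l"
    by (auto simp: zero_less_mult_iff)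
  show ?thesis
  proof (cases "2 * j = int l")
    \<comment> \<open>The pair collapses to the turning index; one equation then fixes R = l/2, sign
      included, which is the zero of the loop factor.\<close>
    case True
    define i where "i = nat j"
    have i: "j = int i" "l = 2 * i" "i \<ge> 1"
      using True j by (auto simp: i_def)
    have "int l - 1 - j = k"
      using True by (simp add: j_def)
    then have "x (int l - 1 - j) = x k"
      by simp
    then have "R = real i"
      using e2 x i by simp
    moreover obtain k' where "i = Suc k'"
      using i(3) by (cases i) auto
    ultimately show ?thesis
      by (simp add: chQ_def i(2) chc_def)
  next
    case False
    \<comment> \<open>j and l - j give the same R^2; the smaller one appears as a factor before the
      path turns.\<close>
    define i where "i = nat (min j (int l - j))"
    have i: "i \<ge> 1" "2 * i < l" "int i = j \<or> int i = int l - j"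
      using False j by (auto simp: i_def min_def)
    have "real i = of_int j \<or> real i = real l - of_int j"
      using i(3) by (metis of_int_diff of_int_of_nat_eq)
    then have Ri: "R\<^sup>2 = real i * (real l - real i)"
      using R2 by auto
    have "chn l 0 R l = 0"
      using chn_zero_tail[OF i(1) Ri, of l] i(2) by simp
    moreover have "chn l 0 R (l - 1) = 0" if "even l"
    proof -
      have "l - 1 \<ge> 2 * i + 1"
        using that i(2) by (auto elim!: evenE)
      then show ?thesis
        using chn_zero_tail[OF i(1) Ri] by blast
    qed
    ultimately show ?thesis
      by (auto simp: chQ_def)
  qed
qed

lemma antiper_fixes:
  assumes "r > 0" "e = 1 \<or> e = - 1" "antiper l m (e * r) F"
  shows "\<exists>k::int. even (k - int l) \<and> rotnum (1 / (2 * r)) (real l / (2 * r)) (m / r) = of_int k \<and>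
    fixes_mod (poincare (1 / (2 * r)) (real l / (2 * r)) (m / r)) (e * pi / 2)"
proof -
  obtain k :: int where k: "even (k - int l)" "phi r l m (e * pi / 2) (2 * pi) = e * pi / 2 + 2 * pi * k"
    using antiper_imp_fixed[OF assms] by blast
  have "\<bar>e * pi / 2\<bar> \<le> pi"
    using assms(2) by auto
  then have "rotnum (1 / (2 * r)) (real l / (2 * r)) (m / r) = of_int k"
    using rotnum_eq[OF assms(1) _ k(2)] by simp
  with k show ?thesis
    unfolding fixes_mod_def poincare_phi by blast
qed

lemma fixes_antiper:
  assumes "r > 0" "e = 1 \<or> e = - 1" "even (s - int l)"
    and rot: "rotnum (1 / (2 * r)) (real l / (2 * r)) (m / r) = of_int s"
    and fixed: "fixes_mod (poincare (1 / (2 * r)) (real l / (2 * r)) (m / r)) (e * pi / 2)"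
  shows "\<exists>F. antiper l m (e * r) F"
proof -
  obtain k :: int where k: "phi r l m (e * pi / 2) (2 * pi) = e * pi / 2 + 2 * pi * k"
    using fixed by (auto simp: fixes_mod_def poincare_phi)
  have "\<bar>e * pi / 2\<bar> \<le> pi"
    using assms(2) by auto
  then have "k = s"
    using rotnum_eq[OF assms(1) _ k] rot by simp
  then show ?thesis
    using fixed_imp_antiper[OF assms(1,2), of k] k assms(3) by simp
qed

lemma ex_sign: "(\<exists>e::real. (e = 1 \<or> e = - 1) \<and> P e) \<longleftrightarrow> P 1 \<or> P (- 1)"
  by blast

lemma SI_iff:
  "(m, r) \<in> SI l \<longleftrightarrow> r > 0 \<and> \<not> constriction (1 / (2 * r)) (real l / (2 * r)) (m / r) \<and>
    (\<exists>s. even (s - int l) \<and> rotnum (1 / (2 * r)) (real l / (2 * r)) (m / r) = of_int s) \<and>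
    (\<exists>e. (e = 1 \<or> e = - 1) \<and> fixes_mod (poincare (1 / (2 * r)) (real l / (2 * r)) (m / r)) (e * pi / 2))"
proof -
  have par: "s mod 2 = int l mod 2 \<longleftrightarrow> even (s - int l)" for s
    by presburger
  have "real l / (2 * r) = real l * (1 / (2 * r))"
    by simp
  then show ?thesis
    unfolding ex_sign[of "\<lambda>e. fixes_mod _ (e * pi / 2)"] mult_1 mult_minus1
    unfolding SI_def gen_simple_int_def bdry_def bdry_plus_def bdry_minus_def phase_lock_def par[symmetric]
    by blast
qed

text \<open>For m = 0 an identical Poincare map is a growth point, which \<open>SI\<close> admits,
  so the mirror argument is confined to nonzero m.\<close>

lemma SI_chQ:
  assumes SI: "(m, r) \<in> SI l" and l: "l \<ge> 1" and e: "e = 1 \<or> e = - 1"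
    and fixed: "fixes_mod (poincare (1 / (2 * r)) (real l / (2 * r)) (m / r)) (e * pi / 2)"
  shows "chQ l m (e * r) = 0"
proof -
  obtain s where r: "r > 0" and nc: "\<not> constriction (1 / (2 * r)) (real l / (2 * r)) (m / r)"
    and s: "even (s - int l)" "rotnum (1 / (2 * r)) (real l / (2 * r)) (m / r) = of_int s"
    using SI unfolding SI_iff by blast
  obtain F where F: "antiper l m (e * r) F"
    using fixes_antiper[OF r e s fixed] by blast
  obtain x k where x: "rsys l m (e * r) x" "bseq x" "x k \<noteq> 0"
    using antiper_to_rsys[OF F] by blast
  show ?thesis
  proof (cases "m = 0")
    case True
    then show ?thesis
      using rsys_chQ_zero_m0[of l "e * r" x k] x r e l by auto
  next
    case False
    have "x (- 1) = 0"
    proof (rule ccontr)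
      assume "x (- 1) \<noteq> 0"
      then obtain x' k' where "rsys l m (- (e * r)) x'" "bseq x'" "x' k' \<noteq> 0"
        using rsys_mirror[OF x(1,2) _ False l] by blast
      then obtain G where G: "antiper l m (- (e * r)) G"
        using rsys_to_antiper by blast
      have "circle_id (\<lambda>x. phi r l m x (2 * pi))"
        using antiper_both_imp_circle_id[OF r, of l m] F G e by auto
      then have "constriction (1 / (2 * r)) (real l / (2 * r)) (m / r)"
        using s(2) False r unfolding constriction_def poincare_phi[symmetric] phase_lock_def by auto
      with nc show False ..
    qed
    then show ?thesis
      using rsys_chQ_zero[OF x(1) False l _ x(3)] by blast
  qed
qed

text \<open>An identical Poincare map would give a bounded solution for the opposite sign as well.
  For small m that one also has \<open>x (- 1) = 0\<close>, so Q would vanish at both R and -R,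
  against \<open>chQ_mirror\<close>.\<close>

lemma chQ_SI0:
  assumes l: "l \<ge> 1" and e: "e = 1 \<or> e = - 1" and m: "m \<noteq> 0" "\<bar>m\<bar> \<le> 1 / 2" and r: "r > 0"
    and zero: "chQ l m (e * r) = 0"
  shows "(m, r) \<in> SI0 l \<and> fixes_mod (poincare (1 / (2 * r)) (real l / (2 * r)) (m / r)) (e * pi / 2)"
proof -
  obtain F where F: "antiper l m (e * r) F"
    using rsys_from_zero[OF zero m(1) l] rsys_to_antiper by blast
  obtain s :: int where s: "even (s - int l)" "rotnum (1 / (2 * r)) (real l / (2 * r)) (m / r) = of_int s"
    "fixes_mod (poincare (1 / (2 * r)) (real l / (2 * r)) (m / r)) (e * pi / 2)"
    using antiper_fixes[OF r e F] by blast
  have "\<not> circle_id (poincare (1 / (2 * r)) (real l / (2 * r)) (m / r))"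
  proof
    assume "circle_id (poincare (1 / (2 * r)) (real l / (2 * r)) (m / r))"
    then have "fixes_mod (poincare (1 / (2 * r)) (real l / (2 * r)) (m / r)) ((- e) * pi / 2)"
      unfolding circle_id_def by blast
    then obtain G where "antiper l m (- e * r) G"
      using fixes_antiper[OF r _ s(1,2), of "- e"] e by auto
    then obtain x k where x: "rsys l m (- (e * r)) x" "bseq x" "x k \<noteq> 0"
      using antiper_to_rsys by fastforce
    have "x (- 1) = 0"
      using rsys_divergent[OF x(1,2) m _ l] e r by auto
    then have "chQ l m (- (e * r)) = 0"
      using rsys_chQ_zero[OF x(1) m(1) l _ x(3)] by blast
    then show False
      using chQ_mirror[OF m(1) l zero] by simp
  qed
  then show ?thesis
    using s r m(1) e unfolding SI0_def by (auto simp: SI_iff constriction_def growth_point_def)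
qed

section \<open>Infinitely many real zeros near m = 0\<close>

lemma continuous_on_chn:
  fixes f g :: "real \<Rightarrow> real"
  assumes "continuous_on UNIV f" "continuous_on UNIV g"
  shows "continuous_on UNIV (\<lambda>t. chn l (f t) (g t) n)"
proof -
  have c: "continuous_on UNIV (\<lambda>t. chc l (f t) k)" for k
    using assms by (cases "even k") (auto simp: chc_def intro!: continuous_intros)
  have "continuous_on UNIV (\<lambda>t. chn l (f t) (g t) n) \<and> continuous_on UNIV (\<lambda>t. chn l (f t) (g t) (Suc n))"
    by (induction n) (auto intro!: continuous_intros assms c)
  then show ?thesis
    by blast
qed

lemma continuous_on_chQ:
  fixes f g :: "real \<Rightarrow> real"
  assumes "continuous_on UNIV f" "continuous_on UNIV g"
  shows "continuous_on UNIV (\<lambda>t. chQ l (f t) (g t))"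
  using assms by (cases "odd l") (auto simp: chQ_def intro!: continuous_intros continuous_on_chn)

text \<open>At \<open>m = 0\<close> the polynomial changes sign at \<open>r\<^sup>2 = l - 1\<close>, its smallest positive root.\<close>

lemma chn_sign_change:
  fixes e :: real
  assumes e: "e = 1 \<or> e = - 1" and k: "k \<ge> 1" "2 * k < l"
    and a: "a \<ge> 0" "a\<^sup>2 = real l - 3 / 2" "b \<ge> 0" "b\<^sup>2 = real l - 1 / 2"
  shows "chn l 0 (e * a) (Suc (2 * k)) * chn l 0 (e * b) (Suc (2 * k)) < 0"
  using k
proof (induction k rule: nat_induct_at_least)
  case base
  have step: "chn l 0 (e * c) (Suc (2 * 1)) = e * c * (c\<^sup>2 - (real l - 1))" for c
    using e by (auto simp: numeral_2_eq_2 chc_def power2_eq_square algebra_simps)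
  have "a\<^sup>2 > 0" "b\<^sup>2 > 0"
    using base a by simp_all
  then have "a \<noteq> 0" "b \<noteq> 0"
    unfolding zero_less_power2 .
  then have "a > 0" "b > 0"
    using a by (simp_all add: order_less_le)
  moreover have "(e * a * (a\<^sup>2 - (real l - 1))) * (e * b * (b\<^sup>2 - (real l - 1))) = - (a * b) / 4"
    unfolding a using e by auto
  ultimately show ?case
    unfolding step by simp
next
  case (Suc k)
  have step: "chn l 0 (e * c) (Suc (2 * Suc k)) =
      (c\<^sup>2 - real (Suc k) * (real l - real (Suc k))) * chn l 0 (e * c) (Suc (2 * k))" for c
    using e by (auto simp: chc_def power2_eq_square algebra_simps)
  \<comment> \<open>The product is the excess of i (l - i) over 2 (l - 2) for i = k + 1. So all
    other roots i (l - i) lie above l - 1/2, and their factors are negative at both a and b.\<close>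
  have "(real k - 1) * (real l - real k - 3) \<ge> 0"
    using Suc.prems Suc.hyps by (intro mult_nonneg_nonneg) auto
  then have "real (Suc k) * (real l - real (Suc k)) \<ge> 2 * (real l - 2)"
    by (simp add: algebra_simps)
  moreover have "2 * (real l - 2) > real l - 1 / 2"
    using Suc.prems Suc.hyps by auto
  ultimately have "a\<^sup>2 - real (Suc k) * (real l - real (Suc k)) < 0" "b\<^sup>2 - real (Suc k) * (real l - real (Suc k)) < 0"
    unfolding a by linarith+
  then have "(a\<^sup>2 - real (Suc k) * (real l - real (Suc k))) * (b\<^sup>2 - real (Suc k) * (real l - real (Suc k))) > 0"
    by (rule mult_neg_neg)
  moreover have "chn l 0 (e * a) (Suc (2 * k)) * chn l 0 (e * b) (Suc (2 * k)) < 0"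
    using Suc by simp
  ultimately have "((a\<^sup>2 - real (Suc k) * (real l - real (Suc k))) * (b\<^sup>2 - real (Suc k) * (real l - real (Suc k))))
      * (chn l 0 (e * a) (Suc (2 * k)) * chn l 0 (e * b) (Suc (2 * k))) < 0"
    by (rule mult_pos_neg)
  then show ?case
    unfolding step by (simp only: mult_ac)
qed

lemma chQ_sign_change:
  fixes e :: real
  assumes l: "l \<ge> 3" and e: "e = 1 \<or> e = - 1"
    and a: "a \<ge> 0" "a\<^sup>2 = real l - 3 / 2" "b \<ge> 0" "b\<^sup>2 = real l - 1 / 2"
  shows "chQ l 0 (e * a) * chQ l 0 (e * b) < 0"
proof (cases "odd l")
  case True
  then obtain k where k: "l = Suc (2 * k)"
    by (auto elim: oddE)
  have "1 \<le> k" "2 * k < l"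
    using l k by simp_all
  from chn_sign_change[OF e this a] have "chn l 0 (e * a) l * chn l 0 (e * b) l < 0"
    unfolding k[symmetric] .
  moreover have "chQ l 0 R = chn l 0 R l" for R :: real
    using True by (simp add: chQ_def)
  ultimately show ?thesis
    by (simp only:)
next
  case False
  then obtain q where q: "l = 2 * q"
    by (auto elim: evenE)
  define k where "k = q - 1"
  have k: "l = 2 * Suc k" "k \<ge> 1"
    using l q by (simp_all add: k_def)
  \<comment> \<open>For even l the loop contributes the factor e c - l/2, negative at both points
    because l - 1/2 < (l/2)^2.\<close>
  have step: "chQ l 0 (e * c) = (e * c - real (Suc k)) * chn l 0 (e * c) (Suc (2 * k))" for c
    by (simp add: chQ_def k(1) chc_def algebra_simps)
  have "real l - 1 / 2 < (real (Suc k))\<^sup>2"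
  proof -
    have "real k * real k \<ge> real k * 1"
      using k(2) by (intro mult_left_mono) auto
    moreover have "real k \<ge> 1"
      using k(2) by simp
    moreover have "(real (Suc k))\<^sup>2 = real k * real k + 2 * real k + 1"
      by (simp add: power2_eq_square algebra_simps)
    moreover have "real l = 2 * real k + 2"
      by (simp add: k(1))
    ultimately show ?thesis
      by linarith
  qed
  then have "a\<^sup>2 < (real (Suc k))\<^sup>2" "b\<^sup>2 < (real (Suc k))\<^sup>2"
    unfolding a by linarith+
  then have "a < real (Suc k)" "b < real (Suc k)"
    by (auto intro: power2_less_imp_less)
  then have "e * a - real (Suc k) < 0" "e * b - real (Suc k) < 0"
    using e a by auto
  then have "(e * a - real (Suc k)) * (e * b - real (Suc k)) > 0"
    by (rule mult_neg_neg)
  moreover have "chn l 0 (e * a) (Suc (2 * k)) * chn l 0 (e * b) (Suc (2 * k)) < 0"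
    using chn_sign_change[OF e k(2) _ a] k by simp
  ultimately have "((e * a - real (Suc k)) * (e * b - real (Suc k)))
      * (chn l 0 (e * a) (Suc (2 * k)) * chn l 0 (e * b) (Suc (2 * k))) < 0"
    by (rule mult_pos_neg)
  then show ?thesis
    unfolding step by (simp only: mult_ac)
qed

text \<open>For l >= 3 the sign change at m = 0 persists for small m, and the intermediate value
  theorem applies. For l = 1 and l = 2 the roots are read off from R = m and R^2 - R = m^2; the
  factor e on the parameter gives m the sign that keeps r positive when l = 1.\<close>

lemma infinite_real_roots:
  fixes e :: real
  assumes l: "l \<ge> 1" and e: "e = 1 \<or> e = - 1"
  shows "infinite {m. m \<noteq> 0 \<and> \<bar>m\<bar> \<le> 1 / 2 \<and> (\<exists>r>0. chQ l m (e * r) = 0)}" (is "infinite ?M")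
proof -
  have inf: "infinite ((*) e ` {0<..<c})" if "c > 0" for c
    using that e infinite_Ioo[of 0 c] by (subst finite_image_iff) (auto simp: inj_on_def)
  consider "l = 1" | "l = 2" | "l \<ge> 3"
    using l by linarith
  then show ?thesis
  proof cases
    case 1
    have "(*) e ` {0<..<1 / 2} \<subseteq> ?M"
      using e by (auto simp: 1 chQ_def)
    then show ?thesis
      using inf[of "1 / 2"] infinite_super by auto
  next
    case 2
    have "(*) e ` {0<..<1 / 2} \<subseteq> ?M"
    proof clarify
      fix t :: real assume t: "t \<in> {0<..<1 / 2}"
      define s where "s = sqrt (1 + 4 * t\<^sup>2)"
      have s: "s\<^sup>2 = 1 + 4 * t\<^sup>2" "s > 1"
        using t by (simp_all add: s_def)
      have "chQ 2 (e * t) (e * ((e + s) / 2)) = 0"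
        using e s(1) by (auto simp: chQ_def numeral_2_eq_2 chc_def power2_eq_square field_simps)
      moreover have "(e + s) / 2 > 0"
        using e s(2) by auto
      ultimately have "\<exists>r>0. chQ l (e * t) (e * r) = 0"
        unfolding 2 by blast
      then show "e * t \<noteq> 0 \<and> \<bar>e * t\<bar> \<le> 1 / 2 \<and> (\<exists>r>0. chQ l (e * t) (e * r) = 0)"
        using e t 2 by auto
    qed
    then show ?thesis
      using inf[of "1 / 2"] infinite_super by auto
  next
    case 3
    define a where "a = sqrt (real l - 3 / 2)"
    define b where "b = sqrt (real l - 1 / 2)"
    have a: "a \<ge> 0" "a\<^sup>2 = real l - 3 / 2" "a > 0" and b: "b \<ge> 0" "b\<^sup>2 = real l - 1 / 2" and ab: "a \<le> b"
      using 3 by (simp_all add: a_def b_def)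
    have "continuous_on UNIV (\<lambda>m. chQ l m (e * a) * chQ l m (e * b))"
      by (intro continuous_on_mult continuous_on_chQ continuous_intros)
    then have "open ((\<lambda>m. chQ l m (e * a) * chQ l m (e * b)) -` {..<0})"
      by (intro open_vimage) auto
    moreover have "0 \<in> (\<lambda>m. chQ l m (e * a) * chQ l m (e * b)) -` {..<0}"
      using chQ_sign_change[OF 3 e a(1,2) b] by simp
    ultimately obtain \<delta> where \<delta>: "\<delta> > 0" "\<And>m. \<bar>m\<bar> < \<delta> \<Longrightarrow> chQ l m (e * a) * chQ l m (e * b) < 0"
      unfolding open_dist by (force simp: dist_real_def)
    have root: "\<exists>r>0. chQ l m (e * r) = 0" if "\<bar>m\<bar> < \<delta>" for m
    proof -
      have cont: "continuous_on {a..b} (\<lambda>r. chQ l m (e * r))"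
        by (rule continuous_on_subset[OF continuous_on_chQ]) (auto intro!: continuous_intros)
      have "\<exists>r\<ge>a. r \<le> b \<and> chQ l m (e * r) = 0"
      proof (cases "chQ l m (e * a) < 0")
        case True
        then have "chQ l m (e * b) > 0"
          using \<delta>(2)[OF that] by (auto simp: mult_less_0_iff)
        then show ?thesis
          using True ab cont by (intro IVT') auto
      next
        case False
        then have "chQ l m (e * a) \<ge> 0" "chQ l m (e * b) \<le> 0"
          using \<delta>(2)[OF that] by (auto simp: mult_less_0_iff)
        then show ?thesis
          using ab cont by (intro IVT2') auto
      qed
      then show ?thesis
        using a(3) by (meson less_le_trans)
    qed
    have "(*) e ` {0<..<min \<delta> (1 / 2)} \<subseteq> ?M"
      using e root by auto
    then show ?thesis
      using inf[of "min \<delta> (1 / 2)"] \<delta>(1) infinite_super by auto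
  qed
qed

lemma infinite_if_infinite_fst:
  assumes "infinite M" "\<And>m. m \<in> M \<Longrightarrow> \<exists>r. (m, r) \<in> S"
  shows "infinite S"
proof
  assume "finite S"
  moreover have "M \<subseteq> fst ` S"
    using assms(2) by force
  ultimately show False
    using assms(1) finite_subset by blast
qed

lemma chQ_of_real: "chQ l (complex_of_real m) (complex_of_real e * complex_of_real r) = complex_of_real (chQ l m (e * r))"
  using chQ_hom[OF rhom_of_real, of l m "e * r"] by simp

theorem theorem1p20:
  fixes l :: nat
  assumes "l \<ge> 1"
  shows "irreducible_alg ((\<lambda>(\<mu>, r). (\<mu>, r ^ 2)) ` SI_hat l)
       \<and> algebraic_curve ((\<lambda>(\<mu>, r). (\<mu>, r ^ 2)) ` SI_hat l)
       \<and> irr_components (SI_hat l) = {SI_hat_plus l, SI_hat_minus l}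
       \<and> SI_hat_plus l \<noteq> SI_hat_minus l
       \<and> algebraic_curve (SI_hat_plus l) \<and> algebraic_curve (SI_hat_minus l)"
  unfolding SI_hat_def SI_hat_plus_def SI_hat_minus_def
proof (rule zariski_closures_on_qcurves[OF assms])
  have sub: "SI0 l \<subseteq> SI l"
    by (auto simp: SI0_def)
  show "SI0_plus l \<subseteq> SI l" "SI0_minus l \<subseteq> SI l"
    using sub by (auto simp: SI0_plus_def SI0_minus_def)
  show "complexify (SI0_plus l) \<subseteq> qcurve l 1"
    using SI_chQ[OF _ assms, of _ _ 1] sub chQ_of_real[of l _ 1]
    by (fastforce simp: complexify_def SI0_plus_def qcurve_iff)
  show "complexify (SI0_minus l) \<subseteq> qcurve l (- 1)"
    using SI_chQ[OF _ assms, of _ _ "- 1"] sub chQ_of_real[of l _ "- 1"]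
    by (fastforce simp: complexify_def SI0_minus_def qcurve_iff)
  show "complexify (SI l) \<subseteq> qcurve l 1 \<union> qcurve l (- 1)"
  proof
    fix z assume "z \<in> complexify (SI l)"
    then obtain m r where mr: "(m, r) \<in> SI l" "z = (complex_of_real m, complex_of_real r)"
      by (auto simp: complexify_def)
    then obtain e where e: "e = 1 \<or> e = - 1"
      "fixes_mod (poincare (1 / (2 * r)) (real l / (2 * r)) (m / r)) (e * pi / 2)"
      unfolding SI_iff by blast
    have "chQ l (complex_of_real m) (complex_of_real e * complex_of_real r) = 0"
      using SI_chQ[OF mr(1) assms e] by (simp only: chQ_of_real of_real_0)
    then show "z \<in> qcurve l 1 \<union> qcurve l (- 1)"
      using e(1) by (auto simp: mr(2) qcurve_iff)
  qed
  show "infinite (SI0_plus l)"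
    using infinite_real_roots[OF assms, of 1]
    by (rule infinite_if_infinite_fst) (use chQ_SI0[OF assms, of 1] in \<open>auto simp: SI0_plus_def\<close>)
  show "infinite (SI0_minus l)"
    using infinite_real_roots[OF assms, of "- 1"]
    by (rule infinite_if_infinite_fst) (use chQ_SI0[OF assms, of "- 1"] in \<open>auto simp: SI0_minus_def\<close>)
qed

end
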